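(* Let $p\ge 5$ be a prime and $i\in\mathbb{N}_0$. If $\gamma\in\hat{H}_i$ and $\lambda=\lambda(\gamma)\in\mathbb{N}_0\cup\{\infty\}$, then $L_{i,\lambda}(\gamma)$ is finite; more precisely, there exists $y\in\mathbb{N}_0$ with $\lambda=3i+13-2p+y$ or, equivalently, there exists $y\in\mathbb{N}_0$ with $|L_{i,\lambda}(\gamma)|=p^{2i+13-2p+y}$.
   Context: Let $p$ be a prime, $\mathbb{Q}_p$ the field of $p$-adic numbers, $\mathbb{Z}_p$ the $p$-adic integers, $\theta$ a primitive $p$-th root of unity, and $K=\mathbb{Q}_p(\theta)$. Let $\mathcal{O}$ be the maximal order (ring of integers) of $K$ and $\mathfrak{p}$ its unique maximal ideal, generated by $\kappa=\theta-1$. For $n \in \mathbb{N}_0$, $\mathfrak{p}^n=\kappa^n\mathcal{O}$ has index $p^n$ in $\mathcal{O}$; put $\mathfrak{p}^\infty=\{0\}$. For $i\in\mathbb{N}_0$, $\mathfrak{p}^i\wedge\mathfrak{p}^i$ is the exterior square over $\mathbb{Z}_p$, on which $\theta$ acts diagonally ($x\wedge y\mapsto\theta x\wedge\theta y$). $H_i=\mathrm{Hom}_\theta(\mathfrak{p}^i\wedge\mathfrak{p}^i,\mathfrak{p}^{2i+1})$ is the set of $\mathbb{Z}_p$-linear maps $\gamma:\mathfrak{p}^i\wedge\mathfrak{p}^i\to\mathfrak{p}^{2i+1}$ with $\gamma(\theta x\wedge\theta y)=\theta\,\gamma(x\wedge y)$, and $\hat{H}_i=\{\gamma\in H_i\mid\gamma\text{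 surjective}\}$. For $\gamma\in\hat{H}_i$ and $u,v,w\in\mathfrak{p}^i$ let $J_\gamma(u,v,w)=\gamma(\gamma(u\wedge v)\wedge w)+\gamma(\gamma(v\wedge w)\wedge u)+\gamma(\gamma(w\wedge u)\wedge v)$. Let $J(\gamma)$ be the ideal of $\mathcal{O}$ generated by all $J_\gamma(u,v,w)$ with $u,v,w\in\mathfrak{p}^i$, and let $\lambda(\gamma)\in\mathbb{N}_0\cup\{\infty\}$ be defined by $J(\gamma)=\mathfrak{p}^{\lambda(\gamma)}$. $L_{i,m}(\gamma)$ denotes the set $\mathfrak{p}^i/\mathfrak{p}^m$ with its natural addition and the multiplication $[x+\mathfrak{p}^m,y+\mathfrak{p}^m]=\gamma(x\wedge y)+\mathfrak{p}^m$; $|L_{i,m}(\gamma)|$ is the cardinality of this set. *)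

theory Defs
  imports
    Complex_Main
    "HOL-Library.Poly_Mapping"
    "HOL-Library.Extended_Nat"
    "HOL-Library.FuncSet"
    "HOL-Computational_Algebra.Polynomial"
begin

section \<open>The $p$-adic integers\<close>

text \<open>The inverse limit of the rings of integers modulo $p^n$: a $p$-adic integer is the
  sequence of its canonical residues modulo $p^n$.\<close>

definition padic_ints :: "nat \<Rightarrow> (nat \<Rightarrow> int) set" where
  "padic_ints p =
     {x. \<forall>n. x n \<in> {0..<int p ^ n} \<and> x (Suc n) mod int p ^ n = x n}"

definition padic_add :: "nat \<Rightarrow> (nat \<Rightarrow> int) \<Rightarrow> (nat \<Rightarrow> int) \<Rightarrow> (nat \<Rightarrow> int)" where
  "padic_add p x y = (\<lambda>n. (x n + y n) mod int p ^ n)"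

definition padic_mult :: "nat \<Rightarrow> (nat \<Rightarrow> int) \<Rightarrow> (nat \<Rightarrow> int) \<Rightarrow> (nat \<Rightarrow> int)" where
  "padic_mult p x y = (\<lambda>n. (x n * y n) mod int p ^ n)"

definition padic_one :: "nat \<Rightarrow> (nat \<Rightarrow> int)" where
  "padic_one p = (\<lambda>n. 1 mod int p ^ n)"

definition padic_embedding :: "nat \<Rightarrow> ((nat \<Rightarrow> int) \<Rightarrow> 'k::field) \<Rightarrow> bool" where
  "padic_embedding p \<iota> \<longleftrightarrow>
     inj_on \<iota> (padic_ints p) \<and>
     \<iota> (padic_one p) = 1 \<and>
     (\<forall>x\<in>padic_ints p. \<forall>y\<in>padic_ints p.
        \<iota> (padic_add p x y) = \<iota> x + \<iota> y \<and> \<iota> (padic_mult p x y) = \<iota> x * \<iota> y)"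

section \<open>The field $K$ obtained by adjoining a primitive root of unity\<close>

definition fractions :: "'k::field set \<Rightarrow> 'k set" where
  "fractions Z = {a / b |a b. a \<in> Z \<and> b \<in> Z \<and> b \<noteq> 0}"

definition is_subfield :: "'k::field set \<Rightarrow> bool" where
  "is_subfield F \<longleftrightarrow>
     0 \<in> F \<and> 1 \<in> F \<and>
     (\<forall>x\<in>F. \<forall>y\<in>F. x + y \<in> F \<and> x * y \<in> F) \<and>
     (\<forall>x\<in>F. - x \<in> F \<and> inverse x \<in> F)"

definition primitive_root_of_unity :: "nat \<Rightarrow> 'k::field \<Rightarrow> bool" where
  "primitive_root_of_unity n \<theta> \<longleftrightarrow> \<theta> ^ n = 1 \<and> (\<forall>k. 0 < k \<and> k < n \<longrightarrow> \<theta> ^ k \<noteq> 1)"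

text \<open>The whole type \<open>'k\<close> plays the role of $K = Q_p(\theta)$. The $p$-adic integers are identified
  with their image under \<open>\<iota>\<close>, so that $Q_p$ is the subfield of fractions of that image. This
  determines $K$ with its embedding and \<open>\<theta>\<close> up to isomorphism.\<close>

definition padic_cyclotomic_field ::
    "nat \<Rightarrow> ((nat \<Rightarrow> int) \<Rightarrow> 'k::field) \<Rightarrow> 'k \<Rightarrow> bool" where
  "padic_cyclotomic_field p \<iota> \<theta> \<longleftrightarrow>
     padic_embedding p \<iota> \<and>
     primitive_root_of_unity p \<theta> \<and>
     is_subfield hull (insert \<theta> (fractions (\<iota> ` padic_ints p))) = UNIV"

text \<open>In the rest of this theory \<open>Z\<close> stands for the copy of the $p$-adic integers inside $K$.\<close>

definition max_order :: "'k::field set \<Rightarrow> 'k set" where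
  "max_order Z =
     {x. \<exists>f :: 'k poly. lead_coeff f = 1 \<and> (\<forall>n. coeff f n \<in> Z) \<and> poly f x = 0}"

fun ppow :: "'k::field set \<Rightarrow> 'k \<Rightarrow> enat \<Rightarrow> 'k set" where
  "ppow Z \<theta> (enat n) = (\<lambda>x. (\<theta> - 1) ^ n * x) ` max_order Z"
| "ppow Z \<theta> \<infinity> = {0}"

section \<open>The exterior square over the $p$-adic integers\<close>

text \<open>For a \<open>Z\<close>-submodule \<open>M\<close> of $K$, the exterior square is the quotient of the free \<open>Z\<close>-module
  on \<open>M \<times> M\<close> by the relations of bilinearity and \<open>x \<and> x = 0\<close>; its elements are classes of
  formal linear combinations.\<close>

definition free_module :: "'k::field set \<Rightarrow> 'k set \<Rightarrow> ('k \<times> 'k \<Rightarrow>\<^sub>0 'k) set" where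
  "free_module Z M = {f. Poly_Mapping.keys f \<subseteq> M \<times> M \<and> range (Poly_Mapping.lookup f) \<subseteq> Z}"

definition scale :: "'k::field \<Rightarrow> ('k \<times> 'k \<Rightarrow>\<^sub>0 'k) \<Rightarrow> ('k \<times> 'k \<Rightarrow>\<^sub>0 'k)" where
  "scale a f = Poly_Mapping.map ((*) a) f"

definition is_submodule :: "'k::field set \<Rightarrow> ('k \<times> 'k \<Rightarrow>\<^sub>0 'k) set \<Rightarrow> bool" where
  "is_submodule Z N \<longleftrightarrow>
     0 \<in> N \<and> (\<forall>f\<in>N. \<forall>g\<in>N. f + g \<in> N) \<and> (\<forall>a\<in>Z. \<forall>f\<in>N. scale a f \<in> N)"

definition wedge_relators :: "'k::field set \<Rightarrow> 'k set \<Rightarrow> ('k \<times> 'k \<Rightarrow>\<^sub>0 'k) set" where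
  "wedge_relators Z M =
     (let s = (\<lambda>x y. Poly_Mapping.single (x, y) 1) in
       {s (x + y) z - s x z - s y z |x y z. x \<in> M \<and> y \<in> M \<and> z \<in> M} \<union>
       {s z (x + y) - s z x - s z y |x y z. x \<in> M \<and> y \<in> M \<and> z \<in> M} \<union>
       {s (a * x) y - scale a (s x y) |a x y. a \<in> Z \<and> x \<in> M \<and> y \<in> M} \<union>
       {s x (a * y) - scale a (s x y) |a x y. a \<in> Z \<and> x \<in> M \<and> y \<in> M} \<union>
       {s x x |x. x \<in> M})"

definition wedge_rel ::
    "'k::field set \<Rightarrow> 'k set \<Rightarrow> (('k \<times> 'k \<Rightarrow>\<^sub>0 'k) \<times> ('k \<times> 'k \<Rightarrow>\<^sub>0 'k)) set" where
  "wedge_rel Z M =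
     {(f, g). f \<in> free_module Z M \<and> g \<in> free_module Z M \<and>
        f - g \<in> is_submodule Z hull wedge_relators Z M}"

definition wedge_class ::
    "'k::field set \<Rightarrow> 'k set \<Rightarrow> ('k \<times> 'k \<Rightarrow>\<^sub>0 'k) \<Rightarrow> ('k \<times> 'k \<Rightarrow>\<^sub>0 'k) set" where
  "wedge_class Z M f = wedge_rel Z M `` {f}"

definition exterior_square :: "'k::field set \<Rightarrow> 'k set \<Rightarrow> ('k \<times> 'k \<Rightarrow>\<^sub>0 'k) set set" where
  "exterior_square Z M = free_module Z M // wedge_rel Z M"

definition wedge :: "'k::field set \<Rightarrow> 'k set \<Rightarrow> 'k \<Rightarrow> 'k \<Rightarrow> ('k \<times> 'k \<Rightarrow>\<^sub>0 'k) set" where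
  "wedge Z M x y = wedge_class Z M (Poly_Mapping.single (x, y) 1)"

text \<open>Addition and scalar multiplication of classes are given on representatives.\<close>

definition wedge_linear ::
    "'k::field set \<Rightarrow> 'k set \<Rightarrow> (('k \<times> 'k \<Rightarrow>\<^sub>0 'k) set \<Rightarrow> 'k) \<Rightarrow> bool" where
  "wedge_linear Z M \<gamma> \<longleftrightarrow>
     (\<forall>f\<in>free_module Z M. \<forall>g\<in>free_module Z M.
        \<gamma> (wedge_class Z M (f + g)) = \<gamma> (wedge_class Z M f) + \<gamma> (wedge_class Z M g)) \<and>
     (\<forall>a\<in>Z. \<forall>f\<in>free_module Z M.
        \<gamma> (wedge_class Z M (scale a f)) = a * \<gamma> (wedge_class Z M f))"

section \<open>Homomorphisms compatible with \<open>\<theta>\<close> and the associated structures\<close>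

definition Hom_theta ::
    "'k::field set \<Rightarrow> 'k \<Rightarrow> nat \<Rightarrow> (('k \<times> 'k \<Rightarrow>\<^sub>0 'k) set \<Rightarrow> 'k) set" where
  "Hom_theta Z \<theta> i =
     {\<gamma>. \<gamma> \<in> exterior_square Z (ppow Z \<theta> i) \<rightarrow> ppow Z \<theta> (enat (2 * i + 1)) \<and>
         wedge_linear Z (ppow Z \<theta> i) \<gamma> \<and>
         (\<forall>x\<in>ppow Z \<theta> i. \<forall>y\<in>ppow Z \<theta> i.
            \<gamma> (wedge Z (ppow Z \<theta> i) (\<theta> * x) (\<theta> * y)) = \<theta> * \<gamma> (wedge Z (ppow Z \<theta> i) x y))}"

definition surj_Hom_theta ::
    "'k::field set \<Rightarrow> 'k \<Rightarrow> nat \<Rightarrow> (('k \<times> 'k \<Rightarrow>\<^sub>0 'k) set \<Rightarrow> 'k) set" where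
  "surj_Hom_theta Z \<theta> i =
     {\<gamma> \<in> Hom_theta Z \<theta> i.
        \<gamma> ` exterior_square Z (ppow Z \<theta> i) = ppow Z \<theta> (enat (2 * i + 1))}"

definition jacobi ::
    "'k::field set \<Rightarrow> 'k \<Rightarrow> nat \<Rightarrow> (('k \<times> 'k \<Rightarrow>\<^sub>0 'k) set \<Rightarrow> 'k) \<Rightarrow> 'k \<Rightarrow> 'k \<Rightarrow> 'k \<Rightarrow> 'k" where
  "jacobi Z \<theta> i \<gamma> u v w =
     (let b = (\<lambda>x y. \<gamma> (wedge Z (ppow Z \<theta> i) x y))
      in b (b u v) w + b (b v w) u + b (b w u) v)"

definition is_ideal :: "'k::field set \<Rightarrow> 'k set \<Rightarrow> bool" where
  "is_ideal R I \<longleftrightarrow>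
     I \<subseteq> R \<and> 0 \<in> I \<and> (\<forall>x\<in>I. \<forall>y\<in>I. x + y \<in> I) \<and> (\<forall>r\<in>R. \<forall>x\<in>I. r * x \<in> I)"

definition jacobi_ideal ::
    "'k::field set \<Rightarrow> 'k \<Rightarrow> nat \<Rightarrow> (('k \<times> 'k \<Rightarrow>\<^sub>0 'k) set \<Rightarrow> 'k) \<Rightarrow> 'k set" where
  "jacobi_ideal Z \<theta> i \<gamma> =
     is_ideal (max_order Z) hull
       {jacobi Z \<theta> i \<gamma> u v w |u v w. u \<in> ppow Z \<theta> i \<and> v \<in> ppow Z \<theta> i \<and> w \<in> ppow Z \<theta> i}"

definition jacobi_exponent ::
    "'k::field set \<Rightarrow> 'k \<Rightarrow> nat \<Rightarrow> (('k \<times> 'k \<Rightarrow>\<^sub>0 'k) set \<Rightarrow> 'k) \<Rightarrow> enat" where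
  "jacobi_exponent Z \<theta> i \<gamma> = (THE l. jacobi_ideal Z \<theta> i \<gamma> = ppow Z \<theta> l)"

record 'a add_bracket =
  carrier :: "'a set"
  add :: "'a \<Rightarrow> 'a \<Rightarrow> 'a"
  bracket :: "'a \<Rightarrow> 'a \<Rightarrow> 'a"

definition coset_rel :: "'k::field set \<Rightarrow> ('k \<times> 'k) set" where
  "coset_rel N = {(x, y). x - y \<in> N}"

text \<open>The unions below are over representatives; they are single cosets whenever the operation
  is well defined.\<close>

definition quot_struct ::
    "'k::field set \<Rightarrow> 'k \<Rightarrow> nat \<Rightarrow> enat \<Rightarrow> (('k \<times> 'k \<Rightarrow>\<^sub>0 'k) set \<Rightarrow> 'k) \<Rightarrow> 'k set add_bracket" where
  "quot_struct Z \<theta> i m \<gamma> =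
     (let M = ppow Z \<theta> i; r = coset_rel (ppow Z \<theta> m) in
      \<lparr>carrier = M // r,
       add = (\<lambda>A B. \<Union>x\<in>A. \<Union>y\<in>B. r `` {x + y}),
       bracket = (\<lambda>A B. \<Union>x\<in>A. \<Union>y\<in>B. r `` {\<gamma> (wedge Z M x y)})\<rparr>)"

end

theory Submission
  imports
    "Jordan_Normal_Form.Char_Poly"
    "HOL-Number_Theory.Cong"
    Defs
begin

text \<open>Let \<open>\<sigma>_a\<close> be the automorphism \<open>\<theta> \<mapsto> \<theta>^a\<close>. A discrete Fourier transform over the residues modulo
  \<open>p\<close> shows that a form \<open>\<gamma>\<close> in \<open>Hom_theta\<close> satisfies
  \<open>\<sigma>_s (\<gamma> (u \<and> v)) = \<Sum> T x y * \<sigma>_x u * \<sigma>_y v\<close>, where the sum is over the residues with \<open>x + y = s\<close>.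
  The \<open>T x y\<close> are the structure constants of an algebra with one basis vector for every nonzero
  residue. If the Jacobi expressions of \<open>\<gamma>\<close> vanish, then this is a Lie algebra by the independence
  of the \<open>\<sigma>_x\<close>, and Engel's argument yields a central basis vector. Conjugation permutes the basis
  vectors, hence all structure constants vanish, which contradicts the surjectivity of \<open>\<gamma>\<close>.

  The inverse Fourier transform gives the \<open>\<kappa>\<close>-adic valuation \<open>2 - p\<close> as a lower bound for \<open>T x y\<close>. This implies
  \<open>\<lambda> \<ge> 3 i + 3 - p\<close>, which is enough for \<open>p \<ge> 11\<close>. For \<open>p = 7\<close> the two independent structure
  constants are found by elimination and have valuation at least \<open>-2\<close>. For \<open>p = 5\<close> the only
  one is integral, and the Jacobi expression is a multiple of the determinant of three conjugates
  of \<open>u\<close>, \<open>v\<close>, \<open>w\<close>, whose valuation is at least \<open>3 i + 3\<close>.\<close>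

section \<open>Subrings and integral elements\<close>

text \<open>The coordinates \<open>sg x u\<close> diagonalize multiplication by \<theta>, which acts
  on the coordinate with index x as multiplication by \<theta>^x. Equivariance of \<gamma> therefore
  leaves only the terms with x + y = s. Residue 0 is no index, because no automorphism sends
  \<theta> to 1, and Engel's argument lives on this gap in the grading. That argument only excludes
  \<lambda> = \<infinity>; it gives no upper bound. The conjugates themselves have to be
  constructed, which rests on the irreducibility of the cyclotomic polynomial over the p-adic
  numbers. Here it comes out of total ramification: p is \<kappa>^(p - 1) times a unit. The constant
  13 - 2p belongs to the line through the two special bounds, 3i + 3 at p = 5 and 3i - 1 at p = 7.
  The general bound 3i + 3 - p stays below this line at 5 and 7 and reaches it from p = 10 on, so
  exactly these two primes need their own argument.\<close>

definition polys_over :: "'a::comm_ring_1 set \<Rightarrow> 'a poly set" where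
  "polys_over S = {f. \<forall>n. coeff f n \<in> S}"

definition adjoin :: "'a::comm_ring_1 set \<Rightarrow> 'a \<Rightarrow> 'a set" where
  "adjoin S x = (\<lambda>f. poly f x) ` polys_over S"

locale subring_set =
  fixes S :: "'a::comm_ring_1 set"
  assumes one_closed: "1 \<in> S"
    and add_closed: "x \<in> S \<Longrightarrow> y \<in> S \<Longrightarrow> x + y \<in> S"
    and mult_closed: "x \<in> S \<Longrightarrow> y \<in> S \<Longrightarrow> x * y \<in> S"
    and uminus_closed: "x \<in> S \<Longrightarrow> - x \<in> S"
begin

lemma diff_closed: "x \<in> S \<Longrightarrow> y \<in> S \<Longrightarrow> x - y \<in> S"
  using add_closed[of x "- y"] uminus_closed[of y] by simp

lemma zero_closed: "0 \<in> S"
  using diff_closed[OF one_closed one_closed] by simp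

lemma power_closed: "x \<in> S \<Longrightarrow> x ^ n \<in> S"
  by (induction n) (auto intro: one_closed mult_closed)

lemma sum_closed: "(\<And>i. i \<in> I \<Longrightarrow> f i \<in> S) \<Longrightarrow> sum f I \<in> S"
  by (induction I rule: infinite_finite_induct) (auto intro: zero_closed add_closed)

lemma prod_closed: "(\<And>i. i \<in> I \<Longrightarrow> f i \<in> S) \<Longrightarrow> prod f I \<in> S"
  by (induction I rule: infinite_finite_induct) (auto intro: one_closed mult_closed)

lemma of_nat_closed: "of_nat n \<in> S"
  by (induction n) (auto intro: zero_closed one_closed add_closed)

lemma of_int_closed: "of_int n \<in> S"
  by (cases n) (auto intro: uminus_closed of_nat_closed diff_closed one_closed)

lemma polys_over_pCons: "a \<in> S \<Longrightarrow> f \<in> polys_over S \<Longrightarrow> pCons a f \<in> polys_over S"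
  by (auto simp: polys_over_def coeff_pCons split: nat.splits)

lemma polys_over_0: "0 \<in> polys_over S"
  by (auto simp: polys_over_def zero_closed)

lemma polys_over_const: "a \<in> S \<Longrightarrow> [:a:] \<in> polys_over S"
  by (intro polys_over_pCons polys_over_0)

lemma subring_polys_over: "subring_set (polys_over S)"
proof
  show "1 \<in> polys_over S"
    by (simp add: polys_over_const one_closed one_pCons)
qed (auto simp: polys_over_def coeff_mult intro!: add_closed mult_closed uminus_closed sum_closed)

lemma subring_adjoin: "subring_set (adjoin S x)"
proof -
  interpret P: subring_set "polys_over S" by (rule subring_polys_over)
  show ?thesis
  proof
    show "1 \<in> adjoin S x"
      unfolding adjoin_def by (rule image_eqI[of _ _ 1]) (auto intro: P.one_closed)
  next
    fix a b assume "a \<in> adjoin S x" "b \<in> adjoin S x"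
    then obtain f g where fg: "f \<in> polys_over S" "g \<in> polys_over S" "a = poly f x" "b = poly g x"
      by (auto simp: adjoin_def)
    show "a + b \<in> adjoin S x"
      unfolding adjoin_def by (rule image_eqI[of _ _ "f + g"]) (auto simp: fg intro: P.add_closed)
    show "a * b \<in> adjoin S x"
      unfolding adjoin_def by (rule image_eqI[of _ _ "f * g"]) (auto simp: fg intro: P.mult_closed)
  next
    fix a assume "a \<in> adjoin S x"
    then obtain f where f: "f \<in> polys_over S" "a = poly f x"
      by (auto simp: adjoin_def)
    show "- a \<in> adjoin S x"
      unfolding adjoin_def by (rule image_eqI[of _ _ "- f"]) (auto simp: f intro: P.uminus_closed)
  qed
qed

lemma adjoin_base: "a \<in> S \<Longrightarrow> a \<in> adjoin S x"
  unfolding adjoin_def by (rule image_eqI[of _ _ "[:a:]"]) (auto intro: polys_over_const)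

lemma adjoin_gen: "x \<in> adjoin S x"
  unfolding adjoin_def
  by (rule image_eqI[of _ _ "[:0, 1:]"])
    (auto intro!: polys_over_const polys_over_pCons zero_closed one_closed)

lemma poly_closed: "f \<in> polys_over S \<Longrightarrow> x \<in> S \<Longrightarrow> poly f x \<in> S"
  by (auto simp: poly_altdef polys_over_def intro!: sum_closed mult_closed power_closed)

end

lemma polys_over_mono: "S \<subseteq> T \<Longrightarrow> polys_over S \<subseteq> polys_over T"
  by (auto simp: polys_over_def)

lemma max_order_altdef:
  "max_order Z = {x. \<exists>f. lead_coeff f = 1 \<and> f \<in> polys_over Z \<and> poly f x = 0}"
  by (simp add: max_order_def polys_over_def)

text \<open>Multiplication by \<open>x\<close> on the module spanned by the \<open>v j\<close> has a matrix over \<open>S\<close>, and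
  \<open>x\<close> is a root of its characteristic polynomial.\<close>

lemma integral_if_stable_span:
  fixes S :: "'a::field set" and n :: nat
  assumes "subring_set S"
    and mv: "\<And>j. j < n \<Longrightarrow> x * v j = (\<Sum>k<n. m j k * v k)"
    and mS: "\<And>j k. j < n \<Longrightarrow> k < n \<Longrightarrow> m j k \<in> S"
    and j0: "j0 < n" "v j0 \<noteq> 0"
  shows "x \<in> max_order S"
proof -
  interpret subring_set S by fact
  interpret P: subring_set "polys_over S" by (rule subring_polys_over)
  define M where "M = mat n n (\<lambda>(j, k). m j k)"
  define w where "w = vec n v"
  have M: "M \<in> carrier_mat n n" by (simp add: M_def)
  have w: "w \<in> carrier_vec n" by (simp add: w_def)
  have "M *\<^sub>v w = x \<cdot>\<^sub>v w"
    by (rule eq_vecI)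
      (auto simp: M_def w_def mult_mat_vec_def scalar_prod_def mv lessThan_atLeast0)
  moreover have "w \<noteq> 0\<^sub>v n"
  proof
    assume "w = 0\<^sub>v n"
    then have "w $ j0 = 0" using j0 by simp
    then show False using j0 by (simp add: w_def)
  qed
  ultimately have "eigenvalue M x"
    unfolding eigenvalue_def eigenvector_def using w by (intro exI[of _ w]) (simp add: M_def)
  then have root: "poly (char_poly M) x = 0"
    using eigenvalue_root_char_poly[OF M] by simp
  have "lead_coeff (char_poly M) = 1"
    using degree_monic_char_poly[OF M] by simp
  moreover have "char_poly M \<in> polys_over S"
    unfolding char_poly_def det_def char_poly_matrix_def
    by (auto simp: M_def intro!: P.sum_closed P.mult_closed P.of_int_closed P.prod_closed
        P.zero_closed P.one_closed P.add_closed mS polys_over_pCons polys_over_0 uminus_closed one_closed zero_closed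
        permutes_in_image
        dest: permutes_in_image)
  ultimately show ?thesis
    unfolding max_order_altdef using root by blast
qed

text \<open>Divide the monic equation of \<open>x\<close> by \<open>x ^ (n - 1)\<close>.\<close>

lemma integral_mem_if_inverse_mem:
  fixes S T :: "'a::field set"
  assumes "subring_set T" "S \<subseteq> T" "x \<in> max_order S" "inverse x \<in> T"
  shows "x \<in> T"
proof (cases "x = 0")
  case True
  then show ?thesis using subring_set.zero_closed[OF assms(1)] by simp
next
  case False
  interpret T: subring_set T by fact
  obtain f where f: "lead_coeff f = 1" "f \<in> polys_over S" "poly f x = 0"
    using assms(3) by (auto simp: max_order_altdef)
  define n where "n = degree f"
  have n: "n \<noteq> 0"
  proof
    assume "n = 0"
    then obtain c where "f = [:c:]" by (metis n_def degree_eq_zeroE)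
    then show False using f by simp
  qed
  define y where "y = inverse x"
  have yT: "y \<in> T" using assms(4) by (simp add: y_def)
  have "0 = x * y ^ n * poly f x" using f by simp
  also have "\<dots> = (\<Sum>k\<le>n. coeff f k * (x * (y ^ n * x ^ k)))"
    by (simp add: poly_altdef n_def sum_distrib_left mult_ac)
  also have "\<dots> = (\<Sum>k<n. coeff f k * (x * (y ^ n * x ^ k))) + x * (y ^ n * x ^ n)"
    using f(1) by (simp add: lessThan_Suc_atMost [symmetric] n_def)
  also have "y ^ n * x ^ n = 1"
    using False by (simp add: y_def flip: power_mult_distrib)
  also have "(\<Sum>k<n. coeff f k * (x * (y ^ n * x ^ k))) = (\<Sum>k<n. coeff f k * y ^ (n - 1 - k))"
  proof (rule sum.cong)
    fix k assume "k \<in> {..<n}"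
    then have "n = k + 1 + (n - 1 - k)" by simp
    then have "y ^ n = y ^ k * y * y ^ (n - 1 - k)" by (metis power_add power_one_right)
    moreover have "y ^ k * x ^ k = 1"
      using False by (simp add: y_def flip: power_mult_distrib)
    moreover have "x * y = 1" using False by (simp add: y_def)
    ultimately have "x * (y ^ n * x ^ k) = y ^ (n - 1 - k)"
      by (metis (no_types, lifting) ab_semigroup_mult_class.mult_ac(1) mult.commute mult.left_neutral)
    then show "coeff f k * (x * (y ^ n * x ^ k)) = coeff f k * y ^ (n - 1 - k)" by simp
  qed simp
  finally have "x = - (\<Sum>k<n. coeff f k * y ^ (n - 1 - k))"
    by (simp add: eq_neg_iff_add_eq_0 add.commute)
  also have "\<dots> \<in> T"
    using f(2) assms(2) yT
    by (intro T.uminus_closed T.sum_closed T.mult_closed T.power_closed) (auto simp: polys_over_def)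
  finally show ?thesis .
qed

section \<open>The maximal order as a discrete valuation ring\<close>

text \<open>The axioms on \<open>Z\<close> say that it is a discrete valuation ring with uniformizer
  p and residue field of p elements. The p-adic integers enter only through them; the last section
  verifies them for the image of \<iota>.\<close>

locale cyclotomic_dvr = subring_set Z for Z :: "'k::field set" +
  fixes p :: nat and \<theta> :: 'k
  assumes prime_p: "prime p" and p_ge_5: "p \<ge> 5"
    and Z_residue: "z \<in> Z \<Longrightarrow> \<exists>a<p. \<exists>y\<in>Z. z = of_nat a + of_nat p * y"
    and Z_factor: "z \<in> Z \<Longrightarrow> z \<noteq> 0 \<Longrightarrow> \<exists>n. \<exists>y\<in>Z. z = of_nat p ^ n * y \<and> inverse y \<in> Z"
    and p_nonzero: "(of_nat p :: 'k) \<noteq> 0"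
    and p_nonunit: "inverse (of_nat p) \<notin> Z"
    and primitive: "primitive_root_of_unity p \<theta>"
    and generated: "is_subfield hull (insert \<theta> (fractions Z)) = UNIV"
begin

definition \<kappa> :: 'k where "\<kappa> = \<theta> - 1"

text \<open>This ring turns out to be the maximal order in \<open>max_order_eq\<close>. It is
  introduced separately because its closure under the ring operations is immediate, unlike that of
  \<open>max_order\<close>.\<close>

definition A :: "'k set" where "A = adjoin Z \<theta>"

sublocale A: subring_set A
  unfolding A_def by (rule subring_adjoin)

lemma theta_power_p: "\<theta> ^ p = 1"
  using primitive by (simp add: primitive_root_of_unity_def)

lemma theta_power_mod: "\<theta> ^ (k mod p) = \<theta> ^ k"
  by (metis div_mult_mod_eq mult.commute power_add power_mult power_one theta_power_p mult_1)

lemma theta_power_eq_1: "\<theta> ^ k = 1 \<longleftrightarrow> p dvd k"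
proof
  assume "\<theta> ^ k = 1"
  then have "\<theta> ^ (k mod p) = 1" by (simp add: theta_power_mod)
  moreover have "k mod p < p" using p_ge_5 by simp
  ultimately have "k mod p = 0"
    using primitive by (auto simp: primitive_root_of_unity_def)
  then show "p dvd k" by auto
next
  assume "p dvd k"
  then show "\<theta> ^ k = 1" by (auto simp: power_mult theta_power_p)
qed

lemma theta_nonzero: "\<theta> \<noteq> 0"
  using theta_power_p p_ge_5 by (metis power_0_left not_numeral_le_zero zero_neq_one)

lemma kappa_nonzero: "\<kappa> \<noteq> 0"
  using theta_power_eq_1[of 1] p_ge_5 by (auto simp: \<kappa>_def)

lemma Z_subset_A: "Z \<subseteq> A"
  by (auto simp: A_def adjoin_base)

lemma theta_in_A: "\<theta> \<in> A"
  by (simp add: A_def adjoin_gen)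

lemma kappa_in_A: "\<kappa> \<in> A"
  by (simp add: \<kappa>_def A.diff_closed theta_in_A A.one_closed)

section \<open>Cyclotomic units and the ramification of p\<close>

definition geo :: "nat \<Rightarrow> 'k" where "geo k = (\<Sum>j<k. \<theta> ^ j)"

lemma geo_in_A: "geo k \<in> A"
  by (auto simp: geo_def intro: A.sum_closed A.power_closed theta_in_A)

lemma theta_power_minus_1: "\<theta> ^ k - 1 = \<kappa> * geo k"
  by (simp add: geo_def \<kappa>_def power_diff_1_eq)

lemma geo_nonzero: "\<not> p dvd k \<Longrightarrow> geo k \<noteq> 0"
  using theta_power_minus_1[of k] theta_power_eq_1[of k] by auto

text \<open>With k l = 1 modulo p, \<theta> is the l-th power of \<theta>^k, so \<theta>^k - 1
  divides \<theta> - 1 with a geometric sum as quotient.\<close>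

lemma inverse_geo_in_A:
  assumes "\<not> p dvd k"
  shows "inverse (geo k) \<in> A"
proof -
  have "coprime k p"
    using assms prime_p by (metis coprime_commute prime_imp_coprime)
  then obtain l where l: "[k * l = 1] (mod p)"
    using cong_solve_coprime_nat[of k p] by auto
  then have "\<theta> ^ (k * l) = \<theta>"
    by (metis cong_def power_one_right theta_power_mod)
  then have "\<kappa> = (\<theta> ^ k) ^ l - 1"
    by (simp add: \<kappa>_def power_mult)
  also have "\<dots> = \<kappa> * (geo k * (\<Sum>j<l. (\<theta> ^ k) ^ j))"
    unfolding power_diff_1_eq[of "\<theta> ^ k" l] theta_power_minus_1[of k] by (simp add: mult.assoc)
  finally have "geo k * (\<Sum>j<l. (\<theta> ^ k) ^ j) = 1"
    using kappa_nonzero by (metis mult_cancel_left2 mult.commute)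
  then have "inverse (geo k) = (\<Sum>j<l. (\<theta> ^ k) ^ j)"
    by (metis inverse_unique)
  then show ?thesis
    by (auto intro!: A.sum_closed A.power_closed theta_in_A)
qed

lemma theta_power_inj: "inj_on (\<lambda>k. \<theta> ^ k) {..<p}"
proof (rule inj_onI)
  have *: "a = b" if "a \<le> b" "b < p" "\<theta> ^ a = \<theta> ^ b" for a b
  proof -
    have "\<theta> ^ b = \<theta> ^ a * \<theta> ^ (b - a)" using that by (metis le_add_diff_inverse power_add)
    then have "\<theta> ^ (b - a) = 1" using that theta_nonzero by simp
    then have "p dvd b - a" by (simp add: theta_power_eq_1)
    then show "a = b" using that by (cases "b - a = 0") (auto dest: dvd_imp_le)
  qed
  fix a b assume "a \<in> {..<p}" "b \<in> {..<p}" "\<theta> ^ a = \<theta> ^ b"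
  then show "a = b" using *[of a b] *[of b a] by (cases "a \<le> b") auto
qed

text \<open>Evaluate \<open>\<Prod>k=1..<p. X - \<theta>^k = 1 + X + \<dots> + X^(p-1)\<close> at \<open>X = 1\<close>.\<close>

lemma p_eq_prod: "of_nat p = (\<Prod>k\<in>{1..<p}. 1 - \<theta> ^ k)"
proof -
  define f :: "'k poly" where "f = (\<Prod>k\<in>{1..<p}. [:- (\<theta> ^ k), 1:])"
  define g :: "'k poly" where "g = (\<Sum>j<p. monom 1 j)"
  have inj: "inj_on (\<lambda>k. \<theta> ^ k) {1..<p}"
    by (rule inj_on_subset[OF theta_power_inj]) auto
  have df: "degree f = p - 1"
    unfolding f_def by (subst degree_prod_eq_sum_degree) auto
  have lf: "coeff f (p - 1) = 1"
    using lead_coeff_prod[of "\<lambda>k. [:- (\<theta> ^ k), 1:]" "{1..<p}"] df by (simp add: f_def)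
  have cg: "coeff g n = (if n < p then 1 else 0)" for n
    by (auto simp: g_def coeff_sum)
  \<comment> \<open>Both polynomials have degree p - 1 and leading coefficient 1, so agreement at
    the p - 1 nontrivial roots of unity suffices.\<close>
  have "f = g"
  proof (rule poly_eqI_degree_lead_coeff[where n = "p - 1" and A = "(\<lambda>k. \<theta> ^ k) ` {1..<p}"])
    show "coeff f (p - 1) = coeff g (p - 1)" using lf cg p_ge_5 by simp
    show "p - 1 \<le> card ((\<lambda>k. \<theta> ^ k) ` {1..<p})" using inj by (simp add: card_image)
    show "degree g \<le> p - 1" by (rule degree_le) (auto simp: cg)
    fix z assume "z \<in> (\<lambda>k. \<theta> ^ k) ` {1..<p}"
    then obtain k where k: "1 \<le> k" "k < p" "z = \<theta> ^ k" by auto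
    then have "poly f z = 0"
      by (auto simp: f_def poly_prod intro!: prod_zero)
    moreover have "(z - 1) * poly g z = 0"
    proof -
      have "(z - 1) * poly g z = z ^ p - 1"
        by (simp add: g_def poly_sum poly_monom power_diff_1_eq)
      also have "z ^ p = (\<theta> ^ p) ^ k" using k by (simp add: mult.commute flip: power_mult)
      finally show ?thesis by (simp add: theta_power_p)
    qed
    moreover have "z \<noteq> 1"
      using k theta_power_eq_1[of k] by (auto dest: dvd_imp_le)
    ultimately show "poly f z = poly g z" by simp
  qed (use df in simp)
  then have "poly f 1 = poly g 1" by simp
  then show ?thesis
    by (simp add: f_def g_def poly_prod poly_sum poly_monom)
qed

text \<open>Total ramification: each factor \<open>1 - \<theta> ^ k\<close> of p is \<kappa> times a
  cyclotomic unit.\<close>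

lemma p_eq_kappa_unit:
  obtains u where "u \<in> A" "inverse u \<in> A" "u \<noteq> 0" "of_nat p = \<kappa> ^ (p - 1) * u"
proof
  let ?u = "\<Prod>k\<in>{1..<p}. - geo k"
  have nd: "\<not> p dvd k" if "k \<in> {1..<p}" for k
    using that by (auto dest: dvd_imp_le)
  show "?u \<in> A" by (intro A.prod_closed A.uminus_closed geo_in_A)
  show "inverse ?u \<in> A"
    unfolding prod_inversef[symmetric] o_def
    using nd by (intro A.prod_closed) (auto intro: A.uminus_closed inverse_geo_in_A)
  show "?u \<noteq> 0" using nd geo_nonzero by (auto simp: prod_zero_iff)
  have "1 - \<theta> ^ k = \<kappa> * - geo k" for k
    using theta_power_minus_1[of k] by (simp add: algebra_simps)
  then show "of_nat p = \<kappa> ^ (p - 1) * ?u"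
    by (simp only: p_eq_prod prod.distrib prod_constant card_atLeastLessThan)
qed

lemma p_in_kappa_A: obtains y where "y \<in> A" "of_nat p = \<kappa> * y"
proof -
  obtain u where u: "u \<in> A" "of_nat p = \<kappa> ^ (p - 1) * u" using p_eq_kappa_unit by blast
  have "p - 1 = Suc (p - 2)" using p_ge_5 by simp
  then have "\<kappa> ^ (p - 1) = \<kappa> * \<kappa> ^ (p - 2)"
    by simp
  then have "of_nat p = \<kappa> * (\<kappa> ^ (p - 2) * u)" using u by simp
  then show thesis using that u A.mult_closed A.power_closed kappa_in_A by blast
qed


text \<open>Exponents are reduced modulo p. A spanning family, possibly dependent, suffices for both
  uses: integrality of \<open>A\<close> and comparison of linear maps on generators.\<close>

lemma adjoin_span: "x \<in> A \<Longrightarrow> \<exists>z. (\<forall>k. z k \<in> Z) \<and> x = (\<Sum>k<p. z k * \<theta> ^ k)"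
proof -
  define B where "B = {x. \<exists>z. (\<forall>k. z k \<in> Z) \<and> x = (\<Sum>k<p. z k * \<theta> ^ k)}"
  have mono: "c * \<theta> ^ j \<in> B" if "c \<in> Z" for c j
  proof -
    have "c * \<theta> ^ j = (\<Sum>k<p. (if k = j mod p then c else 0) * \<theta> ^ k)"
      using p_ge_5 by (simp add: if_distrib[of "\<lambda>t. t * _"] sum.delta theta_power_mod cong: if_cong)
    then show ?thesis
      using that zero_closed unfolding B_def by (intro CollectI exI[of _ "\<lambda>k. if k = j mod p then c else 0"]) auto
  qed
  have add: "x + y \<in> B" if xy: "x \<in> B" "y \<in> B" for x y
  proof -
    obtain z z' where "\<forall>k. z k \<in> Z" "x = (\<Sum>k<p. z k * \<theta> ^ k)"
      "\<forall>k. z' k \<in> Z" "y = (\<Sum>k<p. z' k * \<theta> ^ k)"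
      using xy unfolding B_def by blast
    then show ?thesis
      unfolding B_def
      by (intro CollectI exI[of _ "\<lambda>k. z k + z' k"]) (auto simp: algebra_simps sum.distrib add_closed)
  qed
  have sm: "(\<And>i. i \<in> I \<Longrightarrow> f i \<in> B) \<Longrightarrow> sum f I \<in> B" for f and I :: "nat set"
    by (induction I rule: infinite_finite_induct) (use add mono[OF zero_closed] in auto)
  assume "x \<in> A"
  then obtain f where "f \<in> polys_over Z" "x = poly f \<theta>" by (auto simp: A_def adjoin_def)
  then have "x \<in> B"
    by (auto simp: poly_altdef polys_over_def intro!: sm mono)
  then show ?thesis by (simp add: B_def)
qed

lemma A_subset_max_order: "A \<subseteq> max_order Z"
proof
  fix x assume x: "x \<in> A"
  have "\<forall>j. \<exists>z. (\<forall>k. z k \<in> Z) \<and> x * \<theta> ^ j = (\<Sum>k<p. z k * \<theta> ^ k)"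
    using x by (intro allI adjoin_span A.mult_closed A.power_closed theta_in_A)
  then obtain m where m: "\<And>j k. m j k \<in> Z" "\<And>j. x * \<theta> ^ j = (\<Sum>k<p. m j k * \<theta> ^ k)"
    by metis
  show "x \<in> max_order Z"
    by (rule integral_if_stable_span[OF subring_set_axioms m(2) m(1), where ?j0.0 = 0]) (use p_ge_5 in auto)
qed

text \<open>An element 1/p of \<open>A\<close> would be integral over \<open>Z\<close>; as its
  inverse p lies in \<open>Z\<close>, it would lie in \<open>Z\<close> itself.\<close>

lemma inverse_p_notin_A: "inverse (of_nat p) \<notin> A"
proof
  assume "inverse (of_nat p) \<in> A"
  then have "inverse (of_nat p) \<in> max_order Z" using A_subset_max_order by blast
  then have "inverse (of_nat p) \<in> Z"
    using integral_mem_if_inverse_mem[OF subring_set_axioms subset_refl] of_nat_closed by simp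
  then show False using p_nonunit by simp
qed

lemma inverse_kappa_notin_A: "inverse \<kappa> \<notin> A"
proof
  assume *: "inverse \<kappa> \<in> A"
  obtain u where u: "inverse u \<in> A" "of_nat p = \<kappa> ^ (p - 1) * u" using p_eq_kappa_unit by blast
  have "inverse (of_nat p) = inverse \<kappa> ^ (p - 1) * inverse u"
    using u by (simp add: power_inverse)
  then show False
    using * u A.mult_closed A.power_closed inverse_p_notin_A by metis
qed

lemma kappa_mult_neq_1: "y \<in> A \<Longrightarrow> \<kappa> * y \<noteq> 1"
  using inverse_kappa_notin_A by (metis inverse_unique)

text \<open>If p does not divide a, then a is invertible modulo p, hence modulo \<kappa>, which
  divides p. Then 1 would be a multiple of \<kappa>.\<close>

lemma of_nat_dvd_kappa:
  assumes "y \<in> A" "of_nat a = \<kappa> * y"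
  shows "p dvd a"
proof (rule ccontr)
  assume "\<not> p dvd a"
  then have "coprime a p" using prime_p by (metis coprime_commute prime_imp_coprime)
  then obtain b where b: "[a * b = 1] (mod p)" using cong_solve_coprime_nat[of a p] by auto
  then have "a * b mod p = 1" using p_ge_5 by (simp add: cong_def)
  then have ab: "a * b = a * b div p * p + 1" by (metis div_mult_mod_eq)
  obtain w where w: "w \<in> A" "of_nat p = \<kappa> * w" by (rule p_in_kappa_A)
  have "(of_nat (a * b) :: 'k) = of_nat (a * b div p * p + 1)" using ab by simp
  then have "\<kappa> * y * of_nat b = of_nat (a * b div p) * (\<kappa> * w) + 1"
    by (simp only: of_nat_mult of_nat_add of_nat_1 assms(2)[symmetric] w(2)[symmetric])
  then have "\<kappa> * (y * of_nat b - of_nat (a * b div p) * w) = 1"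
    by (simp add: algebra_simps)
  moreover have "y * of_nat b - of_nat (a * b div p) * w \<in> A"
    by (intro A.diff_closed A.mult_closed A.of_nat_closed w assms)
  ultimately show False using kappa_mult_neq_1 by blast
qed

lemma A_residue:
  assumes "x \<in> A"
  shows "\<exists>a<p. \<exists>y\<in>A. x = of_nat a + \<kappa> * y"
proof -
  obtain w where w: "w \<in> A" "of_nat p = \<kappa> * w" by (rule p_in_kappa_A)
  obtain f where f: "f \<in> polys_over Z" "x = poly f \<theta>" using assms by (auto simp: A_def adjoin_def)
  have "\<exists>c\<in>Z. \<exists>y\<in>A. poly f \<theta> = c + \<kappa> * y"
    using f(1)
  proof (induction f)
    case 0
    show ?case by (rule bexI[of _ 0], rule bexI[of _ 0]) (auto intro: zero_closed A.zero_closed)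
  next
    case (pCons a f)
    then have "f \<in> polys_over Z" and a: "a \<in> Z"
      unfolding polys_over_def by (auto simp: coeff_pCons split: nat.splits dest: spec[of _ "Suc _"] spec[of _ 0])
    then obtain c y where c: "c \<in> Z" "y \<in> A" "poly f \<theta> = c + \<kappa> * y" using pCons.IH by blast
    \<comment> \<open>Since \<theta> = 1 + \<kappa>, evaluation at \<theta> just adds up the
      coefficients modulo \<kappa>.\<close>
    have "poly (pCons a f) \<theta> = (a + c) + \<kappa> * (c + (1 + \<kappa>) * y)"
      unfolding poly_pCons c(3) by (simp add: \<kappa>_def algebra_simps)
    then show ?case
      using a c by (metis A.add_closed A.mult_closed A.one_closed Z_subset_A add_closed kappa_in_A subsetD)
  qed
  then obtain c y where c: "c \<in> Z" "y \<in> A" "x = c + \<kappa> * y" using f by blast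
  obtain a z where a: "a < p" "z \<in> Z" "c = of_nat a + of_nat p * z"
    using Z_residue[OF c(1)] by blast
  have "x = of_nat a + \<kappa> * (y + w * z)"
    using c a w by (simp add: algebra_simps)
  then show ?thesis
    using a c w by (metis A.add_closed A.mult_closed Z_subset_A subsetD)
qed

text \<open>The quotient of \<open>A\<close> by \<kappa> is the field of p elements, so residues of
  x and y with product zero cannot both be nonzero.\<close>

lemma kappa_A_prime:
  assumes "x \<in> A" "y \<in> A" "z \<in> A" "x * y = \<kappa> * z"
  shows "(\<exists>w\<in>A. x = \<kappa> * w) \<or> (\<exists>w\<in>A. y = \<kappa> * w)"
proof -
  obtain w where w: "w \<in> A" "of_nat p = \<kappa> * w" by (rule p_in_kappa_A)
  obtain a x' where a: "x' \<in> A" "x = of_nat a + \<kappa> * x'" using A_residue[OF assms(1)] by blast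
  obtain b y' where b: "y' \<in> A" "y = of_nat b + \<kappa> * y'" using A_residue[OF assms(2)] by blast
  have "of_nat (a * b) = \<kappa> * (z - of_nat a * y' - x' * of_nat b - \<kappa> * x' * y')"
    using assms(4) a b by (simp add: algebra_simps)
  then have "p dvd a * b"
    by (rule of_nat_dvd_kappa[rotated])
      (intro A.diff_closed A.mult_closed A.of_nat_closed w assms a b kappa_in_A)
  then have "p dvd a \<or> p dvd b" using prime_p prime_dvd_mult_iff by blast
  moreover have "\<exists>w\<in>A. of_nat n + \<kappa> * v = \<kappa> * w" if nv: "p dvd n" "v \<in> A" for n v
  proof -
    obtain m where "n = p * m" using nv(1) by (rule dvdE)
    then have "of_nat n + \<kappa> * v = \<kappa> * (w * of_nat m + v)" using w by (simp add: algebra_simps)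
    then show ?thesis using nv w by (metis A.add_closed A.mult_closed A.of_nat_closed)
  qed
  ultimately show ?thesis using a b by blast
qed

section \<open>Factorization into a power of \<kappa> and a unit\<close>

lemma A_divides_p_power:
  assumes "a \<in> A" "a \<noteq> 0"
  shows "\<exists>b\<in>A. \<exists>n. a * b = of_nat p ^ n"
proof -
  \<comment> \<open>The constant coefficient of an equation of a is a multiple of a. Factors X are
    stripped from the polynomial until this coefficient is nonzero.\<close>
  have *: "\<exists>c\<in>Z. c \<noteq> 0 \<and> (\<exists>b\<in>A. a * b = c)"
    if "f \<noteq> 0" "f \<in> polys_over Z" "poly f a = 0" for f
    using that
  proof (induction f)
    case 0
    then show ?case by simp
  next
    case (pCons c f)
    then have f: "f \<in> polys_over Z" and c: "c \<in> Z"
      unfolding polys_over_def by (auto simp: coeff_pCons split: nat.splits dest: spec[of _ "Suc _"] spec[of _ 0])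
    show ?case
    proof (cases "c = 0")
      case True
      then have "poly f a = 0" "f \<noteq> 0" using pCons assms by auto
      then show ?thesis using pCons f by blast
    next
      case False
      have "a * - poly f a = c" using pCons.prems by (simp add: add_eq_0_iff2)
      moreover have "- poly f a \<in> A"
        using f polys_over_mono[OF Z_subset_A] assms by (intro A.uminus_closed A.poly_closed) auto
      ultimately show ?thesis using False c by blast
    qed
  qed
  have "a \<in> max_order Z" using assms A_subset_max_order by blast
  then obtain f where "lead_coeff f = 1" "f \<in> polys_over Z" "poly f a = 0"
    by (auto simp: max_order_altdef)
  then obtain c b where c: "c \<in> Z" "c \<noteq> 0" "b \<in> A" "a * b = c"
    using *[of f] by (metis leading_coeff_0_iff zero_neq_one)
  obtain n y where y: "y \<in> Z" "c = of_nat p ^ n * y" "inverse y \<in> Z"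
    using Z_factor[OF c(1,2)] by blast
  have "a * (b * inverse y) = of_nat p ^ n"
    using c y by (auto simp: mult.assoc[symmetric])
  then show ?thesis using c y Z_subset_A by (metis A.mult_closed subsetD)
qed

text \<open>\<open>A\<close> with p inverted is already a field, because every nonzero element of
  \<open>A\<close> divides a power of p. It contains the generators of the whole field.\<close>

lemma field_generated: "\<exists>a\<in>A. \<exists>n. x = a / of_nat p ^ n"
proof -
  define L where "L = {a / of_nat p ^ n |a n. a \<in> A}"
  have LI: "a / of_nat p ^ n \<in> L" if "a \<in> A" for a n
    using that unfolding L_def by blast
  have AL: "a \<in> L" if "a \<in> A" for a using LI[OF that, of 0] by simp
  have "is_subfield L"
    unfolding is_subfield_def
  proof (intro conjI ballI)
    show "0 \<in> L" "1 \<in> L" by (auto intro: AL A.zero_closed A.one_closed)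
  next
    fix x y assume "x \<in> L" "y \<in> L"
    then obtain a b n m where ab: "a \<in> A" "b \<in> A" "x = a / of_nat p ^ n" "y = b / of_nat p ^ m"
      unfolding L_def by blast
    have "x + y = (a * of_nat p ^ m + b * of_nat p ^ n) / of_nat p ^ (n + m)"
      unfolding ab using p_nonzero by (simp add: add_frac_eq power_add)
    then show "x + y \<in> L"
      using ab LI by (metis A.add_closed A.mult_closed A.power_closed A.of_nat_closed)
    have "x * y = (a * b) / of_nat p ^ (n + m)" using ab by (simp add: power_add)
    then show "x * y \<in> L" using ab LI by (metis A.mult_closed)
  next
    fix x assume "x \<in> L"
    then obtain a n where a: "a \<in> A" "x = a / of_nat p ^ n" unfolding L_def by blast
    then show "- x \<in> L" using LI[of "- a" n] A.uminus_closed by simp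
    show "inverse x \<in> L"
    proof (cases "a = 0")
      case True
      then show ?thesis using a AL A.zero_closed by simp
    next
      case False
      then obtain b m where b: "b \<in> A" "a * b = of_nat p ^ m" using A_divides_p_power a by blast
      then have "inverse x = (b * of_nat p ^ n) / of_nat p ^ m"
        unfolding a(2) using False p_nonzero by (simp add: divide_simps) (metis mult.commute mult.assoc)
      then show ?thesis using b LI by (metis A.mult_closed A.power_closed A.of_nat_closed)
    qed
  qed
  moreover have "insert \<theta> (fractions Z) \<subseteq> L"
  proof -
    have "a / b \<in> L" if ab: "a \<in> Z" "b \<in> Z" "b \<noteq> 0" for a b
    proof -
      obtain n y where "y \<in> Z" "b = of_nat p ^ n * y" "inverse y \<in> Z"
        using Z_factor[OF ab(2,3)] by blast
      then have "a / b = (a * inverse y) / of_nat p ^ n" "a * inverse y \<in> Z"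
        using ab mult_closed by (auto simp: divide_inverse)
      then show ?thesis using LI Z_subset_A by (metis subsetD)
    qed
    then show ?thesis using AL theta_in_A by (auto simp: fractions_def)
  qed
  ultimately have "is_subfield hull (insert \<theta> (fractions Z)) \<subseteq> L" by (metis hull_minimal)
  then show ?thesis using generated unfolding L_def by blast
qed

text \<open>Otherwise a positive power of \<kappa> would divide the unit w.\<close>

lemma kappa_power_unit_bound:
  assumes "x \<in> A" "w \<in> A" "inverse w \<in> A" "w \<noteq> 0" "\<kappa> ^ n * x = \<kappa> ^ m * w"
  shows "n \<le> m"
proof (rule ccontr)
  assume "\<not> n \<le> m"
  then have "\<kappa> ^ n = \<kappa> ^ m * (\<kappa> * \<kappa> ^ (n - m - 1))"
    by (metis Suc_diff_1 linorder_not_le ordered_cancel_comm_monoid_diff_class.add_diff_inverse power_Suc power_add zero_less_diff less_imp_le)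
  then have "w = \<kappa> * \<kappa> ^ (n - m - 1) * x" using assms(5) kappa_nonzero by (simp add: mult.assoc)
  then have "\<kappa> * (\<kappa> ^ (n - m - 1) * x * inverse w) = 1" using assms(4) by (simp add: field_simps)
  then show False
    using kappa_mult_neq_1[of "\<kappa> ^ (n - m - 1) * x * inverse w"] assms
    by (meson A.mult_closed A.power_closed kappa_in_A)
qed

text \<open>The exponent is the largest n such that \<kappa>^n divides x. It exists because x
  divides a power of p, which is a power of \<kappa> times a unit.\<close>

lemma kappa_factor_max:
  assumes "x \<in> A" "x \<noteq> 0"
  obtains n u where "u \<in> A" "x = \<kappa> ^ n * u" "\<not> (\<exists>y\<in>A. u = \<kappa> * y)"
proof -
  obtain b N where b: "b \<in> A" "x * b = of_nat p ^ N" using A_divides_p_power[OF assms] by blast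
  obtain u where u: "u \<in> A" "inverse u \<in> A" "u \<noteq> 0" "of_nat p = \<kappa> ^ (p - 1) * u" by (rule p_eq_kappa_unit)
  define M where "M = (p - 1) * N"
  have xb: "x * b = \<kappa> ^ M * u ^ N"
    using b u by (simp add: M_def power_mult power_mult_distrib)
  define Q where "Q n \<longleftrightarrow> (\<exists>y\<in>A. x = \<kappa> ^ n * y)" for n
  have bound: "n \<le> M" if n: "Q n" for n
  proof -
    obtain y where y: "y \<in> A" "x = \<kappa> ^ n * y" using n by (auto simp: Q_def)
    show ?thesis
      by (rule kappa_power_unit_bound[of "y * b" "u ^ N"])
        (use y b u xb in \<open>auto simp: mult.assoc power_inverse[symmetric] intro: A.mult_closed A.power_closed\<close>)
  qed
  have "Q 0" using assms by (auto simp: Q_def)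
  define n where "n = (GREATEST n. Q n)"
  have "Q n" unfolding n_def using \<open>Q 0\<close> bound by (rule GreatestI_nat)
  then obtain v where v: "v \<in> A" "x = \<kappa> ^ n * v" by (auto simp: Q_def)
  have "\<not> (\<exists>y\<in>A. v = \<kappa> * y)"
  proof
    assume "\<exists>y\<in>A. v = \<kappa> * y"
    then have "Q (Suc n)" using v by (auto simp: Q_def mult_ac)
    then have "Suc n \<le> n" unfolding n_def using bound by (rule Greatest_le_nat)
    then show False by simp
  qed
  then show thesis using that v by blast
qed

text \<open>In a product \<open>u * b\<close> equal to a power of p, all factors \<kappa> sit in b,
  since \<kappa> is prime and does not divide u. Cancelling them leaves a unit.\<close>

lemma unit_if_not_in_kappa_A:
  assumes "u \<in> A" "\<not> (\<exists>y\<in>A. u = \<kappa> * y)"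
  shows "inverse u \<in> A"
proof -
  have u0: "u \<noteq> 0" using assms A.zero_closed by force
  obtain b N where b: "b \<in> A" "u * b = of_nat p ^ N" using A_divides_p_power[OF assms(1) u0] by blast
  obtain w where w: "w \<in> A" "inverse w \<in> A" "w \<noteq> 0" "of_nat p = \<kappa> ^ (p - 1) * w" by (rule p_eq_kappa_unit)
  define M where "M = (p - 1) * N"
  have ub: "u * b = \<kappa> ^ M * w ^ N"
    using b w by (simp add: M_def power_mult power_mult_distrib)
  then have "b \<noteq> 0" using w kappa_nonzero by auto
  then obtain n v where v: "v \<in> A" "b = \<kappa> ^ n * v" "\<not> (\<exists>y\<in>A. v = \<kappa> * y)"
    using kappa_factor_max[OF b(1)] by metis
  have "n \<le> M"
    by (rule kappa_power_unit_bound[of "u * v" "w ^ N"])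
      (use v ub assms w in \<open>auto simp: mult_ac power_inverse[symmetric] intro: A.mult_closed A.power_closed\<close>)
  then have "\<kappa> ^ M = \<kappa> ^ n * \<kappa> ^ (M - n)" by (metis le_add_diff_inverse power_add)
  then have uv: "u * v = \<kappa> ^ (M - n) * w ^ N"
    using ub v kappa_nonzero by (simp add: mult_ac)
  have "M - n = 0"
  proof (rule ccontr)
    assume "M - n \<noteq> 0"
    then obtain k where "M - n = Suc k" by (cases "M - n") auto
    then have "u * v = \<kappa> * (\<kappa> ^ k * w ^ N)" using uv by (simp add: mult_ac)
    moreover have "\<kappa> ^ k * w ^ N \<in> A" by (intro A.mult_closed A.power_closed kappa_in_A w)
    ultimately show False using kappa_A_prime[of u v] assms v by blast
  qed
  then have "u * (v * inverse w ^ N) = 1"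
    using uv w by (simp add: mult.assoc[symmetric] power_inverse)
  then have "inverse u = v * inverse w ^ N" by (metis inverse_unique)
  then show ?thesis using v w by (metis A.mult_closed A.power_closed)
qed

lemma kappa_powi_unit:
  assumes "x \<noteq> 0"
  obtains n :: int and u where "u \<in> A" "inverse u \<in> A" "u \<noteq> 0" "x = \<kappa> powi n * u"
proof -
  obtain a N where a: "a \<in> A" "x = a / of_nat p ^ N" using field_generated by blast
  have "a \<noteq> 0" using a assms by auto
  then obtain n u where u: "u \<in> A" "a = \<kappa> ^ n * u" "\<not> (\<exists>y\<in>A. u = \<kappa> * y)"
    using kappa_factor_max[OF a(1)] by metis
  have iu: "inverse u \<in> A" using u by (intro unit_if_not_in_kappa_A)
  obtain w where w: "w \<in> A" "inverse w \<in> A" "w \<noteq> 0" "of_nat p = \<kappa> ^ (p - 1) * w" by (rule p_eq_kappa_unit)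
  have "x = (\<kappa> ^ n / \<kappa> ^ ((p - 1) * N)) * (u * inverse w ^ N)"
    using a u w by (simp add: power_mult power_mult_distrib power_inverse divide_simps)
  also have "\<kappa> ^ n / \<kappa> ^ ((p - 1) * N) = \<kappa> powi (int n - int ((p - 1) * N))"
    by (subst power_int_diff) (use kappa_nonzero in \<open>auto simp del: of_nat_mult\<close>)
  finally have x: "x = \<kappa> powi (int n - int ((p - 1) * N)) * (u * inverse w ^ N)" .
  show thesis
    by (rule that[OF _ _ _ x])
      (use u w iu \<open>a \<noteq> 0\<close> in \<open>auto simp: power_inverse[symmetric] intro!: A.mult_closed A.power_closed\<close>)
qed

text \<open>An integral x of negative valuation has its inverse in \<open>A\<close>, and then
  \<open>integral_mem_if_inverse_mem\<close> puts x itself into \<open>A\<close>.\<close>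

lemma max_order_eq: "max_order Z = A"
proof
  show "max_order Z \<subseteq> A"
  proof
    fix x assume x: "x \<in> max_order Z"
    show "x \<in> A"
    proof (cases "x = 0")
      case True
      then show ?thesis using A.zero_closed by simp
    next
      case False
      obtain n :: int and u where u: "u \<in> A" "inverse u \<in> A" "u \<noteq> 0" "x = \<kappa> powi n * u"
        by (rule kappa_powi_unit[OF False])
      show ?thesis
      proof (cases "n \<ge> 0")
        case True
        then show ?thesis using u by (auto simp: power_int_def intro!: A.mult_closed A.power_closed kappa_in_A)
      next
        case False
        then have "inverse x \<in> A"
          using u by (auto simp: power_int_def power_inverse intro!: A.mult_closed A.power_closed kappa_in_A)
        then show ?thesis
          using integral_mem_if_inverse_mem[OF A.subring_set_axioms Z_subset_A x] by blast
      qed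
    qed
  qed
qed (rule A_subset_max_order)

text \<open>Membership in \<open>pw n\<close> expresses a \<kappa>-adic valuation of at least n.
  Negative exponents occur because the structure constants have denominators.\<close>

definition pw :: "int \<Rightarrow> 'k set" where "pw n = (\<lambda>x. \<kappa> powi n * x) ` A"

lemma pw_iff: "x \<in> pw n \<longleftrightarrow> \<kappa> powi (- n) * x \<in> A"
proof
  assume "x \<in> pw n"
  then show "\<kappa> powi (- n) * x \<in> A"
    using kappa_nonzero by (auto simp: pw_def power_int_minus mult.assoc[symmetric])
next
  assume "\<kappa> powi (- n) * x \<in> A"
  then show "x \<in> pw n"
    unfolding pw_def using kappa_nonzero
    by (intro image_eqI[of _ _ "\<kappa> powi (- n) * x"]) (auto simp: power_int_minus)
qed

lemma pw_0: "pw 0 = A"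
  by (simp add: pw_def)

lemma ppow_eq_pw: "ppow Z \<theta> (enat n) = pw (int n)"
  by (simp add: pw_def max_order_eq \<kappa>_def)

lemma pw_mult: "x \<in> pw m \<Longrightarrow> y \<in> pw n \<Longrightarrow> x * y \<in> pw (m + n)"
  using kappa_nonzero unfolding pw_def
  by (auto simp: power_int_add intro!: image_eqI[of _ _ "_ * _"] A.mult_closed)

lemma pw_A_mult: "x \<in> A \<Longrightarrow> y \<in> pw n \<Longrightarrow> x * y \<in> pw n"
  using pw_mult[of x 0 y n] by (simp add: pw_0)

lemma pw_add: "x \<in> pw n \<Longrightarrow> y \<in> pw n \<Longrightarrow> x + y \<in> pw n"
  by (auto simp: pw_iff ring_distribs intro: A.add_closed)

lemma pw_uminus: "x \<in> pw n \<Longrightarrow> - x \<in> pw n"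
  by (auto simp: pw_iff intro: A.uminus_closed)

lemma pw_diff: "x \<in> pw n \<Longrightarrow> y \<in> pw n \<Longrightarrow> x - y \<in> pw n"
  by (auto simp: pw_iff ring_distribs intro: A.diff_closed)

lemma pw_zero: "0 \<in> pw n"
  by (auto simp: pw_iff A.zero_closed)

lemma pw_sum: "(\<And>i. i \<in> I \<Longrightarrow> f i \<in> pw n) \<Longrightarrow> sum f I \<in> pw n"
  by (induction I rule: infinite_finite_induct) (auto intro: pw_zero pw_add)

lemma kappa_powi_in_pw: "\<kappa> powi n \<in> pw n"
  using kappa_nonzero by (auto simp: pw_iff A.one_closed power_int_minus)

lemma kappa_power_in_pw: "\<kappa> ^ n \<in> pw (int n)"
  using kappa_powi_in_pw[of "int n"] by simp

lemma pw_mono: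
  assumes "m \<le> n" "x \<in> pw n"
  shows "x \<in> pw m"
proof -
  have "\<kappa> powi (- m) = \<kappa> powi (int (nat (n - m)) + - n)" using assms by simp
  also have "\<dots> = \<kappa> powi int (nat (n - m)) * \<kappa> powi (- n)"
    by (rule power_int_add) (use kappa_nonzero in auto)
  also have "\<kappa> powi int (nat (n - m)) = \<kappa> ^ nat (n - m)"
    by (rule power_int_of_nat)
  finally have e: "\<kappa> powi (- m) * x = \<kappa> ^ nat (n - m) * (\<kappa> powi (- n) * x)"
    by (simp add: mult.assoc)
  show ?thesis
    unfolding pw_iff e
    using assms(2)[unfolded pw_iff] by (blast intro: A.mult_closed A.power_closed kappa_in_A)
qed

text \<open>The hypothesis on \<open>inverse u\<close> says that u has valuation at most m.\<close>

lemma pw_cancel: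
  assumes "u * x \<in> pw n" "inverse u \<in> pw (- m)" "u \<noteq> 0"
  shows "x \<in> pw (n - m)"
  using pw_mult[OF assms(2) assms(1)] assms(3) by (simp add: mult.assoc[symmetric])

lemma inverse_p_in_pw: "inverse (of_nat p) \<in> pw (1 - int p)"
proof -
  obtain u where u: "u \<in> A" "inverse u \<in> A" "u \<noteq> 0" "of_nat p = \<kappa> ^ (p - 1) * u"
    by (rule p_eq_kappa_unit)
  have e: "- (1 - int p) = int (p - 1)" using p_ge_5 by simp
  show ?thesis
    unfolding pw_iff e using u kappa_nonzero by (simp add: mult.assoc[symmetric])
qed

lemma p_in_pw: "of_nat p \<in> pw (int p - 1)"
proof -
  obtain u where u: "u \<in> A" "inverse u \<in> A" "u \<noteq> 0" "of_nat p = \<kappa> ^ (p - 1) * u"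
    by (rule p_eq_kappa_unit)
  have e: "int p - 1 = int (p - 1)" using p_ge_5 by simp
  show ?thesis
    unfolding pw_def e using u by auto
qed

lemma Z_inter_pw_1:
  assumes "z \<in> Z" "z \<in> pw 1"
  shows "\<exists>y\<in>Z. z = of_nat p * y"
proof -
  obtain a y where a: "a < p" "y \<in> Z" "z = of_nat a + of_nat p * y" using Z_residue[OF assms(1)] by blast
  obtain w where w: "w \<in> A" "of_nat p = \<kappa> * w" by (rule p_in_kappa_A)
  obtain x where x: "x \<in> A" "z = \<kappa> * x" using assms(2) by (auto simp: pw_def)
  have "of_nat a = \<kappa> * (x - w * y)" using a w x by (simp add: algebra_simps)
  then have "p dvd a"
    using a w x Z_subset_A by (intro of_nat_dvd_kappa[of "x - w * y"]) (auto intro!: A.diff_closed A.mult_closed)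
  then have "a = 0" using a by auto
  then show ?thesis using a by auto
qed

lemma pw_neq:
  assumes "m < n"
  shows "pw m \<noteq> pw n"
proof
  assume "pw m = pw n"
  then have "\<kappa> powi m \<in> pw n" using kappa_powi_in_pw by blast
  then have "\<kappa> powi m \<in> pw (m + 1)" using assms pw_mono[of "m + 1" n] by simp
  then have "\<kappa> powi (- (m + 1)) * \<kappa> powi m \<in> A" by (simp only: pw_iff)
  moreover have "\<kappa> powi (- (m + 1)) * \<kappa> powi m = inverse \<kappa>"
    using kappa_nonzero by (simp add: power_int_add[symmetric] power_int_minus)
  ultimately show False using inverse_kappa_notin_A by simp
qed

section \<open>Irreducibility of the cyclotomic polynomial\<close>

lemma kappa_independent:
  assumes "\<And>k. k < p - 1 \<Longrightarrow> z k \<in> Z" "(\<Sum>k<p-1. z k * \<kappa> ^ k) = 0" "k < p - 1"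
  shows "z k = 0"
proof -
  \<comment> \<open>Terms with index below k carry a factor p, hence \<kappa>^(p - 1), and terms
    with index above k carry \<kappa>^(k + 1). So \<kappa> divides \<open>z k\<close>, and therefore
    p does.\<close>
  have div: "\<exists>y\<in>Z. z k = of_nat p * y"
    if z: "\<And>k. k < p - 1 \<Longrightarrow> z k \<in> Z" "(\<Sum>k<p-1. z k * \<kappa> ^ k) = 0" and k: "k < p - 1" for k z
    using k
  proof (induction k rule: less_induct)
    case (less k)
    have "z j * \<kappa> ^ j \<in> pw (int (Suc k))" if j: "j \<in> {..<p-1} - {k}" for j
    proof (cases "j < k")
      case True
      then obtain y where y: "y \<in> Z" "z j = of_nat p * y" using less by force
      have "of_nat p * (y * \<kappa> ^ j) \<in> pw (int p - 1 + (0 + int j))"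
        by (intro pw_mult p_in_pw kappa_power_in_pw) (use y Z_subset_A in \<open>auto simp: pw_0\<close>)
      moreover have "int (Suc k) \<le> int p - 1 + (0 + int j)" using less.prems by linarith
      ultimately show ?thesis using y pw_mono by (metis mult.assoc)
    next
      case False
      then have "int (Suc k) \<le> int j" using j by auto
      moreover have "z j * \<kappa> ^ j \<in> pw (int j)"
        using z(1)[of j] j Z_subset_A by (intro pw_A_mult kappa_power_in_pw) auto
      ultimately show ?thesis using pw_mono by blast
    qed
    then have "(\<Sum>j\<in>{..<p-1} - {k}. z j * \<kappa> ^ j) \<in> pw (int (Suc k))" by (rule pw_sum)
    moreover have "(\<Sum>j<p-1. z j * \<kappa> ^ j) = z k * \<kappa> ^ k + (\<Sum>j\<in>{..<p-1} - {k}. z j * \<kappa> ^ j)"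
      using less.prems by (intro sum.remove) auto
    ultimately have "- (z k * \<kappa> ^ k) \<in> pw (int (Suc k))"
      using z(2) by (metis add_eq_0_iff)
    then have "\<kappa> ^ k * z k \<in> pw (1 + int k)"
      using pw_uminus by (fastforce simp: mult.commute add.commute)
    then have "z k \<in> pw (1 + int k - int k)"
      by (rule pw_cancel) (use kappa_powi_in_pw[of "- int k"] kappa_nonzero in \<open>auto simp: power_int_minus\<close>)
    then show ?case using Z_inter_pw_1 z(1) less.prems by simp
  qed
  \<comment> \<open>A relation with all coefficients divisible by p can be divided by p and treated
    again, so each coefficient is divisible by every power of p.\<close>
  have all: "\<exists>y\<in>Z. z k = of_nat p ^ N * y" for N
  proof -
    have "\<exists>y. (\<forall>k<p-1. y k \<in> Z \<and> z k = of_nat p ^ N * y k) \<and> (\<Sum>k<p-1. y k * \<kappa> ^ k) = 0"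
    proof (induction N)
      case 0
      show ?case by (intro exI[of _ z]) (use assms in auto)
    next
      case (Suc N)
      then obtain y where y: "\<And>k. k < p - 1 \<Longrightarrow> y k \<in> Z \<and> z k = of_nat p ^ N * y k"
        "(\<Sum>k<p-1. y k * \<kappa> ^ k) = 0" by blast
      have "\<forall>k. k < p - 1 \<longrightarrow> (\<exists>x. x \<in> Z \<and> y k = of_nat p * x)"
        using div[of y] y by blast
      then obtain x where x: "\<And>k. k < p - 1 \<Longrightarrow> x k \<in> Z \<and> y k = of_nat p * x k" by metis
      have "(\<Sum>k<p-1. y k * \<kappa> ^ k) = of_nat p * (\<Sum>k<p-1. x k * \<kappa> ^ k)"
        using x by (simp add: sum_distrib_left mult.assoc)
      then have "(\<Sum>k<p-1. x k * \<kappa> ^ k) = 0" using y(2) p_nonzero by simp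
      then show ?case using x y by (intro exI[of _ x]) auto
    qed
    then show ?thesis using assms(3) by blast
  qed
  show ?thesis
  proof (rule ccontr)
    assume "z k \<noteq> 0"
    then obtain n y where y: "y \<in> Z" "z k = of_nat p ^ n * y" "inverse y \<in> Z"
      using Z_factor[OF assms(1)] assms(3) by blast
    obtain x where x: "x \<in> Z" "z k = of_nat p ^ Suc n * x" using all by blast
    have "y \<noteq> 0" using \<open>z k \<noteq> 0\<close> y by auto
    have "y = of_nat p * x" using x y p_nonzero by (simp add: mult.assoc)
    then have "of_nat p * (x * inverse y) = 1" using \<open>y \<noteq> 0\<close>
      by (metis mult.assoc right_inverse)
    then have "inverse (of_nat p) = x * inverse y" by (metis inverse_unique)
    then show False using x y p_nonunit mult_closed by metis
  qed
qed

text \<open>Division with remainder by the monic polynomial 1 + X + ... + X^(p - 1), expressed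
  through values at its roots.\<close>

lemma reduce_mod_cyclotomic:
  assumes "f \<in> polys_over Z"
  shows "\<exists>g\<in>polys_over Z. degree g < p - 1 \<and> (\<forall>x::'k. x ^ p = 1 \<longrightarrow> x \<noteq> 1 \<longrightarrow> poly f x = poly g x)"
  using assms
proof (induction f)
  case 0
  show ?case using p_ge_5 polys_over_0 by (intro bexI[of _ 0]) auto
next
  case (pCons a f)
  interpret Q: subring_set "polys_over Z" by (rule subring_polys_over)
  from pCons have f: "f \<in> polys_over Z" and a: "a \<in> Z"
    unfolding polys_over_def by (auto simp: coeff_pCons split: nat.splits dest: spec[of _ "Suc _"] spec[of _ 0])
  obtain g where g: "g \<in> polys_over Z" "degree g < p - 1"
    "\<And>x::'k. x ^ p = 1 \<Longrightarrow> x \<noteq> 1 \<Longrightarrow> poly f x = poly g x"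
    using pCons.IH[OF f] by blast
  define \<Phi> :: "'k poly" where "\<Phi> = (\<Sum>j<p. monom 1 j)"
  have c\<Phi>: "coeff \<Phi> n = (if n < p then 1 else 0)" for n
    by (auto simp: \<Phi>_def coeff_sum)
  define h where "h = pCons a g"
  have h: "h \<in> polys_over Z" unfolding h_def by (intro polys_over_pCons a g)
  define c where "c = coeff h (p - 1)"
  have c: "c \<in> Z" using h by (auto simp: c_def polys_over_def)
  show ?case
  proof (intro bexI[of _ "h - Polynomial.smult c \<Phi>"] conjI allI impI)
    show "h - Polynomial.smult c \<Phi> \<in> polys_over Z"
      using h c by (auto simp: polys_over_def c\<Phi> intro!: diff_closed mult_closed zero_closed)
    have "degree h \<le> p - 1" using g(2) by (simp add: h_def)
    then have "coeff (h - Polynomial.smult c \<Phi>) n = 0" if "n > p - 2" for n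
    proof (cases "n = p - 1")
      case True
      then show ?thesis using p_ge_5 by (simp add: c\<Phi> c_def)
    next
      case False
      then have "n > p - 1" using that by simp
      then show ?thesis using \<open>degree h \<le> p - 1\<close> by (simp add: c\<Phi> coeff_eq_0)
    qed
    then have "degree (h - Polynomial.smult c \<Phi>) \<le> p - 2" by (auto intro: degree_le)
    then show "degree (h - Polynomial.smult c \<Phi>) < p - 1" using p_ge_5 by simp
    fix x :: 'k assume x: "x ^ p = 1" "x \<noteq> 1"
    have "(x - 1) * poly \<Phi> x = x ^ p - 1"
      by (simp add: \<Phi>_def poly_sum poly_monom power_diff_1_eq)
    then have "poly \<Phi> x = 0" using x by simp
    then show "poly (pCons a f) x = poly (h - Polynomial.smult c \<Phi>) x"
      using g(3)[OF x] by (simp add: h_def)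
  qed
qed

lemma pcompose_polys_over:
  assumes "f \<in> polys_over Z" "g \<in> polys_over Z"
  shows "pcompose f g \<in> polys_over Z"
proof -
  interpret Q: subring_set "polys_over Z" by (rule subring_polys_over)
  show ?thesis
    using assms(1)
  proof (induction f)
    case 0
    then show ?case by (simp add: polys_over_0)
  next
    case (pCons a f)
    then have f: "f \<in> polys_over Z" and a: "a \<in> Z"
      unfolding polys_over_def by (auto simp: coeff_pCons split: nat.splits dest: spec[of _ "Suc _"] spec[of _ 0])
    then show ?case
      using pCons.IH assms(2) by (auto simp: pcompose_pCons intro!: Q.add_closed Q.mult_closed polys_over_const)
  qed
qed

text \<open>The substitution \<theta> = 1 + \<kappa> turns the remainder, of degree below p - 1,
  into a relation between powers of \<kappa>. So the remainder is zero, and f vanishes wherever the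
  cyclotomic polynomial does.\<close>

lemma conjugate_root:
  assumes "f \<in> polys_over Z" "poly f \<theta> = 0" "x ^ p = 1" "x \<noteq> 1"
  shows "poly f x = 0"
proof -
  obtain g where g: "g \<in> polys_over Z" "degree g < p - 1"
    "\<And>x::'k. x ^ p = 1 \<Longrightarrow> x \<noteq> 1 \<Longrightarrow> poly f x = poly g x"
    using reduce_mod_cyclotomic[OF assms(1)] by blast
  define h where "h = pcompose g [:1, 1:]"
  have h: "h \<in> polys_over Z"
    unfolding h_def
    by (intro pcompose_polys_over g polys_over_pCons polys_over_0 one_closed)
  have dh: "degree h < p - 1" using g by (simp add: h_def degree_pcompose)
  have "\<theta> \<noteq> 1" using kappa_nonzero by (auto simp: \<kappa>_def)
  then have "poly h \<kappa> = 0"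
    using g(3)[OF theta_power_p] assms(2) by (simp add: h_def poly_pcompose \<kappa>_def)
  moreover have "poly h \<kappa> = (\<Sum>k<p-1. coeff h k * \<kappa> ^ k)"
    unfolding poly_altdef using dh by (intro sum.mono_neutral_left) (auto simp: coeff_eq_0)
  ultimately have "coeff h k = 0" if "k < p - 1" for k
    using kappa_independent[of "coeff h" k] h that by (auto simp: polys_over_def)
  then have "h = 0" using dh by (metis leading_coeff_0_iff)
  then have "g = 0" unfolding h_def by (simp add: pcompose_eq_0_iff)
  then show ?thesis using g(3) assms by simp
qed

end

section \<open>Galois conjugation\<close>

context cyclotomic_dvr begin

lemma theta_powi_eq_power: "\<theta> powi a = \<theta> ^ nat (a mod int p)"
proof -
  have p0: "int p > 0" using p_ge_5 by simp
  have "\<theta> powi a = \<theta> powi (int p * (a div int p) + a mod int p)" by simp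
  also have "\<dots> = (\<theta> powi int p) powi (a div int p) * \<theta> powi (a mod int p)"
    by (simp only: power_int_add[OF disjI1[OF theta_nonzero]] power_int_mult)
  also have "\<theta> powi int p = 1" by (simp add: theta_power_p)
  also have "\<theta> powi (a mod int p) = \<theta> powi int (nat (a mod int p))" using p0 by simp
  finally show ?thesis by (simp only: power_int_of_nat power_int_1_left mult_1)
qed

lemma theta_powi_cong: "[a = b] (mod int p) \<Longrightarrow> \<theta> powi a = \<theta> powi b"
  by (simp add: theta_powi_eq_power cong_def)

lemma theta_powi_in_A: "\<theta> powi a \<in> A"
  by (simp add: theta_powi_eq_power A.power_closed theta_in_A)

lemma theta_powi_eq_1: "\<theta> powi a = 1 \<longleftrightarrow> int p dvd a"
proof -
  have "int p > 0" using p_ge_5 by simp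
  then have "p dvd nat (a mod int p) \<longleftrightarrow> int p dvd a mod int p"
    by (metis int_dvd_int_iff int_nat_eq pos_mod_sign)
  then show ?thesis by (simp add: theta_powi_eq_power theta_power_eq_1 dvd_mod_iff)
qed

text \<open>An arbitrary fraction for x; \<open>sg_eq\<close> shows that the conjugates do not
  depend on this choice.\<close>

definition rep :: "'k \<Rightarrow> 'k poly \<times> nat" where
  "rep x = (SOME fn. fst fn \<in> polys_over Z \<and> x = poly (fst fn) \<theta> / of_nat p ^ snd fn)"

text \<open>The conjugation \<open>\<theta> \<mapsto> \<theta> powi a\<close>. It is set to be zero if \<open>p\<close> divides \<open>a\<close>,
  so that it is additive and multiplicative for every \<open>a\<close>.\<close>

definition sg :: "int \<Rightarrow> 'k \<Rightarrow> 'k" where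
  "sg a x = (if int p dvd a then 0
    else poly (fst (rep x)) (\<theta> powi a) / of_nat p ^ snd (rep x))"

lemma poly_rep: "\<exists>f\<in>polys_over Z. \<exists>n. x = poly f \<theta> / of_nat p ^ n"
  using field_generated[of x] by (auto simp: A_def adjoin_def)

lemma rep: "fst (rep x) \<in> polys_over Z" "x = poly (fst (rep x)) \<theta> / of_nat p ^ snd (rep x)"
proof -
  have "\<exists>fn. fst fn \<in> polys_over Z \<and> x = poly (fst fn) \<theta> / of_nat p ^ snd fn"
    using poly_rep[of x] by auto
  from someI_ex[OF this]
  show "fst (rep x) \<in> polys_over Z" "x = poly (fst (rep x)) \<theta> / of_nat p ^ snd (rep x)"
    unfolding rep_def by auto
qed

lemma sg_dvd: "int p dvd a \<Longrightarrow> sg a x = 0"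
  by (simp add: sg_def)

lemma sg_cong: "[a = b] (mod int p) \<Longrightarrow> sg a = sg b"
  by (auto simp: sg_def fun_eq_iff theta_powi_cong cong_dvd_iff)

text \<open>Two fractions for the same element yield, after clearing denominators, a polynomial that
  vanishes at \<theta>, hence at every conjugate by \<open>conjugate_root\<close>.\<close>

lemma sg_eq:
  assumes f: "f \<in> polys_over Z" and a: "\<not> int p dvd a"
  shows "sg a (poly f \<theta> / of_nat p ^ n) = poly f (\<theta> powi a) / of_nat p ^ n"
proof -
  interpret Q: subring_set "polys_over Z" by (rule subring_polys_over)
  define x where "x = poly f \<theta> / of_nat p ^ n"
  obtain g m where gm: "rep x = (g, m)" by (cases "rep x")
  have g: "g \<in> polys_over Z" "x = poly g \<theta> / of_nat p ^ m" using rep[of x] gm by auto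
  define h where "h = f * [:of_nat p ^ m:] - g * [:of_nat p ^ n:]"
  have "h \<in> polys_over Z"
    unfolding h_def
    by (intro Q.diff_closed Q.mult_closed f g polys_over_const power_closed of_nat_closed)
  moreover have "poly h \<theta> = 0"
    using g x_def p_nonzero by (simp add: h_def field_simps)
  moreover have "(\<theta> powi a) ^ p = 1"
    by (simp add: theta_powi_eq_power theta_power_p flip: power_mult)
       (simp add: mult.commute power_mult theta_power_p)
  moreover have "\<theta> powi a \<noteq> 1" using a by (simp add: theta_powi_eq_1)
  ultimately have "poly h (\<theta> powi a) = 0" by (rule conjugate_root)
  then have "poly f (\<theta> powi a) / of_nat p ^ n = poly g (\<theta> powi a) / of_nat p ^ m"
    using p_nonzero by (simp add: h_def field_simps)
  then show ?thesis using a gm unfolding x_def[symmetric] by (simp add: sg_def)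
qed

lemma sg_add: "sg a (x + y) = sg a x + sg a y"
proof (cases "int p dvd a")
  case False
  interpret Q: subring_set "polys_over Z" by (rule subring_polys_over)
  obtain f n where f: "f \<in> polys_over Z" "x = poly f \<theta> / of_nat p ^ n" using poly_rep by blast
  obtain g m where g: "g \<in> polys_over Z" "y = poly g \<theta> / of_nat p ^ m" using poly_rep by blast
  define h where "h = f * [:of_nat p ^ m:] + g * [:of_nat p ^ n:]"
  have h: "h \<in> polys_over Z"
    unfolding h_def
    by (intro Q.add_closed Q.mult_closed f g polys_over_const power_closed of_nat_closed)
  have "x + y = poly h \<theta> / of_nat p ^ (n + m)"
    using f g p_nonzero by (simp add: h_def add_frac_eq power_add mult.commute)
  then have "sg a (x + y) = poly h (\<theta> powi a) / of_nat p ^ (n + m)"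
    using sg_eq[OF h False] by simp
  also have "\<dots> = sg a x + sg a y"
    unfolding f(2) g(2) sg_eq[OF f(1) False] sg_eq[OF g(1) False]
    using p_nonzero by (simp add: h_def add_frac_eq power_add mult.commute)
  finally show ?thesis .
qed (simp add: sg_def)

lemma sg_mult: "sg a (x * y) = sg a x * sg a y"
proof (cases "int p dvd a")
  case False
  interpret Q: subring_set "polys_over Z" by (rule subring_polys_over)
  obtain f n where f: "f \<in> polys_over Z" "x = poly f \<theta> / of_nat p ^ n" using poly_rep by blast
  obtain g m where g: "g \<in> polys_over Z" "y = poly g \<theta> / of_nat p ^ m" using poly_rep by blast
  have h: "f * g \<in> polys_over Z" by (intro Q.mult_closed f g)
  have "x * y = poly (f * g) \<theta> / of_nat p ^ (n + m)"
    using f g by (simp add: power_add)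
  then have "sg a (x * y) = poly (f * g) (\<theta> powi a) / of_nat p ^ (n + m)"
    using sg_eq[OF h False] by simp
  also have "\<dots> = sg a x * sg a y"
    unfolding f(2) g(2) sg_eq[OF f(1) False] sg_eq[OF g(1) False]
    by (simp add: power_add)
  finally show ?thesis .
qed (simp add: sg_def)

lemma sg_Z: "z \<in> Z \<Longrightarrow> \<not> int p dvd a \<Longrightarrow> sg a z = z"
  using sg_eq[of "[:z:]" a 0] by (simp add: polys_over_const)

lemma sg_theta: "\<not> int p dvd a \<Longrightarrow> sg a \<theta> = \<theta> powi a"
  using sg_eq[of "[:0, 1:]" a 0] by (simp add: polys_over_pCons polys_over_0 zero_closed one_closed)

lemma sg_0: "sg a 0 = 0"
  using sg_add[of a 0 0] by (metis add_0 add_cancel_left_left)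

lemma sg_1: "\<not> int p dvd a \<Longrightarrow> sg a 1 = 1"
  by (simp add: sg_Z one_closed)

lemma sg_uminus: "sg a (- x) = - sg a x"
  using sg_add[of a x "- x"] by (simp add: sg_0 add_eq_0_iff)

lemma sg_diff: "sg a (x - y) = sg a x - sg a y"
  using sg_add[of a x "- y"] by (simp add: sg_uminus)

lemma sg_sum: "sg a (sum f I) = (\<Sum>i\<in>I. sg a (f i))"
  by (induction I rule: infinite_finite_induct) (auto simp: sg_0 sg_add)

lemma sg_inverse: "sg a (inverse x) = inverse (sg a x)"
proof (cases "int p dvd a \<or> x = 0")
  case True
  then show ?thesis by (auto simp: sg_0 sg_dvd)
next
  case False
  then have "sg a x * sg a (inverse x) = 1"
    by (simp add: sg_1 flip: sg_mult)
  then show ?thesis by (metis inverse_unique)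
qed

lemma sg_nonzero: "\<not> int p dvd a \<Longrightarrow> x \<noteq> 0 \<Longrightarrow> sg a x \<noteq> 0"
  using sg_mult[of a x "inverse x"] by (auto simp: sg_1)

lemma sg_power: "\<not> int p dvd a \<Longrightarrow> sg a (x ^ n) = sg a x ^ n"
  by (induction n) (auto simp: sg_1 sg_mult)

lemma sg_powi: "\<not> int p dvd a \<Longrightarrow> sg a (x powi n) = sg a x powi n"
  by (auto simp: power_int_def sg_power sg_inverse)

lemma sg_theta_powi: "\<not> int p dvd a \<Longrightarrow> sg a (\<theta> powi n) = \<theta> powi (a * n)"
  by (simp add: sg_powi sg_theta power_int_mult)

lemma not_dvd_mult: "\<not> int p dvd a \<Longrightarrow> \<not> int p dvd b \<Longrightarrow> \<not> int p dvd a * b"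
  using prime_p prime_dvd_multD[of "int p" a b] by auto

lemma sg_sg: "sg a (sg b x) = sg (a * b) x"
proof (cases "int p dvd a \<or> int p dvd b")
  case True
  then show ?thesis by (auto simp: sg_dvd sg_0)
next
  case False
  then have ab: "\<not> int p dvd a" "\<not> int p dvd b" "\<not> int p dvd a * b" using not_dvd_mult[of a b] by auto
  obtain f n where f: "f \<in> polys_over Z" "x = poly f \<theta> / of_nat p ^ n" using poly_rep by blast
  have "sg b x = poly f (\<theta> powi b) / of_nat p ^ n"
    using sg_eq[OF f(1) ab(2)] f(2) by simp
  then have "sg a (sg b x) = sg a ((\<Sum>i\<le>degree f. coeff f i * (\<theta> powi b) ^ i) / of_nat p ^ n)"
    by (simp only: poly_altdef)
  also have "\<dots> = (\<Sum>i\<le>degree f. coeff f i * (\<theta> powi (a * b)) ^ i) / of_nat p ^ n"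
    using f(1) ab
    by (simp add: divide_inverse sg_mult sg_inverse sg_sum sg_power sg_theta_powi sg_Z
        of_nat_closed polys_over_def)
  also have "\<dots> = poly f (\<theta> powi (a * b)) / of_nat p ^ n"
    by (simp only: poly_altdef)
  also have "\<dots> = sg (a * b) x"
    using sg_eq[OF f(1) ab(3)] f(2) by simp
  finally show ?thesis .
qed

lemma sg_id: "sg 1 x = x"
proof -
  have 1: "\<not> int p dvd 1" using p_ge_5 by simp
  obtain f n where f: "f \<in> polys_over Z" "x = poly f \<theta> / of_nat p ^ n" using poly_rep by blast
  show ?thesis unfolding f(2) sg_eq[OF f(1) 1] by simp
qed

lemma sg_in_A:
  assumes "x \<in> A"
  shows "sg a x \<in> A"
proof (cases "int p dvd a")
  case True
  then show ?thesis by (simp add: sg_dvd A.zero_closed)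
next
  case False
  obtain f where f: "f \<in> polys_over Z" "x = poly f \<theta>" using assms by (auto simp: A_def adjoin_def)
  have "sg a x = poly f (\<theta> powi a)" using sg_eq[OF f(1) False, of 0] f(2) by simp
  then show ?thesis
    using f(1) polys_over_mono[OF Z_subset_A] by (auto intro!: A.poly_closed theta_powi_in_A)
qed

text \<open>The factor g is a cyclotomic unit \<open>geo k\<close>. This is why conjugation respects
  the filtration by \<open>pw\<close>.\<close>

lemma sg_kappa:
  assumes "\<not> int p dvd a"
  obtains g where "g \<in> A" "inverse g \<in> A" "g \<noteq> 0" "sg a \<kappa> = \<kappa> * g"
proof
  define k where "k = nat (a mod int p)"
  have "\<not> p dvd k"
    using assms by (simp add: k_def theta_power_eq_1[symmetric] theta_powi_eq_1 flip: theta_powi_eq_power)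
  then show "geo k \<in> A" "inverse (geo k) \<in> A" "geo k \<noteq> 0"
    using geo_in_A inverse_geo_in_A geo_nonzero by auto
  have "sg a \<kappa> = \<theta> ^ k - 1"
    using assms by (simp add: k_def \<kappa>_def sg_diff sg_1 sg_theta theta_powi_eq_power)
  then show "sg a \<kappa> = \<kappa> * geo k" by (simp add: theta_power_minus_1)
qed

lemma sg_pw:
  assumes "x \<in> pw n"
  shows "sg a x \<in> pw n"
proof (cases "int p dvd a")
  case True
  then show ?thesis by (simp add: sg_dvd pw_zero)
next
  case False
  obtain y where y: "y \<in> A" "x = \<kappa> powi n * y" using assms by (auto simp: pw_def)
  obtain g where g: "g \<in> A" "inverse g \<in> A" "sg a \<kappa> = \<kappa> * g" using sg_kappa[OF False] by metis
  have "g powi n \<in> A" using g by (auto simp: power_int_def intro: A.power_closed)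
  moreover have "sg a x = \<kappa> powi n * (g powi n * sg a y)"
    using y g False by (simp add: sg_mult sg_powi power_int_mult_distrib mult.assoc)
  ultimately show ?thesis
    unfolding pw_def using sg_in_A[OF y(1)] by (auto intro: A.mult_closed)
qed

section \<open>Fourier inversion and the independence of the conjugates\<close>

lemma sum_theta_powi:
  "(\<Sum>j\<in>{0..<int p}. \<theta> powi (a * j)) = (if int p dvd a then of_nat p else 0)"
proof (cases "int p dvd a")
  case True
  then have "\<theta> powi (a * j) = 1" for j by (simp add: theta_powi_eq_1)
  then show ?thesis using True by simp
next
  case False
  define x where "x = \<theta> powi a"
  have "(\<Sum>j\<in>{0..<int p}. \<theta> powi (a * j)) = (\<Sum>j<p. x ^ j)"
    by (rule sum.reindex_bij_witness[of _ int nat])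
      (auto simp: x_def power_int_mult simp flip: power_int_of_nat)
  moreover have "(x - 1) * (\<Sum>j<p. x ^ j) = x ^ p - 1" by (simp add: power_diff_1_eq)
  moreover have "x ^ p = \<theta> powi (a * int p)"
    by (simp add: x_def power_int_mult)
  then have "x ^ p = 1" by (simp add: theta_powi_eq_1)
  moreover have "x \<noteq> 1" using False by (simp add: x_def theta_powi_eq_1)
  ultimately show ?thesis using False by simp
qed

lemma fourier_inversion:
  assumes "x \<in> {0..<int p}"
  shows "(\<Sum>j\<in>{0..<int p}. \<theta> powi (- (j * x)) * (\<Sum>b\<in>{0..<int p}. c b * \<theta> powi (j * b))) = of_nat p * c x"
proof -
  have "(\<Sum>j\<in>{0..<int p}. \<theta> powi (- (j * x)) * (\<Sum>b\<in>{0..<int p}. c b * \<theta> powi (j * b)))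
    = (\<Sum>j\<in>{0..<int p}. \<Sum>b\<in>{0..<int p}. c b * \<theta> powi ((b - x) * j))"
    by (simp add: sum_distrib_left algebra_simps power_int_diff power_int_minus theta_nonzero divide_inverse)
  also have "\<dots> = (\<Sum>b\<in>{0..<int p}. c b * (\<Sum>j\<in>{0..<int p}. \<theta> powi ((b - x) * j)))"
    by (subst sum.swap) (simp add: sum_distrib_left)
  also have "\<dots> = (\<Sum>b\<in>{0..<int p}. if b = x then of_nat p * c b else 0)"
  proof (rule sum.cong)
    fix b assume "b \<in> {0..<int p}"
    then have "int p dvd b - x \<longleftrightarrow> b = x"
      using assms by (auto dest: zdvd_imp_le simp: mod_eq_dvd_iff[symmetric])
    then show "c b * (\<Sum>j\<in>{0..<int p}. \<theta> powi ((b - x) * j)) = (if b = x then of_nat p * c b else 0)"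
      by (auto simp: sum_theta_powi)
  qed simp
  also have "\<dots> = of_nat p * c x" using assms by simp
  finally show ?thesis .
qed

text \<open>A form of Dedekind's independence of characters: inserting \<theta>^j \<kappa>^i for u
  turns the hypothesis into the vanishing of a Fourier transform in j.\<close>

lemma conjugates_independent:
  assumes "\<And>u. u \<in> pw (int i) \<Longrightarrow> (\<Sum>x\<in>{0..<int p}. c x * sg x u) = 0"
    and "x \<in> {0..<int p}" "\<not> int p dvd x"
  shows "c x = 0"
proof -
  \<comment> \<open>The value 0 at multiples of p matches \<open>sg\<close>, which vanishes there,
    whereas the corresponding power of \<theta> does not.\<close>
  define d where "d b = (if int p dvd b then 0 else c b * sg b (\<kappa> ^ i))" for b
  have "(\<Sum>b\<in>{0..<int p}. d b * \<theta> powi (j * b)) = 0" for j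
  proof -
    have "(\<Sum>b\<in>{0..<int p}. d b * \<theta> powi (j * b))
      = (\<Sum>b\<in>{0..<int p}. c b * sg b (\<theta> powi j * \<kappa> ^ i))"
      by (intro sum.cong) (auto simp: d_def sg_dvd sg_mult sg_theta_powi mult_ac)
    also have "\<dots> = 0"
      by (intro assms pw_A_mult theta_powi_in_A kappa_power_in_pw)
    finally show ?thesis .
  qed
  then have "of_nat p * d x = 0"
    using fourier_inversion[OF assms(2), of d] by simp
  then have "c x * sg x (\<kappa> ^ i) = 0" using assms(3) p_nonzero by (simp add: d_def)
  then show ?thesis using sg_nonzero[OF assms(3)] kappa_nonzero by simp
qed

end

section \<open>An Engel theorem for structure constants graded by residues\<close>

text \<open>\<open>T a b\<close> is the structure constant of \<open>[e_a, e_b] = T a b * e_(a+b)\<close> in a Lie algebra graded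
  by the nonzero residues modulo \<open>n\<close> with homogeneous components of dimension one. The proof is
  the one of Engel's theorem. The map \<open>ad e_b\<close> is nilpotent since iterating the shift by \<open>b\<close>
  meets the residue zero.\<close>

lemma graded_engel:
  fixes T :: "int \<Rightarrow> int \<Rightarrow> 'a::idom" and p :: nat
  assumes prime: "prime p"
    and mod_left: "\<And>x y. T (x mod int p) y = T x y"
    and mod_right: "\<And>x y. T x (y mod int p) = T x y"
    and zero_sum: "\<And>x y. int p dvd x + y \<Longrightarrow> T x y = 0"
    and diag: "\<And>x. T x x = 0"
    and anti: "\<And>x y. T y x = - T x y"
    and jac: "\<And>x y z. T x y * T (x + y) z + T y z * T (y + z) x + T z x * T (z + x) y = 0"
  shows "\<exists>c\<in>{1..<int p}. \<forall>a\<in>{1..<int p}. T a c = 0"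
proof -
  define I where "I = {1..<int p}"
  \<comment> \<open>The span of the e_b with b in U is mapped into itself by all
    \<open>ad e_a\<close> with a in S.\<close>
  define stable where "stable S U \<longleftrightarrow> (\<forall>a\<in>S. \<forall>b\<in>U. T a b \<noteq> 0 \<longrightarrow> (a + b) mod int p \<in> U)" for S U
  \<comment> \<open>Engel's conclusion for S: modulo any proper coordinate subspace U that S leaves
    invariant, S annihilates some basis vector outside U.\<close>
  define engel where "engel S \<longleftrightarrow> (\<forall>U. U \<subset> I \<longrightarrow> stable S U \<longrightarrow>
      (\<exists>b\<in>I - U. \<forall>a\<in>S. T a b \<noteq> 0 \<longrightarrow> (a + b) mod int p \<in> U))" for S
  have p1: "int p > 1" using prime prime_gt_1_nat by simp
  have finI: "finite I" by (simp add: I_def)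
  have modI: "x mod int p \<in> I \<longleftrightarrow> \<not> int p dvd x" for x
  proof -
    have "0 \<le> x mod int p" "x mod int p < int p" using p1 by auto
    then show ?thesis unfolding I_def by (auto simp: dvd_eq_mod_eq_0)
  qed
  have sumI: "(x + y) mod int p \<in> I" if "T x y \<noteq> 0" for x y
    using zero_sum[of x y] that by (auto simp: modI)
  \<comment> \<open>With U = S, Engel's conclusion yields an e_b that normalizes the span of S.
    Adjoining it gives a subalgebra with one more basis vector.\<close>
  have step: "\<exists>b\<in>I - S. stable (insert b S) (insert b S) \<and> engel (insert b S)"
    if S: "S \<subset> I" "stable S S" "engel S" for S
  proof -
    obtain b where b: "b \<in> I - S" "\<And>a. a \<in> S \<Longrightarrow> T a b \<noteq> 0 \<Longrightarrow> (a + b) mod int p \<in> S"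
      using S(3)[unfolded engel_def, rule_format, OF S(1,2)] by auto
    have "stable (insert b S) (insert b S)"
      unfolding stable_def
    proof (intro ballI impI)
      fix a c assume ac: "a \<in> insert b S" "c \<in> insert b S" "T a c \<noteq> 0"
      consider "a = b" "c = b" | "a = b" "c \<in> S" | "a \<in> S" "c = b" | "a \<in> S" "c \<in> S"
        using ac by blast
      then show "(a + c) mod int p \<in> insert b S"
      proof cases
        case 1
        then show ?thesis using ac diag by blast
      next
        case 2
        then have "T c b \<noteq> 0" using ac anti[of b c] by simp
        then show ?thesis using b(2)[of c] 2 by (simp add: add.commute)
      next
        case 3
        then show ?thesis using b(2) ac by simp
      next
        case 4
        then show ?thesis using S(2) ac unfolding stable_def by simp
      qed
    qed
    moreover have "engel (insert b S)"
      unfolding engel_def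
    proof (intro allI impI)
      fix U assume U: "U \<subset> I" "stable (insert b S) U"
      \<comment> \<open>The basis vectors that S annihilates modulo U. Since brackets of e_b with S
        stay in S, the Jacobi identity shows that \<open>ad e_b\<close> preserves them modulo
        U.\<close>
      define N where "N = {x \<in> I - U. \<forall>a\<in>S. T a x \<noteq> 0 \<longrightarrow> (a + x) mod int p \<in> U}"
      have "stable S U" using U(2) by (simp add: stable_def)
      then have "N \<noteq> {}"
        using S(3)[unfolded engel_def, rule_format, OF U(1)] by (auto simp: N_def)
      have next_in_N: "(b + x) mod int p \<in> N"
        if x: "x \<in> N" "T b x \<noteq> 0" "(b + x) mod int p \<notin> U" for x
      proof -
        have "(a + (b + x) mod int p) mod int p \<in> U"
          if a: "a \<in> S" "T a ((b + x) mod int p) \<noteq> 0" for a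
        proof -
          have "T b x * T (b + x) a \<noteq> 0"
            using x(2) a(2) anti[of "b + x" a] by (simp add: mod_right)
          then have "T x a * T (x + a) b \<noteq> 0 \<or> T a b * T (a + b) x \<noteq> 0"
            using jac[of b x a] by auto
          then have "(a + b + x) mod int p \<in> U"
          proof
            assume *: "T x a * T (x + a) b \<noteq> 0"
            then have "T a x \<noteq> 0" using anti[of a x] by auto
            then have "(a + x) mod int p \<in> U" using x(1) a(1) unfolding N_def by blast
            moreover have "T b ((a + x) mod int p) \<noteq> 0"
              using * anti[of "x + a" b] by (simp add: mod_right add.commute)
            ultimately have "(b + (a + x) mod int p) mod int p \<in> U"
              using U(2) unfolding stable_def by blast
            then show ?thesis by (simp add: mod_add_right_eq ac_simps)
          next
            assume *: "T a b * T (a + b) x \<noteq> 0"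
            then have "(a + b) mod int p \<in> S" using b(2) a(1) by auto
            moreover have "T ((a + b) mod int p) x \<noteq> 0" using * by (simp add: mod_left)
            ultimately have "((a + b) mod int p + x) mod int p \<in> U" using x(1) unfolding N_def by blast
            then show ?thesis by (simp add: mod_add_left_eq)
          qed
          then show ?thesis by (simp add: mod_add_right_eq ac_simps)
        qed
        then show ?thesis using sumI[OF x(2)] x(3) unfolding N_def by blast
      qed
      have "\<exists>x\<in>N. T b x \<noteq> 0 \<longrightarrow> (b + x) mod int p \<in> U"
      proof (rule ccontr)
        assume "\<not> (\<exists>x\<in>N. T b x \<noteq> 0 \<longrightarrow> (b + x) mod int p \<in> U)"
        then have shift: "(b + x) mod int p \<in> N" if "x \<in> N" for x using next_in_N that by blast
        obtain x where x: "x \<in> N" using \<open>N \<noteq> {}\<close> by blast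
        have iter: "(int k * b + x) mod int p \<in> N" for k
        proof (induction k)
          case 0
          have "x \<in> I" using x by (auto simp: N_def)
          then have "x mod int p = x" by (auto simp: I_def)
          then show ?case using x by simp
        next
          case (Suc k)
          then have "(b + (int k * b + x) mod int p) mod int p \<in> N" by (rule shift)
          then show ?case by (simp add: mod_add_right_eq algebra_simps)
        qed
        have "b \<in> I" using b by simp
        then have "\<not> int p dvd b" by (auto simp: I_def dest: zdvd_imp_le)
        then have "coprime b (int p)"
          using prime prime_imp_coprime[of "int p" b] by (simp add: coprime_commute)
        then obtain c where c: "[b * c = 1] (mod int p)" using cong_solve_coprime_int by blast
        \<comment> \<open>This k solves k b + x = 0 modulo p, so after k shifts the residue 0 would
          lie in \<open>N\<close>.\<close>
        define k where "k = nat ((- x * c) mod int p)"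
        have "int k = (- x * c) mod int p" using p1 by (simp add: k_def)
        then have "[int k = - x * c] (mod int p)" by (simp add: cong_def)
        then have "[int k * b + x = (- x * c) * b + x] (mod int p)" by (intro cong_add cong_mult cong_refl)
        also have "(- x * c) * b + x = - x * (b * c) + x" by simp
        also have "[\<dots> = - x * 1 + x] (mod int p)" by (intro cong_add cong_mult cong_refl c)
        finally have "(int k * b + x) mod int p = 0" by (simp add: cong_def)
        then show False using iter[of k] by (auto simp: N_def I_def)
      qed
      then obtain x where x: "x \<in> N" "T b x \<noteq> 0 \<longrightarrow> (b + x) mod int p \<in> U" by blast
      then show "\<exists>x\<in>I - U. \<forall>a\<in>insert b S. T a x \<noteq> 0 \<longrightarrow> (a + x) mod int p \<in> U"
        by (intro bexI[of _ x]) (auto simp: N_def)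
    qed
    ultimately show ?thesis using b(1) by blast
  qed
  have "\<exists>S. S \<subseteq> I \<and> stable S S \<and> engel S \<and> card S = k" if "k \<le> card I" for k
    using that
  proof (induction k)
    case 0
    show ?case by (rule exI[of _ "{}"]) (auto simp: stable_def engel_def)
  next
    case (Suc k)
    then obtain S where S: "S \<subseteq> I" "stable S S" "engel S" "card S = k" by auto
    then have "S \<subset> I" using Suc.prems by auto
    from step[OF this S(2,3)] obtain b where "b \<in> I - S" "stable (insert b S) (insert b S)" "engel (insert b S)"
      by blast
    moreover have "finite S" using S(1) finI finite_subset by blast
    ultimately show ?case using S by (intro exI[of _ "insert b S"]) auto
  qed
  then obtain S where S: "S \<subseteq> I" "engel S" "card S = card I" by blast
  then have "S = I" using finI card_subset_eq by blast
  moreover have "{} \<subset> I" using p1 by (auto simp: I_def)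
  moreover have "stable S {}" by (simp add: stable_def)
  \<comment> \<open>For S = I and empty U, Engel's conclusion is the existence of a central basis
    vector.\<close>
  ultimately have "\<exists>b\<in>I - {}. \<forall>a\<in>I. T a b \<noteq> 0 \<longrightarrow> (a + b) mod int p \<in> {}"
    using S(2) unfolding engel_def by blast
  then show ?thesis unfolding I_def by auto
qed

section \<open>Structure constants of an equivariant alternating form\<close>

context cyclotomic_dvr begin

lemma sum_residues_reindex:
  fixes f :: "int \<Rightarrow> 'k"
  assumes periodic: "\<And>x. f (x mod int p) = f x"
    and inj: "\<And>x y. [h x = h y] (mod int p) \<Longrightarrow> [x = y] (mod int p)"
  shows "(\<Sum>x\<in>{0..<int p}. f (h x)) = (\<Sum>x\<in>{0..<int p}. f x)"
proof -
  have p0: "int p > 0" using p_ge_5 by simp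
  let ?g = "\<lambda>x. h x mod int p"
  have "inj_on ?g {0..<int p}"
  proof (rule inj_onI)
    fix x y assume xy: "x \<in> {0..<int p}" "y \<in> {0..<int p}" "?g x = ?g y"
    have "[x = y] (mod int p)" by (rule inj) (use xy(3) in \<open>simp add: cong_def\<close>)
    then show "x = y" using xy(1,2) by (simp add: cong_def)
  qed
  moreover have "?g ` {0..<int p} \<subseteq> {0..<int p}" using p0 by auto
  ultimately have "bij_betw ?g {0..<int p} {0..<int p}"
    by (simp add: bij_betw_def endo_inj_surj)
  then have "(\<Sum>x\<in>{0..<int p}. f (?g x)) = (\<Sum>x\<in>{0..<int p}. f x)"
    by (rule sum.reindex_bij_betw)
  then show ?thesis by (simp add: periodic)
qed

lemma sum_residues_flip:
  fixes f :: "int \<Rightarrow> 'k"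
  assumes "\<And>x. f (x mod int p) = f x"
  shows "(\<Sum>x\<in>{0..<int p}. f (s - x)) = (\<Sum>x\<in>{0..<int p}. f x)"
proof (rule sum_residues_reindex[where f = f and h = "\<lambda>x. s - x"], rule assms)
  fix x y assume "[s - x = s - y] (mod int p)"
  from cong_diff[OF cong_refl[of s] this] show "[x = y] (mod int p)" by simp
qed

lemma sum_residues_shift:
  fixes f :: "int \<Rightarrow> 'k"
  assumes "\<And>x. f (x mod int p) = f x"
  shows "(\<Sum>x\<in>{0..<int p}. f (x + s)) = (\<Sum>x\<in>{0..<int p}. f x)"
proof (rule sum_residues_reindex[where f = f and h = "\<lambda>x. x + s"], rule assms)
  fix x y assume "[x + s = y + s] (mod int p)"
  then show "[x = y] (mod int p)" by (simp add: cong_add_rcancel)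
qed

lemma sg_mod: "sg (a mod int p) = sg a"
  by (rule sg_cong) simp

text \<open>Fixing v = \<kappa>^i leaves a relation between conjugates of u alone. The divisibility
  conditions exclude the terms in which \<open>sg\<close> vanishes identically, as these say nothing
  about their coefficient.\<close>

lemma bi_independent:
  assumes "\<And>u v. u \<in> pw (int i) \<Longrightarrow> v \<in> pw (int i) \<Longrightarrow>
      (\<Sum>x\<in>{0..<int p}. c x * sg x u * sg (s - x) v) = 0"
    and x: "x \<in> {0..<int p}" "\<not> int p dvd x" "\<not> int p dvd s - x"
  shows "c x = 0"
proof -
  have "c x * sg (s - x) (\<kappa> ^ i) = 0"
    by (rule conjugates_independent[of i "\<lambda>x. c x * sg (s - x) (\<kappa> ^ i)"])
      (use assms(1)[OF _ kappa_power_in_pw] x in \<open>auto simp: mult_ac\<close>)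
  then show ?thesis using sg_nonzero[OF x(3)] kappa_nonzero by simp
qed

lemma tri_independent:
  assumes "\<And>u v w. u \<in> pw (int i) \<Longrightarrow> v \<in> pw (int i) \<Longrightarrow> w \<in> pw (int i) \<Longrightarrow>
      (\<Sum>x\<in>{0..<int p}. \<Sum>y\<in>{0..<int p}. c x y * sg x u * sg y v * sg (s - x - y) w) = 0"
    and x: "x \<in> {0..<int p}" "\<not> int p dvd x" and y: "y \<in> {0..<int p}" "\<not> int p dvd y"
    and s: "\<not> int p dvd s - x - y"
  shows "c x y = 0"
proof -
  have "(\<Sum>y\<in>{0..<int p}. c x y * sg y v * sg (s - x - y) w) = 0"
    if "v \<in> pw (int i)" "w \<in> pw (int i)" for v w
  proof (rule conjugates_independent[of i "\<lambda>x. \<Sum>y\<in>{0..<int p}. c x y * sg y v * sg (s - x - y) w"])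
    fix u assume "u \<in> pw (int i)"
    from assms(1)[OF this that]
    show "(\<Sum>x\<in>{0..<int p}. (\<Sum>y\<in>{0..<int p}. c x y * sg y v * sg (s - x - y) w) * sg x u) = 0"
      unfolding sum_distrib_right by (simp add: mult_ac)
  qed (use x in auto)
  then show ?thesis
    by (rule bi_independent[of i "c x" "s - x"]) (use y s in auto)
qed

definition Z_linear_on :: "'k set \<Rightarrow> ('k \<Rightarrow> 'k) \<Rightarrow> bool" where
  "Z_linear_on M F \<longleftrightarrow> (\<forall>x\<in>M. \<forall>y\<in>M. F (x + y) = F x + F y) \<and> (\<forall>a\<in>Z. \<forall>x\<in>M. F (a * x) = a * F x)"

lemma Z_linear_on_sum:
  assumes "Z_linear_on (pw n) F" "\<And>k. k \<in> I \<Longrightarrow> z k \<in> Z" "\<And>k. k \<in> I \<Longrightarrow> m k \<in> pw n"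
  shows "F (\<Sum>k\<in>I. z k * m k) = (\<Sum>k\<in>I. z k * F (m k))"
proof -
  have "F (0 * 0) = 0 * F 0"
    using assms(1) zero_closed pw_zero unfolding Z_linear_on_def by blast
  then have F0: "F 0 = 0" by simp
  have m: "z k * m k \<in> pw n" if "k \<in> I" for k
    using assms(2,3) that Z_subset_A by (blast intro: pw_A_mult)
  show ?thesis
    using assms(2,3) m
  proof (induction I rule: infinite_finite_induct)
    case (insert k I)
    have "(\<Sum>k\<in>I. z k * m k) \<in> pw n" using insert by (intro pw_sum) auto
    then show ?case
      using insert assms(1) unfolding Z_linear_on_def by simp
  qed (auto simp: F0)
qed

text \<open>The elements \<kappa>^i \<theta>^j span the lattice over \<open>Z\<close>.\<close>

lemma Z_linear_on_eqI:
  assumes F: "Z_linear_on (pw (int i)) F" and G: "Z_linear_on (pw (int i)) G"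
    and eq: "\<And>j. F (\<kappa> ^ i * \<theta> ^ j) = G (\<kappa> ^ i * \<theta> ^ j)"
    and u: "u \<in> pw (int i)"
  shows "F u = G u"
proof -
  obtain a where a: "a \<in> A" "u = \<kappa> ^ i * a" using u by (auto simp: pw_def)
  obtain z where z: "\<And>k. z k \<in> Z" "a = (\<Sum>k<p. z k * \<theta> ^ k)" using adjoin_span[OF a(1)] by blast
  have e: "u = (\<Sum>k<p. z k * (\<kappa> ^ i * \<theta> ^ k))"
    using a z by (simp add: sum_distrib_left mult_ac)
  have m: "\<kappa> ^ i * \<theta> ^ k \<in> pw (int i)" for k
    using pw_A_mult[OF _ kappa_power_in_pw] A.power_closed[OF theta_in_A] by (simp add: mult.commute)
  show ?thesis
    unfolding e
    using Z_linear_on_sum[OF F z(1) m, of _ "\<lambda>k. k"] Z_linear_on_sum[OF G z(1) m, of _ "\<lambda>k. k"] eq by simp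
qed

end

text \<open>The map from (u, v) to \<gamma>(u \<and> v) as a bilinear form, detached from the
  quotient construction of the exterior square.\<close>

locale theta_form = cyclotomic_dvr Z p \<theta> for Z :: "'k::field set" and p \<theta> +
  fixes i :: nat and b :: "'k \<Rightarrow> 'k \<Rightarrow> 'k"
  assumes lin_left: "v \<in> pw (int i) \<Longrightarrow> Z_linear_on (pw (int i)) (\<lambda>u. b u v)"
    and lin_right: "u \<in> pw (int i) \<Longrightarrow> Z_linear_on (pw (int i)) (b u)"
    and alt: "u \<in> pw (int i) \<Longrightarrow> b u u = 0"
    and theta_equivariant: "u \<in> pw (int i) \<Longrightarrow> v \<in> pw (int i) \<Longrightarrow> b (\<theta> * u) (\<theta> * v) = \<theta> * b u v"
    and b_in_pw: "u \<in> pw (int i) \<Longrightarrow> v \<in> pw (int i) \<Longrightarrow> b u v \<in> pw (2 * int i + 1)"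
begin

abbreviation "M \<equiv> pw (int i)"
abbreviation "I \<equiv> {0..<int p}"

lemma b_in_M: "u \<in> M \<Longrightarrow> v \<in> M \<Longrightarrow> b u v \<in> M"
  using b_in_pw pw_mono[of "int i" "2 * int i + 1"] by auto

lemma b_add_left: "u \<in> M \<Longrightarrow> u' \<in> M \<Longrightarrow> v \<in> M \<Longrightarrow> b (u + u') v = b u v + b u' v"
  using lin_left by (auto simp: Z_linear_on_def)

lemma b_add_right: "u \<in> M \<Longrightarrow> v \<in> M \<Longrightarrow> v' \<in> M \<Longrightarrow> b u (v + v') = b u v + b u v'"
  using lin_right by (auto simp: Z_linear_on_def)

lemma b_anti: "u \<in> M \<Longrightarrow> v \<in> M \<Longrightarrow> b v u = - b u v"
  using alt[of "u + v"] alt[of u] alt[of v]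
  by (simp add: b_add_left b_add_right pw_add eq_neg_iff_add_eq_0 add.commute)

lemma theta_M: "\<theta> powi n * \<kappa> ^ i \<in> M"
  by (intro pw_A_mult theta_powi_in_A kappa_power_in_pw)

lemma kappa_M: "\<kappa> ^ i \<in> M"
  by (rule kappa_power_in_pw)

lemma theta_powi_equivariant:
  assumes "u \<in> M" "v \<in> M"
  shows "b (\<theta> powi n * u) (\<theta> powi n * v) = \<theta> powi n * b u v"
proof -
  have "b (\<theta> ^ k * u) (\<theta> ^ k * v) = \<theta> ^ k * b u v" for k
  proof (induction k)
    case (Suc k)
    have "\<theta> ^ k * u \<in> M" "\<theta> ^ k * v \<in> M"
      using assms by (auto intro: pw_A_mult A.power_closed theta_in_A)
    from theta_equivariant[OF this] show ?case using Suc by (simp add: mult.assoc)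
  qed simp
  then show ?thesis by (simp add: theta_powi_eq_power)
qed

text \<open>By bilinearity and equivariance these values determine the form: at \<theta>^j
  \<kappa>^i and \<theta>^k \<kappa>^i it equals
  \<open>\<theta> powi k * gen (j - k)\<close>.\<close>

definition gen :: "int \<Rightarrow> 'k" where
  "gen j = b (\<theta> powi j * \<kappa> ^ i) (\<kappa> ^ i)"

text \<open>The numerator of \<open>T x y\<close> is the Fourier transform of the values of the form on
  generators.\<close>

definition T :: "int \<Rightarrow> int \<Rightarrow> 'k" where
  "T x y = (\<Sum>j\<in>I. \<theta> powi (- (j * x)) * sg (x + y) (gen j)) /
     (of_nat p * sg x (\<kappa> ^ i) * sg y (\<kappa> ^ i))"

lemma T_cong:
  assumes "[x = x'] (mod int p)" "[y = y'] (mod int p)"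
  shows "T x y = T x' y'"
proof -
  have "\<theta> powi (- (j * x)) = \<theta> powi (- (j * x'))" for j
    using assms by (intro theta_powi_cong) (simp add: cong_mult cong_minus_minus_iff)
  moreover have "sg (x + y) = sg (x' + y')" using assms by (intro sg_cong cong_add)
  ultimately show ?thesis using sg_cong[OF assms(1)] sg_cong[OF assms(2)] by (simp add: T_def)
qed

lemma T_mod_left: "T (x mod int p) y = T x y"
  by (rule T_cong) auto

lemma T_mod_right: "T x (y mod int p) = T x y"
  by (rule T_cong) auto

text \<open>If x or y is divisible by p, the denominator is 0 and division by zero yields 0. If x +
  y is, the numerator vanishes.\<close>

lemma T_zero:
  assumes "int p dvd x \<or> int p dvd y \<or> int p dvd x + y"
  shows "T x y = 0"
  using assms by (auto simp: T_def sg_dvd)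

lemma gen_cong: "[j = j'] (mod int p) \<Longrightarrow> gen j = gen j'"
  by (simp add: gen_def theta_powi_cong)

text \<open>The sum of all p-th roots of unity is 0. This kills the Fourier coefficient at residue
  0, where \<open>sg\<close> is not a conjugation.\<close>

lemma sum_gen: "(\<Sum>j\<in>I. gen j) = 0"
proof -
  have "(\<Sum>j\<in>I. gen j) = b (\<Sum>j\<in>I. 1 * (\<theta> powi j * \<kappa> ^ i)) (\<kappa> ^ i)"
    unfolding gen_def
    by (subst Z_linear_on_sum[OF lin_left[OF kappa_M]]) (auto simp: one_closed theta_M)
  also have "(\<Sum>j\<in>I. 1 * (\<theta> powi j * \<kappa> ^ i)) = (\<Sum>j\<in>I. \<theta> powi (1 * j)) * \<kappa> ^ i"
    by (simp add: sum_distrib_right)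
  also have "\<dots> = 0" using p_ge_5 by (simp only: sum_theta_powi) auto
  also have "b 0 (\<kappa> ^ i) = 0"
    using b_add_left[OF pw_zero pw_zero kappa_M] by (metis add_0 add_cancel_left_left)
  finally show ?thesis .
qed

text \<open>Alternation gives \<open>\<theta> powi (- j) * gen j = - gen (- j)\<close>. This kills
  the Fourier coefficient at x = s, where the index s - x of v would be 0.\<close>

lemma sum_gen': "(\<Sum>j\<in>I. \<theta> powi (- j) * gen j) = 0"
proof -
  have "\<theta> powi (- j) * gen j = - gen (- j)" for j
  proof -
    have "\<theta> powi (- j) * gen j = b (\<theta> powi (- j) * (\<theta> powi j * \<kappa> ^ i)) (\<theta> powi (- j) * \<kappa> ^ i)"
      unfolding gen_def by (rule theta_powi_equivariant[OF theta_M kappa_M, symmetric])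
    also have "\<theta> powi (- j) * (\<theta> powi j * \<kappa> ^ i) = \<kappa> ^ i"
      using theta_nonzero by (simp add: power_int_minus mult.assoc[symmetric])
    also have "b (\<kappa> ^ i) (\<theta> powi (- j) * \<kappa> ^ i) = - gen (- j)"
      unfolding gen_def by (rule b_anti[OF theta_M kappa_M])
    finally show ?thesis .
  qed
  moreover have "(\<Sum>j\<in>I. gen (0 - j)) = (\<Sum>j\<in>I. gen j)"
    by (rule sum_residues_flip) (auto intro: gen_cong)
  ultimately show ?thesis by (simp add: sum_negf sum_gen)
qed

text \<open>Both sides are \<open>Z\<close>-linear in each variable, so it suffices to compare them
  at u = \<theta>^j \<kappa>^i and v = \<theta>^k \<kappa>^i. There equivariance reduces the form to
  \<open>gen (j - k)\<close>, which is recovered by Fourier inversion.\<close>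

lemma expansion:
  assumes u: "u \<in> M" and v: "v \<in> M"
  shows "sg s (b u v) = (\<Sum>x\<in>I. T x (s - x) * sg x u * sg (s - x) v)"
proof (cases "int p dvd s")
  case True
  then show ?thesis by (simp add: sg_dvd T_zero)
next
  case s: False
  define c where "c x = (\<Sum>j\<in>I. \<theta> powi (- (j * x)) * sg s (gen j)) / of_nat p" for x
  have c0: "c x = 0" if "int p dvd x" for x
  proof -
    have "\<theta> powi (- (j * x)) = 1" for j using that by (simp add: theta_powi_eq_1)
    then show ?thesis by (simp add: c_def sum_gen sg_0 flip: sg_sum)
  qed
  have cs: "c x = 0" if "int p dvd s - x" for x
  proof -
    have "\<theta> powi (- (j * x)) = sg s (\<theta> powi (- j))" for j
    proof -
      have "[x = s] (mod int p)" using that by (simp add: cong_iff_dvd_diff dvd_diff_commute)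
      then have "[- (j * x) = s * - j] (mod int p)"
        by (simp add: cong_minus_minus_iff cong_scalar_left mult.commute)
      then show ?thesis using s by (simp add: sg_theta_powi theta_powi_cong)
    qed
    then show ?thesis by (simp add: c_def sum_gen' sg_0 flip: sg_sum sg_mult)
  qed
  have inv: "sg s (gen n) = (\<Sum>x\<in>I. c x * \<theta> powi (n * x))" for n
  proof -
    have "(\<Sum>x\<in>I. c x * \<theta> powi (n * x))
      = (\<Sum>x\<in>I. \<Sum>j\<in>I. sg s (gen j) * \<theta> powi ((n - j) * x)) / of_nat p"
      by (simp add: c_def sum_divide_distrib sum_distrib_right sum_distrib_left algebra_simps
          power_int_diff power_int_minus theta_nonzero divide_inverse)
    also have "(\<Sum>x\<in>I. \<Sum>j\<in>I. sg s (gen j) * \<theta> powi ((n - j) * x))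
      = (\<Sum>j\<in>I. sg s (gen j) * (\<Sum>x\<in>I. \<theta> powi ((n - j) * x)))"
      by (subst sum.swap) (simp add: sum_distrib_left)
    also have "\<dots> = (\<Sum>j\<in>I. if j = n mod int p then sg s (gen n) * of_nat p else 0)"
    proof (rule sum.cong)
      fix j assume j: "j \<in> I"
      then have e: "int p dvd n - j \<longleftrightarrow> j = n mod int p"
        by (auto simp: mod_eq_dvd_iff[symmetric])
      have "gen (n mod int p) = gen n" by (rule gen_cong) simp
      then show "sg s (gen j) * (\<Sum>x\<in>I. \<theta> powi ((n - j) * x))
          = (if j = n mod int p then sg s (gen n) * of_nat p else 0)"
        using e by (auto simp: sum_theta_powi)
    qed simp
    also have "\<dots> = sg s (gen n) * of_nat p" using p_ge_5 by simp
    finally show ?thesis using p_nonzero by simp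
  qed
  \<comment> \<open>The denominator of \<open>T\<close> cancels against the conjugates of
    \<kappa>^i. At the excluded residues both sides vanish, the right one by \<open>c0\<close> and
    \<open>cs\<close>.\<close>
  have Tc: "T x (s - x) * sg x (\<theta> powi j * \<kappa> ^ i) * sg (s - x) (\<theta> powi k * \<kappa> ^ i)
      = c x * \<theta> powi (j * x + k * (s - x))" for x j k
  proof (cases "int p dvd x \<or> int p dvd s - x")
    case True
    then have "c x = 0" using c0 cs by blast
    then show ?thesis using True by (auto simp: T_zero)
  next
    case False
    then have "sg x (\<kappa> ^ i) \<noteq> 0" "sg (s - x) (\<kappa> ^ i) \<noteq> 0"
      using kappa_nonzero by (simp_all add: sg_nonzero)
    then have "T x (s - x) * sg x (\<kappa> ^ i) * sg (s - x) (\<kappa> ^ i) = c x"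
      using p_nonzero by (simp add: T_def c_def)
    then show ?thesis
      using False by (simp add: sg_mult sg_theta_powi power_int_add theta_nonzero mult_ac)
  qed
  have on_gen: "sg s (b (\<theta> powi j * \<kappa> ^ i) (\<theta> powi k * \<kappa> ^ i))
      = (\<Sum>x\<in>I. T x (s - x) * sg x (\<theta> powi j * \<kappa> ^ i) * sg (s - x) (\<theta> powi k * \<kappa> ^ i))" for j k
  proof -
    have e: "\<theta> powi k * (\<theta> powi (j - k) * \<kappa> ^ i) = \<theta> powi j * \<kappa> ^ i"
      by (simp add: mult.assoc[symmetric] theta_nonzero flip: power_int_add)
    have "b (\<theta> powi j * \<kappa> ^ i) (\<theta> powi k * \<kappa> ^ i) = \<theta> powi k * gen (j - k)"
      using theta_powi_equivariant[OF theta_M kappa_M, of k "j - k"] unfolding e gen_def .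
    then have "sg s (b (\<theta> powi j * \<kappa> ^ i) (\<theta> powi k * \<kappa> ^ i))
      = \<theta> powi (s * k) * (\<Sum>x\<in>I. c x * \<theta> powi ((j - k) * x))"
      using s by (simp add: sg_mult sg_theta_powi inv)
    also have "\<dots> = (\<Sum>x\<in>I. c x * \<theta> powi (j * x + k * (s - x)))"
    proof -
      have "\<theta> powi (s * k) * \<theta> powi ((j - k) * x) = \<theta> powi (j * x + k * (s - x))" for x
        by (simp add: theta_nonzero algebra_simps flip: power_int_add)
      then show ?thesis by (simp add: sum_distrib_left mult.left_commute)
    qed
    finally show ?thesis by (simp only: Tc)
  qed
  define R where "R u v = (\<Sum>x\<in>I. T x (s - x) * sg x u * sg (s - x) v)" for u v
  have Z1: "T x y * sg x (a * w) = a * (T x y * sg x w)" if "a \<in> Z" for x y a w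
    using that by (cases "int p dvd x") (auto simp: T_zero sg_mult sg_Z)
  have Z2: "T x y * (v * sg y (a * w)) = a * (T x y * (v * sg y w))" if "a \<in> Z" for x y a w v
    using that by (cases "int p dvd y") (auto simp: T_zero sg_mult sg_Z)
  have R1: "Z_linear_on M (\<lambda>u. R u v)" for v
    unfolding Z_linear_on_def R_def
    by (auto simp: sg_add sum.distrib ring_distribs Z1 sum_distrib_left mult.assoc)
  have R2: "Z_linear_on M (R u)" for u
    unfolding Z_linear_on_def R_def
    by (auto simp: sg_add sum.distrib ring_distribs Z2 sum_distrib_left mult.assoc)
  have S1: "Z_linear_on M (\<lambda>u. sg s (b u v))" if "v \<in> M" for v
    using lin_left[OF that] s unfolding Z_linear_on_def by (auto simp: sg_add sg_mult sg_Z)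
  have S2: "Z_linear_on M (\<lambda>v. sg s (b u v))" if "u \<in> M" for u
    using lin_right[OF that] s unfolding Z_linear_on_def by (auto simp: sg_add sg_mult sg_Z)
  have g: "\<theta> powi int k * \<kappa> ^ i = \<kappa> ^ i * \<theta> ^ k" for k by simp
  have "sg s (b u (\<kappa> ^ i * \<theta> ^ k)) = R u (\<kappa> ^ i * \<theta> ^ k)" for k
  proof (rule Z_linear_on_eqI[OF S1 R1 _ u])
    show "\<kappa> ^ i * \<theta> ^ k \<in> M" using theta_M[of "int k"] unfolding g .
    show "sg s (b (\<kappa> ^ i * \<theta> ^ j) (\<kappa> ^ i * \<theta> ^ k)) = R (\<kappa> ^ i * \<theta> ^ j) (\<kappa> ^ i * \<theta> ^ k)" for j
      using on_gen[of "int j" "int k"] unfolding g R_def .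
  qed
  then have "sg s (b u v) = R u v"
    by (rule Z_linear_on_eqI[OF S2[OF u] R2 _ v])
  then show ?thesis by (simp add: R_def)
qed

lemma expansion_1: "u \<in> M \<Longrightarrow> v \<in> M \<Longrightarrow> b u v = (\<Sum>x\<in>I. T x (1 - x) * sg x u * sg (1 - x) v)"
  using expansion[of u v 1] by (simp add: sg_id)

lemma T_conj: "\<not> int p dvd k \<Longrightarrow> sg k (T x y) = T (k * x) (k * y)"
  by (simp add: T_def divide_inverse sg_mult sg_inverse sg_sum sg_theta_powi sg_sg sg_Z of_nat_closed
      algebra_simps)

section \<open>Lie algebra identities for the structure constants\<close>

lemma T_anti: "T y x = - T x y"
proof (cases "int p dvd x \<or> int p dvd y")
  case True
  then show ?thesis by (auto simp: T_zero)
next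
  case False
  define s where "s = x + y"
  \<comment> \<open>The coefficient of \<open>sg a u * sg (s - a) v\<close> in the conjugate of
    \<open>b u v + b v u\<close>, which is zero.\<close>
  define c where "c a = T a (s - a) + T (s - a) a" for a
  have per: "T (a mod int p) (s - a mod int p) = T a (s - a)" for a
    by (intro T_cong cong_diff) auto
  have "(\<Sum>a\<in>I. c a * sg a u * sg (s - a) v) = 0" if uv: "u \<in> M" "v \<in> M" for u v
  proof -
    have "(\<Sum>a\<in>I. T (s - a) a * sg a u * sg (s - a) v)
        = (\<Sum>a\<in>I. (\<lambda>a. T a (s - a) * sg a v * sg (s - a) u) (s - a))"
      by (simp add: mult_ac)
    also have "\<dots> = (\<Sum>a\<in>I. T a (s - a) * sg a v * sg (s - a) u)"
    proof (rule sum_residues_flip)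
      fix a
      have "sg (s - a mod int p) = sg (s - a)" by (intro sg_cong cong_diff) auto
      then show "T (a mod int p) (s - a mod int p) * sg (a mod int p) v * sg (s - a mod int p) u
        = T a (s - a) * sg a v * sg (s - a) u" by (simp add: per sg_mod)
    qed
    also have "\<dots> = sg s (b v u)" by (rule expansion[OF uv(2,1), symmetric])
    finally have "(\<Sum>a\<in>I. c a * sg a u * sg (s - a) v) = sg s (b u v) + sg s (b v u)"
      by (simp add: c_def ring_distribs sum.distrib expansion[OF uv])
    then show ?thesis using b_anti[OF uv] by (simp add: sg_uminus)
  qed
  then have "c (x mod int p) = 0"
  proof (rule bi_independent)
    show "x mod int p \<in> I" using p_ge_5 by simp
    show "\<not> int p dvd x mod int p" using False by (simp add: dvd_mod_iff)
    have "[s - x mod int p = y] (mod int p)" unfolding s_def by (simp add: cong_def mod_diff_right_eq)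
    then show "\<not> int p dvd s - x mod int p" using False cong_dvd_iff by blast
  qed
  moreover have "c (x mod int p) = T x y + T y x"
  proof -
    have "T (x mod int p) (s - x mod int p) = T x y" "T (s - x mod int p) (x mod int p) = T y x"
      by (intro T_cong; simp add: s_def cong_def mod_diff_right_eq)+
    then show ?thesis by (simp add: c_def)
  qed
  ultimately show ?thesis by (simp add: eq_neg_iff_add_eq_0 add.commute)
qed

lemma T_diag: "T x x = 0"
proof -
  \<comment> \<open>In characteristic 2 the odd number p would equal 1 and thus be a unit of
    \<open>Z\<close>.\<close>
  have "(2 :: 'k) \<noteq> 0"
  proof
    assume 2: "(2 :: 'k) = 0"
    have "odd p" using prime_p p_ge_5 by (intro prime_odd_nat) auto
    then obtain k where "p = 2 * k + 1" by (rule oddE)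
    then have "(of_nat p :: 'k) = 1" using 2 by simp
    then show False using p_nonunit one_closed by simp
  qed
  moreover have "2 * T x x = 0" using T_anti[of x x] by (metis add.right_inverse mult_2)
  ultimately show ?thesis by simp
qed

definition J :: "'k \<Rightarrow> 'k \<Rightarrow> 'k \<Rightarrow> 'k" where
  "J u v w = b (b u v) w + b (b v w) u + b (b w u) v"

lemma expansion_double:
  assumes "u \<in> M" "v \<in> M" "w \<in> M"
  shows "sg s (b (b u v) w)
    = (\<Sum>y\<in>I. \<Sum>z\<in>I. T y z * T (y + z) (s - y - z) * sg y u * sg z v * sg (s - y - z) w)"
proof -
  define F where "F y x = T y (x - y) * T x (s - x) * sg y u * sg (x - y) v * sg (s - x) w" for x y
  have "sg s (b (b u v) w) = (\<Sum>x\<in>I. T x (s - x) * sg x (b u v) * sg (s - x) w)"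
    by (intro expansion b_in_M assms)
  also have "\<dots> = (\<Sum>x\<in>I. \<Sum>y\<in>I. F y x)"
    by (simp add: expansion[OF assms(1,2)] F_def sum_distrib_left sum_distrib_right mult_ac)
  also have "\<dots> = (\<Sum>y\<in>I. \<Sum>x\<in>I. F y x)" by (rule sum.swap)
  \<comment> \<open>The inner index becomes z = x - y. The summand is periodic in x, so the range of
    residues may be shifted.\<close>
  also have "\<dots> = (\<Sum>y\<in>I. \<Sum>z\<in>I. F y (z + y))"
  proof (rule sum.cong[OF refl])
    fix y
    have "F y (x mod int p) = F y x" for x
    proof -
      have "sg (x mod int p - y) = sg (x - y)" "sg (s - x mod int p) = sg (s - x)"
        "T y (x mod int p - y) = T y (x - y)" "T (x mod int p) (s - x mod int p) = T x (s - x)"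
        by (intro sg_cong T_cong cong_diff cong_refl; simp)+
      then show ?thesis by (simp add: F_def)
    qed
    then show "(\<Sum>x\<in>I. F y x) = (\<Sum>z\<in>I. F y (z + y))" by (rule sum_residues_shift[symmetric])
  qed
  finally show ?thesis by (simp add: F_def algebra_simps)
qed

text \<open>For s = x + y + z the left-hand side is the coefficient of
  \<open>sg x u * sg y v * sg z w\<close> in \<open>sg s (J u v w)\<close>, and
  \<open>tri_independent\<close> makes it vanish.\<close>

lemma jacobi_T:
  assumes J0: "\<And>u v w. u \<in> M \<Longrightarrow> v \<in> M \<Longrightarrow> w \<in> M \<Longrightarrow> J u v w = 0"
  shows "T x y * T (x + y) z + T y z * T (y + z) x + T z x * T (z + x) y = 0"
proof (cases "int p dvd x \<or> int p dvd y \<or> int p dvd z")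
  case True
  then show ?thesis by (auto simp: T_zero)
next
  case False
  define s where "s = x + y + z"
  define E where "E a b c = T a b * T (a + b) c" for a b c
  have E_cong: "E a b c = E a' b' c'"
    if "[a = a'] (mod int p)" "[b = b'] (mod int p)" "[c = c'] (mod int p)" for a b c a' b' c'
    using that unfolding E_def by (intro arg_cong2[of _ _ _ _ "(*)"] T_cong cong_add)
  define C where "C a b = E a b (s - a - b) + E b (s - a - b) a + E (s - a - b) a b" for a b
  have "(\<Sum>a\<in>I. \<Sum>b\<in>I. C a b * sg a u * sg b v * sg (s - a - b) w) = 0"
    if uvw: "u \<in> M" "v \<in> M" "w \<in> M" for u v w
  proof -
    have 1: "sg s (b (b u v) w) = (\<Sum>x\<in>I. \<Sum>y\<in>I. E x y (s - x - y) * sg x u * sg y v * sg (s - x - y) w)"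
      using expansion_double[OF uvw] by (simp add: E_def)
    \<comment> \<open>The residue attached to h becomes the summation index. In all three cyclic
      terms the sums shall run over the residues attached to u and v.\<close>
    have flip: "(\<Sum>z\<in>I. E y z (s - y - z) * sg y f * sg z g * sg (s - y - z) h)
       = (\<Sum>a\<in>I. E y (s - a - y) a * sg y f * sg (s - a - y) g * sg a h)" for y f g h
    proof -
      define F where "F z = E y z (s - y - z) * sg y f * sg z g * sg (s - y - z) h" for z
      have "F (z mod int p) = F z" for z
      proof -
        have "sg (s - y - z mod int p) = sg (s - y - z)"
          "E y (z mod int p) (s - y - z mod int p) = E y z (s - y - z)"
          by (intro sg_cong E_cong cong_diff cong_refl; simp)+
        then show ?thesis by (simp add: F_def sg_mod)
      qed
      then have "(\<Sum>z\<in>I. F z) = (\<Sum>a\<in>I. F (s - y - a))" by (rule sum_residues_flip[symmetric])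
      then show ?thesis by (simp add: F_def algebra_simps)
    qed
    have 2: "sg s (b (b v w) u) = (\<Sum>x\<in>I. \<Sum>y\<in>I. E y (s - x - y) x * sg x u * sg y v * sg (s - x - y) w)"
    proof -
      have "sg s (b (b v w) u) = (\<Sum>y\<in>I. \<Sum>z\<in>I. E y z (s - y - z) * sg y v * sg z w * sg (s - y - z) u)"
        using expansion_double[OF uvw(2,3,1)] by (simp add: E_def)
      also have "\<dots> = (\<Sum>y\<in>I. \<Sum>a\<in>I. E y (s - a - y) a * sg y v * sg (s - a - y) w * sg a u)"
        by (simp only: flip)
      also have "\<dots> = (\<Sum>a\<in>I. \<Sum>y\<in>I. E y (s - a - y) a * sg y v * sg (s - a - y) w * sg a u)"
        by (rule sum.swap)
      finally show ?thesis by (simp add: mult_ac)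
    qed
    have 3: "sg s (b (b w u) v) = (\<Sum>x\<in>I. \<Sum>y\<in>I. E (s - x - y) x y * sg x u * sg y v * sg (s - x - y) w)"
    proof -
      have flip': "(\<Sum>y\<in>I. E y z (s - y - z) * sg y w * sg z u * sg (s - y - z) v)
        = (\<Sum>a\<in>I. E (s - z - a) z a * sg (s - z - a) w * sg z u * sg a v)" for z
      proof -
        define F where "F y = E y z (s - y - z) * sg y w * sg z u * sg (s - y - z) v" for y
        have "F (y mod int p) = F y" for y
        proof -
          have "sg (s - y mod int p - z) = sg (s - y - z)"
            "E (y mod int p) z (s - y mod int p - z) = E y z (s - y - z)"
            by (intro sg_cong E_cong cong_diff cong_refl; simp)+
          then show ?thesis by (simp add: F_def sg_mod)
        qed
        then have "(\<Sum>y\<in>I. F y) = (\<Sum>a\<in>I. F (s - z - a))" by (rule sum_residues_flip[symmetric])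
        then show ?thesis by (simp add: F_def algebra_simps)
      qed
      have "sg s (b (b w u) v) = (\<Sum>y\<in>I. \<Sum>z\<in>I. E y z (s - y - z) * sg y w * sg z u * sg (s - y - z) v)"
        using expansion_double[OF uvw(3,1,2)] by (simp add: E_def)
      also have "\<dots> = (\<Sum>z\<in>I. \<Sum>y\<in>I. E y z (s - y - z) * sg y w * sg z u * sg (s - y - z) v)"
        by (rule sum.swap)
      finally show ?thesis by (simp only: flip') (simp add: mult_ac)
    qed
    have "(\<Sum>a\<in>I. \<Sum>b\<in>I. C a b * sg a u * sg b v * sg (s - a - b) w) = sg s (J u v w)"
      by (simp add: J_def sg_add 1 2 3 C_def ring_distribs sum.distrib)
    then show ?thesis using J0[OF uvw] by (simp add: sg_0)
  qed
  then have "C (x mod int p) (y mod int p) = 0"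
  proof (rule tri_independent)
    show "x mod int p \<in> I" "y mod int p \<in> I" using p_ge_5 by simp_all
    show "\<not> int p dvd x mod int p" "\<not> int p dvd y mod int p" using False by (simp_all add: dvd_mod_iff)
    have "[s - x mod int p - y mod int p = s - x - y] (mod int p)"
      by (intro cong_diff cong_refl) auto
    then show "\<not> int p dvd s - x mod int p - y mod int p"
      using False cong_dvd_iff by (auto simp: s_def)
  qed
  moreover have "C (x mod int p) (y mod int p) = C x y"
    unfolding C_def by (intro arg_cong2[of _ _ _ _ "(+)"] E_cong cong_diff cong_refl) auto
  ultimately have "C x y = 0" by simp
  then show ?thesis by (simp add: C_def E_def s_def)
qed

lemma J_nonzero:
  assumes "\<exists>u\<in>M. \<exists>v\<in>M. b u v \<noteq> 0"
  shows "\<exists>u\<in>M. \<exists>v\<in>M. \<exists>w\<in>M. J u v w \<noteq> 0"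
proof (rule ccontr)
  assume neg: "\<not> ?thesis"
  have J0: "J u v w = 0" if uvw: "u \<in> M" "v \<in> M" "w \<in> M" for u v w
  proof (rule ccontr)
    assume "J u v w \<noteq> 0"
    then have "\<exists>u\<in>M. \<exists>v\<in>M. \<exists>w\<in>M. J u v w \<noteq> 0" using uvw by blast
    then show False using neg by contradiction
  qed
  have "\<exists>c\<in>{1..<int p}. \<forall>a\<in>{1..<int p}. T a c = 0"
  proof (rule graded_engel)
    show "prime p" by (rule prime_p)
    show "T (x mod int p) y = T x y" for x y by (rule T_mod_left)
    show "T x (y mod int p) = T x y" for x y by (rule T_mod_right)
    show "T x y = 0" if "int p dvd x + y" for x y using that by (simp add: T_zero)
    show "T x x = 0" for x by (rule T_diag)
    show "T y x = - T x y" for x y by (rule T_anti)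
    show "T x y * T (x + y) z + T y z * T (y + z) x + T z x * T (z + x) y = 0" for x y z
      by (rule jacobi_T) (rule J0)
  qed
  then obtain c where c: "c \<in> {1..<int p}" "\<And>a. a \<in> {1..<int p} \<Longrightarrow> T a c = 0" by blast
  have p0: "int p > 0" using p_ge_5 by simp
  have inverse: "\<exists>d. [x * d = 1] (mod int p)" if "\<not> int p dvd x" for x
    using that prime_p prime_imp_coprime[of "int p" x] cong_solve_coprime_int[of x "int p"]
    by (auto simp: coprime_commute)
  have T0: "T x y = 0" for x y
  proof (cases "int p dvd x \<or> int p dvd y")
    case True
    then show ?thesis by (auto simp: T_zero)
  next
    case False
    have "\<not> int p dvd c" using c(1) by (auto dest: zdvd_imp_le)
    then obtain d where d: "[c * d = 1] (mod int p)" using inverse by blast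
    \<comment> \<open>Multiplication by k sends the central index c to y; the index a below is the
      one sent to x. Thus \<open>T x y\<close> is a conjugate of \<open>T a c\<close>.\<close>
    define k where "k = y * d"
    have kc: "[k * c = y] (mod int p)"
    proof -
      have "k * c = y * (c * d)" by (simp add: k_def)
      also have "[\<dots> = y * 1] (mod int p)" by (intro cong_mult cong_refl d)
      finally show ?thesis by simp
    qed
    have k: "\<not> int p dvd k"
    proof
      assume "int p dvd k"
      then have "int p dvd k * c" by simp
      then show False using kc False cong_dvd_iff by blast
    qed
    obtain e where e: "[k * e = 1] (mod int p)" using inverse[OF k] by blast
    define a where "a = (x * e) mod int p"
    have ka: "[k * a = x] (mod int p)"
    proof -
      have "[k * a = k * (x * e)] (mod int p)" unfolding a_def by (intro cong_mult cong_refl) simp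
      also have "k * (x * e) = x * (k * e)" by simp
      also have "[\<dots> = x * 1] (mod int p)" by (intro cong_mult cong_refl e)
      finally show ?thesis by simp
    qed
    have "a \<noteq> 0" using ka False by (auto simp: cong_def)
    moreover have "a \<in> I" using p0 by (simp add: a_def)
    ultimately have "T a c = 0" by (intro c(2)) auto
    then have "T (k * a) (k * c) = 0" using T_conj[OF k, of a c] by (simp add: sg_0)
    then show ?thesis using T_cong[OF ka kc] by simp
  qed
  then show False using assms expansion_1 by auto
qed

end

section \<open>Valuations of the structure constants and of the Jacobi expressions\<close>

context cyclotomic_dvr begin

lemma inverse_kappa_power_in_pw: "inverse (\<kappa> ^ n) \<in> pw (- int n)"
  using kappa_powi_in_pw[of "- int n"] by (simp add: power_int_minus)

text \<open>Distinct p-th roots of unity differ by \<kappa> times a unit.\<close>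

lemma inverse_theta_diff:
  assumes "\<not> int p dvd int a - int c"
  shows "inverse (\<theta> ^ a - \<theta> ^ c) \<in> pw (- 1)" "\<theta> ^ a - \<theta> ^ c \<noteq> 0"
proof -
  define k where "k = nat ((int a - int c) mod int p)"
  have "\<not> p dvd k"
    using assms by (simp add: k_def theta_power_eq_1[symmetric] theta_powi_eq_1 flip: theta_powi_eq_power)
  have "\<theta> ^ a - \<theta> ^ c = \<theta> ^ c * (\<theta> powi (int a - int c) - 1)"
    by (simp add: power_int_diff theta_nonzero field_simps)
  also have "\<dots> = \<kappa> ^ 1 * (\<theta> ^ c * geo k)"
    by (simp add: theta_powi_eq_power theta_power_minus_1 flip: k_def)
  finally have e: "\<theta> ^ a - \<theta> ^ c = \<kappa> ^ 1 * (\<theta> ^ c * geo k)" .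
  then show "\<theta> ^ a - \<theta> ^ c \<noteq> 0"
    using kappa_nonzero theta_nonzero geo_nonzero[OF \<open>\<not> p dvd k\<close>] by simp
  have "inverse (\<theta> ^ c) = \<theta> powi (- int c)" by (simp add: power_int_minus)
  then have "inverse (\<theta> ^ a - \<theta> ^ c) = (\<theta> powi (- int c) * inverse (geo k)) * inverse (\<kappa> ^ 1)"
    unfolding e by simp
  also have "\<dots> \<in> pw (- 1)"
    using inverse_kappa_power_in_pw[of 1]
    by (intro pw_A_mult A.mult_closed theta_powi_in_A inverse_geo_in_A \<open>\<not> p dvd k\<close>) simp
  finally show "inverse (\<theta> ^ a - \<theta> ^ c) \<in> pw (- 1)" .
qed

text \<open>An element of \<open>A\<close> is \<open>a + c * \<kappa>\<close> modulo \<open>\<kappa> ^ 2\<close> with \<open>a\<close>, \<open>c\<close> fixed by conjugation. Hence the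
  rows of the following determinant agree modulo \<open>\<kappa>\<close>, and the differences of the rows are proportional
  modulo \<open>\<kappa> ^ 2\<close>, so that the determinant is divisible by \<open>\<kappa> ^ 3\<close>.\<close>

definition det3 :: "'k \<Rightarrow> 'k \<Rightarrow> 'k \<Rightarrow> 'k" where
  "det3 u v w = sg 1 u * (sg 2 v * sg 3 w - sg 3 v * sg 2 w) - sg 1 v * (sg 2 u * sg 3 w - sg 3 u * sg 2 w)
     + sg 1 w * (sg 2 u * sg 3 v - sg 3 u * sg 2 v)"

lemma not_dvd_small: "\<not> int p dvd 1" "\<not> int p dvd 2" "\<not> int p dvd 3"
  using p_ge_5 by (auto dest: zdvd_imp_le)

lemma sg_expand:
  assumes "x \<in> A"
  obtains a c r where "a \<in> Z" "c \<in> Z" "r \<in> A" "x = a + \<kappa> * c + \<kappa> ^ 2 * r"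
proof -
  obtain a y where a: "y \<in> A" "x = of_nat a + \<kappa> * y" using A_residue[OF assms] by blast
  obtain c r where c: "r \<in> A" "y = of_nat c + \<kappa> * r" using A_residue[OF a(1)] by blast
  have "x = of_nat a + \<kappa> * of_nat c + \<kappa> ^ 2 * r"
    using a c by (simp add: algebra_simps power2_eq_square)
  then show thesis using that of_nat_closed c by blast
qed

lemma det3_in_pw_A:
  assumes "u \<in> A" "v \<in> A" "w \<in> A"
  shows "det3 u v w \<in> pw 3"
proof -
  define P where "P x = sg 2 x - sg 1 x" for x
  define Q where "Q x = sg 3 x - sg 1 x" for x
  obtain e1 where e1: "e1 \<in> A" "sg 1 \<kappa> = \<kappa> * e1" using sg_kappa[OF not_dvd_small(1)] by metis
  obtain e2 where e2: "e2 \<in> A" "sg 2 \<kappa> = \<kappa> * e2" using sg_kappa[OF not_dvd_small(2)] by metis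
  obtain e3 where e3: "e3 \<in> A" "sg 3 \<kappa> = \<kappa> * e3" using sg_kappa[OF not_dvd_small(3)] by metis
  \<comment> \<open>The first-order coefficient c comes from \<open>Z\<close> and is fixed by
    conjugation, so the same c occurs in both differences.\<close>
  have PQ: "\<exists>c\<in>A. \<exists>r\<in>A. \<exists>s\<in>A. P x = \<kappa> * (c * (e2 - e1) + \<kappa> * r) \<and> Q x = \<kappa> * (c * (e3 - e1) + \<kappa> * s)"
    if x: "x \<in> A" for x
  proof -
    obtain a c r where acr: "a \<in> Z" "c \<in> Z" "r \<in> A" "x = a + \<kappa> * c + \<kappa> ^ 2 * r"
      by (rule sg_expand[OF x])
    have s: "sg n x = a + \<kappa> * e * c + \<kappa> ^ 2 * (e ^ 2 * sg n r)"
      if "\<not> int p dvd n" "sg n \<kappa> = \<kappa> * e" for n e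
      using that acr by (simp add: sg_add sg_mult sg_power sg_Z power_mult_distrib)
    note s = s[OF not_dvd_small(1) e1(2)] s[OF not_dvd_small(2) e2(2)] s[OF not_dvd_small(3) e3(2)]
    show ?thesis
    proof (intro bexI conjI)
      show "P x = \<kappa> * (c * (e2 - e1) + \<kappa> * (e2 ^ 2 * sg 2 r - e1 ^ 2 * sg 1 r))"
        by (simp add: P_def s algebra_simps power2_eq_square)
      show "Q x = \<kappa> * (c * (e3 - e1) + \<kappa> * (e3 ^ 2 * sg 3 r - e1 ^ 2 * sg 1 r))"
        by (simp add: Q_def s algebra_simps power2_eq_square)
      show "c \<in> A" using acr Z_subset_A by blast
    qed (intro A.diff_closed A.mult_closed A.power_closed sg_in_A acr e1 e2 e3)+
  qed
  \<comment> \<open>To first order the vectors (P x, Q x) and (P y, Q y) are multiples of \<kappa>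
    (e2 - e1, e3 - e1), so the term with \<kappa>^2 cancels.\<close>
  have minor: "P x * Q y - Q x * P y \<in> pw 3" if x: "x \<in> A" and y: "y \<in> A" for x y
  proof -
    obtain c r s where c: "c \<in> A" "r \<in> A" "s \<in> A" "P x = \<kappa> * (c * (e2 - e1) + \<kappa> * r)"
      "Q x = \<kappa> * (c * (e3 - e1) + \<kappa> * s)" using PQ[OF x] by metis
    obtain c' r' s' where c': "c' \<in> A" "r' \<in> A" "s' \<in> A" "P y = \<kappa> * (c' * (e2 - e1) + \<kappa> * r')"
      "Q y = \<kappa> * (c' * (e3 - e1) + \<kappa> * s')" using PQ[OF y] by metis
    have "P x * Q y - Q x * P y = (c * (e2 - e1) * s' + r * c' * (e3 - e1) + \<kappa> * r * s'
        - c * (e3 - e1) * r' - s * c' * (e2 - e1) - \<kappa> * s * r') * \<kappa> ^ 3"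
      unfolding c c' by (simp add: algebra_simps power3_eq_cube)
    also have "\<dots> \<in> pw (int 3)"
      by (intro pw_A_mult kappa_power_in_pw A.diff_closed A.add_closed A.mult_closed kappa_in_A c(1-3) c'(1-3) e1 e2 e3)
    finally show ?thesis by simp
  qed
  have "det3 u v w = sg 1 u * (P v * Q w - Q v * P w) - sg 1 v * (P u * Q w - Q u * P w)
      + sg 1 w * (P u * Q v - Q u * P v)"
    by (simp add: det3_def P_def Q_def algebra_simps)
  also have "\<dots> \<in> pw 3"
    by (intro pw_add pw_diff pw_A_mult minor sg_in_A assms)
  finally show ?thesis .
qed

lemma det3_in_pw:
  assumes "u \<in> pw (int i)" "v \<in> pw (int i)" "w \<in> pw (int i)"
  shows "det3 u v w \<in> pw (3 * int i + 3)"
proof -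
  obtain u' v' w' where u': "u' \<in> A" "u = \<kappa> ^ i * u'" "v' \<in> A" "v = \<kappa> ^ i * v'" "w' \<in> A" "w = \<kappa> ^ i * w'"
    using assms by (auto simp: pw_def)
  have "det3 u v w = (sg 1 (\<kappa> ^ i) * sg 2 (\<kappa> ^ i) * sg 3 (\<kappa> ^ i)) * det3 u' v' w'"
    unfolding u' det3_def sg_mult by (simp add: algebra_simps)
  moreover have "(sg 1 (\<kappa> ^ i) * sg 2 (\<kappa> ^ i) * sg 3 (\<kappa> ^ i)) * det3 u' v' w' \<in> pw (int i + int i + int i + 3)"
    by (intro pw_mult sg_pw kappa_power_in_pw det3_in_pw_A u')
  ultimately show ?thesis by simp
qed

end

context theta_form begin

lemma inverse_sg_kappa_in_pw: "inverse (sg x (\<kappa> ^ i)) \<in> pw (- int i)"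
  using sg_pw[OF inverse_kappa_power_in_pw[of i]] by (simp add: sg_inverse)

lemma gen_in_pw: "gen j \<in> pw (2 * int i + 1)"
  unfolding gen_def by (intro b_in_pw theta_M kappa_M)

text \<open>The contributions are 2i + 1 from \<open>gen\<close>, 1 - p from the division by p, and
  -2i from the conjugates of \<kappa>^i in the denominator.\<close>

lemma T_in_pw: "T x y \<in> pw (2 - int p)"
proof -
  have "(\<Sum>j\<in>I. \<theta> powi (- (j * x)) * sg (x + y) (gen j)) \<in> pw (2 * int i + 1)"
    by (intro pw_sum pw_A_mult theta_powi_in_A sg_pw gen_in_pw)
  then have "(\<Sum>j\<in>I. \<theta> powi (- (j * x)) * sg (x + y) (gen j)) *
      (inverse (of_nat p) * (inverse (sg x (\<kappa> ^ i)) * inverse (sg y (\<kappa> ^ i))))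
    \<in> pw ((2 * int i + 1) + ((1 - int p) + (- int i + - int i)))"
    by (intro pw_mult inverse_p_in_pw inverse_sg_kappa_in_pw)
  then show ?thesis by (simp add: T_def divide_inverse mult.assoc)
qed

lemma b_in_pw_if_T_in_pw:
  assumes "\<And>x. x \<in> I \<Longrightarrow> T x (1 - x) \<in> pw t"
    and "u \<in> M" "v \<in> M" "u \<in> pw m" "v \<in> pw n"
  shows "b u v \<in> pw (t + m + n)"
  unfolding expansion_1[OF assms(2,3)]
  by (intro pw_sum pw_mult assms(1) sg_pw assms(4,5))

text \<open>Only the outer form is expanded, which contributes t + i. The inner value has valuation
  at least 2i + 1 by \<open>b_in_pw\<close>.\<close>

lemma J_in_pw_if_T_in_pw:
  assumes T: "\<And>x. x \<in> I \<Longrightarrow> T x (1 - x) \<in> pw t"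
    and "u \<in> M" "v \<in> M" "w \<in> M"
  shows "J u v w \<in> pw (3 * int i + 1 + t)"
proof -
  have "b (b u v) w \<in> pw (3 * int i + 1 + t)" if "u \<in> M" "v \<in> M" "w \<in> M" for u v w
  proof -
    have "b (b u v) w \<in> pw (t + (2 * int i + 1) + int i)"
      using that by (intro b_in_pw_if_T_in_pw T b_in_M b_in_pw)
    then show ?thesis by (simp add: algebra_simps)
  qed
  then show ?thesis unfolding J_def using assms by (intro pw_add) auto
qed

text \<open>The bound in \<open>J_in_pw\<close> may be negative or below i. This one places the
  Jacobi expressions in the maximal order and yields i \<le> \<lambda> for the index
  computation.\<close>

lemma J_in_pw_weak: "u \<in> M \<Longrightarrow> v \<in> M \<Longrightarrow> w \<in> M \<Longrightarrow> J u v w \<in> pw (2 * int i + 1)"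
  unfolding J_def by (intro pw_add b_in_pw b_in_M)

section \<open>Structure constants for the primes 5 and 7\<close>

definition tt :: "int \<Rightarrow> 'k" where
  "tt x = T x (1 - x) * sg x (\<kappa> ^ i) * sg (1 - x) (\<kappa> ^ i)"

text \<open>A linear system for the Fourier coefficients \<open>tt\<close> with powers of \<theta>
  as coefficients. For small p, solving it directly loses fewer powers of \<kappa> than the division
  by p in \<open>T\<close>.\<close>

lemma gen_tt: "gen (int j) = (\<Sum>x\<in>I. tt x * (\<theta> ^ j) ^ nat x)"
proof -
  have "gen (int j) = (\<Sum>x\<in>I. T x (1 - x) * sg x (\<theta> powi int j * \<kappa> ^ i) * sg (1 - x) (\<kappa> ^ i))"
    unfolding gen_def by (intro expansion_1 theta_M kappa_M)
  also have "\<dots> = (\<Sum>x\<in>I. tt x * (\<theta> ^ j) ^ nat x)"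
  proof (rule sum.cong[OF refl])
    fix x assume x: "x \<in> I"
    show "T x (1 - x) * sg x (\<theta> powi int j * \<kappa> ^ i) * sg (1 - x) (\<kappa> ^ i) = tt x * (\<theta> ^ j) ^ nat x"
    proof (cases "int p dvd x")
      case True
      then show ?thesis by (simp add: T_zero tt_def)
    next
      case False
      have e: "x * int j = int (j * nat x)" using x by simp
      have "\<theta> powi (x * int j) = (\<theta> ^ j) ^ nat x"
        unfolding e by (simp only: power_int_of_nat power_mult)
      then show ?thesis using False by (simp add: tt_def sg_mult sg_theta_powi mult_ac del: power_int_of_nat)
    qed
  qed
  finally show ?thesis .
qed

lemma tt_cong: "[x = y] (mod int p) \<Longrightarrow> tt x = tt y"
  using sg_cong[of x y] sg_cong[of "1 - x" "1 - y"] T_cong[of x y "1 - x" "1 - y"]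
  by (simp add: tt_def cong_diff)

lemma tt_zero: "int p dvd x \<or> int p dvd 1 - x \<Longrightarrow> tt x = 0"
  by (auto simp: tt_def T_zero)

text \<open>Pairing x with 1 - x leaves (p - 3)/2 unknowns, as \<open>tt\<close> also vanishes at 0,
  at 1 and at the residue fixed by the pairing: two unknowns for p = 7 and one for p = 5.\<close>

lemma tt_flip: "[x + y = 1] (mod int p) \<Longrightarrow> tt y = - tt x"
proof -
  assume "[x + y = 1] (mod int p)"
  then have "[1 - x = y] (mod int p)" by (simp add: cong_iff_dvd_diff algebra_simps dvd_diff_commute)
  then have "tt y = tt (1 - x)" by (rule tt_cong[symmetric])
  also have "\<dots> = - tt x" using T_anti[of "1 - x" x] by (simp add: tt_def mult_ac)
  finally show ?thesis .
qed

lemma T_in_pw_if_tt_in_pw: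
  assumes "tt x \<in> pw (2 * int i + t)"
  shows "T x (1 - x) \<in> pw t"
proof (cases "int p dvd x \<or> int p dvd 1 - x")
  case True
  then show ?thesis by (auto simp: T_zero pw_zero)
next
  case False
  then have "sg x (\<kappa> ^ i) \<noteq> 0" "sg (1 - x) (\<kappa> ^ i) \<noteq> 0"
    using kappa_nonzero by (simp_all add: sg_nonzero)
  then have "T x (1 - x) = tt x * (inverse (sg x (\<kappa> ^ i)) * inverse (sg (1 - x) (\<kappa> ^ i)))"
    by (simp add: tt_def field_simps)
  also have "\<dots> \<in> pw ((2 * int i + t) + (- int i + - int i))"
    by (intro pw_mult assms inverse_sg_kappa_in_pw)
  finally show ?thesis by simp
qed

lemma J_in_pw_7:
  assumes p: "p = 7" and uvw: "u \<in> M" "v \<in> M" "w \<in> M"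
  shows "J u v w \<in> pw (3 * int i - 1)"
proof -
  have p_dvd: "int p dvd n \<longleftrightarrow> 7 dvd n" for n by (simp add: p)
  have p1: "p \<noteq> Suc 0" by (simp add: p)
  have I7: "I = {0, 1, 2, 3, 4, 5, 6}" unfolding p by auto
  have t0: "tt 0 = 0" "tt 1 = 0" by (auto intro: tt_zero)
  have t4: "tt 4 = 0"
  proof -
    have "T 4 (1 - 4) = T 4 4" by (rule T_cong) (auto simp: p cong_def)
    then show ?thesis using T_diag by (simp add: tt_def)
  qed
  have t5: "tt 5 = - tt 3" by (rule tt_flip) (simp add: p cong_def)
  have t6: "tt 6 = - tt 2" by (rule tt_flip) (simp add: p cong_def)
  have \<theta>7: "\<theta> ^ 7 = 1" using theta_power_p p by simp
  have reduce: "\<theta> ^ 8 = \<theta>" "\<theta> ^ 10 = \<theta> ^ 3" "\<theta> ^ 12 = \<theta> ^ 5"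
    using \<theta>7 by (simp_all add: power_numeral_reduce)
  \<comment> \<open>\<open>X\<close> and \<open>Y\<close> are the quotients of \<open>gen 1\<close>
    and \<open>gen 2\<close> by their coefficients at \<open>tt 3\<close>. These coefficients have
    valuation 1, so the quotients have valuation at least 2i.\<close>
  define X where "X = tt 3 + tt 2 * (\<theta> + \<theta> ^ 6)"
  define Y where "Y = tt 3 + tt 2 * (\<theta> ^ 2 + \<theta> ^ 5)"
  have g1: "gen 1 = tt 2 * (\<theta> ^ 2 - \<theta> ^ 6) + tt 3 * (\<theta> ^ 3 - \<theta> ^ 5)"
    using gen_tt[of 1] by (simp add: I7 t0 t4 t5 t6 algebra_simps)
  have g2: "gen 2 = tt 2 * (\<theta> ^ 4 - \<theta> ^ 5) + tt 3 * (\<theta> ^ 6 - \<theta> ^ 3)"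
    using gen_tt[of 2] by (simp add: I7 t0 t4 t5 t6 reduce algebra_simps flip: power_mult)
  have "(\<theta> ^ 3 - \<theta> ^ 5) * X = gen 1 + (\<theta> ^ 7 - 1) * (\<theta> ^ 2 - \<theta> ^ 4) * tt 2"
    unfolding g1 X_def by (simp add: algebra_simps power_numeral_reduce)
  then have "(\<theta> ^ 3 - \<theta> ^ 5) * X \<in> pw (2 * int i + 1)" by (simp add: \<theta>7 gen_in_pw)
  from pw_cancel[OF this inverse_theta_diff] have X: "X \<in> pw (2 * int i + 1 - 1)"
    by (simp add: p_dvd)
  have "(\<theta> ^ 6 - \<theta> ^ 3) * Y = gen 2 + (\<theta> ^ 7 - 1) * \<theta> ^ 4 * tt 2"
    unfolding g2 Y_def by (simp add: algebra_simps power_numeral_reduce)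
  then have "(\<theta> ^ 6 - \<theta> ^ 3) * Y \<in> pw (2 * int i + 1)" by (simp add: \<theta>7 gen_in_pw)
  from pw_cancel[OF this inverse_theta_diff] have Y: "Y \<in> pw (2 * int i + 1 - 1)"
    by (simp add: p_dvd)
  \<comment> \<open>The difference eliminates \<open>tt 3\<close>. The coefficient of
    \<open>tt 2\<close> splits into two factors of valuation 1, whence the loss of 2.\<close>
  have "(\<theta> ^ 1 - \<theta> ^ 2) * ((\<theta> ^ 0 - \<theta> ^ 4) * tt 2) = X - Y"
    by (simp add: X_def Y_def algebra_simps power_numeral_reduce)
  then have "(\<theta> ^ 1 - \<theta> ^ 2) * ((\<theta> ^ 0 - \<theta> ^ 4) * tt 2) \<in> pw (2 * int i)"
    using pw_diff[OF X Y] by simp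
  from pw_cancel[OF this inverse_theta_diff] have "(\<theta> ^ 0 - \<theta> ^ 4) * tt 2 \<in> pw (2 * int i - 1)"
    by (simp add: p1)
  from pw_cancel[OF this inverse_theta_diff] have "tt 2 \<in> pw (2 * int i - 1 - 1)"
    by (simp add: p_dvd)
  then have t2: "tt 2 \<in> pw (2 * int i + - 2)" by simp
  have "X \<in> pw (2 * int i + - 2)" using X by (rule pw_mono[rotated]) simp
  moreover have "(\<theta> + \<theta> ^ 6) * tt 2 \<in> pw (2 * int i + - 2)"
    by (intro pw_A_mult t2 A.add_closed A.power_closed theta_in_A)
  ultimately have "X - (\<theta> + \<theta> ^ 6) * tt 2 \<in> pw (2 * int i + - 2)" by (rule pw_diff)
  then have t3: "tt 3 \<in> pw (2 * int i + - 2)" by (simp add: X_def mult.commute)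
  have "T x (1 - x) \<in> pw (- 2)" if "x \<in> I" for x
  proof (rule T_in_pw_if_tt_in_pw)
    show "tt x \<in> pw (2 * int i + - 2)"
      using that t2 t3 pw_uminus[OF t2] pw_uminus[OF t3] unfolding I7
      by (auto simp: t0 t4 t5 t6 pw_zero)
  qed
  from J_in_pw_if_T_in_pw[OF this uvw] show ?thesis by simp
qed

lemma J_in_pw_5:
  assumes p: "p = 5" and uvw: "u \<in> M" "v \<in> M" "w \<in> M"
  shows "J u v w \<in> pw (3 * int i + 3)"
proof -
  have p_dvd: "int p dvd n \<longleftrightarrow> 5 dvd n" for n by (simp add: p)
  have I5: "I = {0, 1, 2, 3, 4}" unfolding p by auto
  have t0: "tt 0 = 0" "tt 1 = 0" by (auto intro: tt_zero)
  have T3: "T 3 (- 2) = 0"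
  proof -
    have "T 3 (- 2) = T 3 3" by (rule T_cong) (auto simp: p cong_def)
    then show ?thesis using T_diag by simp
  qed
  have t3: "tt 3 = 0" using T3 by (simp add: tt_def)
  have t4: "tt 4 = - tt 2" by (rule tt_flip) (simp add: p cong_def)
  \<comment> \<open>The coefficient of the only unknown has valuation 1, which the 1 in 2i + 1
    compensates exactly.\<close>
  have "gen 1 = (\<theta> ^ 2 - \<theta> ^ 4) * tt 2"
    using gen_tt[of 1] by (simp add: I5 t0 t3 t4 algebra_simps)
  then have "(\<theta> ^ 2 - \<theta> ^ 4) * tt 2 \<in> pw (2 * int i + 1)" using gen_in_pw[of 1] by simp
  from pw_cancel[OF this inverse_theta_diff] have "tt 2 \<in> pw (2 * int i + 1 - 1)"
    by (simp add: p_dvd)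
  then have "T 2 (1 - 2) \<in> pw 0" by (intro T_in_pw_if_tt_in_pw) simp
  define t where "t = T 2 (- 1)"
  have t: "t \<in> A" using \<open>T 2 (1 - 2) \<in> pw 0\<close> by (simp add: t_def pw_0)
  have T4: "T 4 (- 3) = - t"
  proof -
    have "T 4 (- 3) = T (- 1) 2" by (rule T_cong) (auto simp: p cong_def)
    then show ?thesis using T_anti[of "- 1" 2] by (simp add: t_def)
  qed
  have sgm: "sg (- 1) = sg 4" "sg (- 3) = sg 2" "sg 8 = sg 3" "sg 16 = sg 1" "sg 6 = sg 1"
    by (rule sg_cong, simp add: p cong_def)+
  have bf: "b u v = t * (sg 2 u * sg 4 v - sg 4 u * sg 2 v)" if "u \<in> M" "v \<in> M" for u v
    using expansion_1[OF that] T_zero[of 0 1] T_zero[of 1 0]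
    by (simp add: I5 T3 T4 sgm t_def[symmetric] algebra_simps)
  have b2: "sg 2 (b u v) = sg 2 t * (sg 4 u * sg 3 v - sg 3 u * sg 4 v)" if "u \<in> M" "v \<in> M" for u v
    by (simp add: bf[OF that] sg_mult sg_diff sg_sg sgm)
  have b4: "sg 4 (b u v) = sg 4 t * (sg 3 u * sg 1 v - sg 1 u * sg 3 v)" if "u \<in> M" "v \<in> M" for u v
    by (simp add: bf[OF that] sg_mult sg_diff sg_sg sgm)
  \<comment> \<open>The terms with \<open>sg 2 t\<close> add up to a determinant with two rows of
    \<open>sg 4\<close> conjugates, hence to zero. The terms with \<open>sg 4 t\<close> form
    \<open>det3\<close> up to sign.\<close>
  have "J u v w = - (t * sg 4 t * det3 u v w)"
    unfolding J_def using uvw by (simp add: bf[OF b_in_M] b2 b4 det3_def algebra_simps)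
  also have "\<dots> \<in> pw (3 * int i + 3)"
    by (intro pw_uminus pw_A_mult A.mult_closed t sg_in_A det3_in_pw uvw)
  finally show ?thesis .
qed

lemma J_in_pw:
  assumes uvw: "u \<in> M" "v \<in> M" "w \<in> M"
  shows "J u v w \<in> pw (3 * int i + 13 - 2 * int p)"
proof -
  consider "p = 5" | "p = 7" | "p \<ge> 10"
  proof -
    have "p \<noteq> 6" "p \<noteq> 8" "p \<noteq> 9"
      using prime_p primes_dvd_imp_eq[of 2 p] primes_dvd_imp_eq[of 3 p] by auto
    then show thesis using that p_ge_5 by linarith
  qed
  then show ?thesis
  proof cases
    case 1
    show ?thesis by (rule pw_mono[OF _ J_in_pw_5[OF 1 uvw]]) (simp add: 1)
  next
    case 2
    show ?thesis by (rule pw_mono[OF _ J_in_pw_7[OF 2 uvw]]) (simp add: 2)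
  next
    case 3
    have "J u v w \<in> pw (3 * int i + 1 + (2 - int p))"
      by (rule J_in_pw_if_T_in_pw[OF T_in_pw uvw])
    from pw_mono[OF _ this] show ?thesis using 3 by simp
  qed
qed

end

section \<open>Ideals and quotients of the maximal order\<close>

context cyclotomic_dvr begin

lemma kappa_powi_in_pw_iff: "\<kappa> powi m \<in> pw n \<longleftrightarrow> n \<le> m"
proof
  assume m: "\<kappa> powi m \<in> pw n"
  show "n \<le> m"
  proof (rule ccontr)
    assume "\<not> n \<le> m"
    then have "m < n" by simp
    have "pw m \<subseteq> pw n"
      using pw_A_mult[OF _ m] by (auto simp: pw_def[of m] mult.commute)
    moreover have "pw n \<subseteq> pw m" using pw_mono[of m n] \<open>m < n\<close> by auto
    ultimately show False using pw_neq[OF \<open>m < n\<close>] by simp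
  qed
qed (use kappa_powi_in_pw pw_mono in blast)

text \<open>Expansion in digits: representatives modulo \<kappa>^(d + 1) are a + \<kappa> r with a <
  p and r a representative modulo \<kappa>^d.\<close>

lemma residue_system:
  "\<exists>R\<subseteq>A. finite R \<and> card R = p ^ d \<and> (\<forall>x\<in>A. \<exists>r\<in>R. x - r \<in> pw (int d)) \<and>
     (\<forall>r\<in>R. \<forall>s\<in>R. r - s \<in> pw (int d) \<longrightarrow> r = s)"
proof (induction d)
  case 0
  show ?case
    by (intro exI[of _ "{0}"]) (auto simp: A.zero_closed pw_0)
next
  case (Suc d)
  then obtain R where R: "R \<subseteq> A" "finite R" "card R = p ^ d" "\<And>x. x \<in> A \<Longrightarrow> \<exists>r\<in>R. x - r \<in> pw (int d)"
    "\<And>r s. r \<in> R \<Longrightarrow> s \<in> R \<Longrightarrow> r - s \<in> pw (int d) \<Longrightarrow> r = s" by blast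
  let ?f = "\<lambda>(a::nat, r). of_nat a + \<kappa> * r"
  have eqI: "a = b \<and> r = s"
    if ab: "a < p" "b < p" "r \<in> R" "s \<in> R" and d: "(of_nat a + \<kappa> * r) - (of_nat b + \<kappa> * s) \<in> pw (int (Suc d))"
    for a b r s
  proof -
    \<comment> \<open>The difference of natural numbers is faithful only for b' \<le> a', so the
      fact is applied in both orders.\<close>
    have le: "a' = b'"
      if ab': "a' < p" "b' \<le> a'" "r' \<in> R" "s' \<in> R" "(of_nat a' + \<kappa> * r') - (of_nat b' + \<kappa> * s') \<in> pw 1"
      for a' b' r' s'
    proof -
      obtain y where y: "y \<in> A" "(of_nat a' + \<kappa> * r') - (of_nat b' + \<kappa> * s') = \<kappa> * y"
        using ab'(5) by (auto simp: pw_def)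
      have "of_nat (a' - b') = \<kappa> * (y - r' + s')"
        using y(2) ab'(2) by (simp add: of_nat_diff algebra_simps)
      moreover have "y - r' + s' \<in> A" using R(1) ab' y by (auto intro!: A.add_closed A.diff_closed)
      ultimately have "p dvd a' - b'" by (intro of_nat_dvd_kappa)
      then show "a' = b'" using ab' by (auto dest: dvd_imp_le)
    qed
    have 1: "(of_nat a + \<kappa> * r) - (of_nat b + \<kappa> * s) \<in> pw 1" using pw_mono[OF _ d, of 1] by simp
    have 2: "(of_nat b + \<kappa> * s) - (of_nat a + \<kappa> * r) \<in> pw 1"
      using pw_uminus[OF 1] by simp
    have "a = b" using le[OF ab(1) _ ab(3,4) 1] le[OF ab(2) _ ab(4,3) 2] by (cases "b \<le> a") auto
    then have "\<kappa> * (r - s) \<in> pw (int (Suc d))" using d by (simp add: algebra_simps)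
    then have "r - s \<in> pw (int (Suc d) - 1)"
      by (rule pw_cancel) (use kappa_powi_in_pw[of "- 1"] kappa_nonzero in \<open>auto simp: power_int_minus\<close>)
    then show ?thesis using R(5) ab \<open>a = b\<close> by simp
  qed
  have inj: "inj_on ?f ({..<p} \<times> R)"
  proof (rule inj_onI)
    fix x y assume "x \<in> {..<p} \<times> R" "y \<in> {..<p} \<times> R" "?f x = ?f y"
    then show "x = y" using eqI[of "fst x" "fst y" "snd x" "snd y"] pw_zero by auto
  qed
  show ?case
  proof (intro exI[of _ "?f ` ({..<p} \<times> R)"] conjI ballI impI)
    show "?f ` ({..<p} \<times> R) \<subseteq> A"
      using R(1) by (auto intro!: A.add_closed A.mult_closed A.of_nat_closed kappa_in_A)
    show "finite (?f ` ({..<p} \<times> R))" using R(2) by auto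
    show "card (?f ` ({..<p} \<times> R)) = p ^ Suc d" using inj R(3) by (simp add: card_image card_cartesian_product)
  next
    fix x assume "x \<in> A"
    then obtain a y where a: "a < p" "y \<in> A" "x = of_nat a + \<kappa> * y" using A_residue by blast
    obtain r where r: "r \<in> R" "y - r \<in> pw (int d)" using R(4)[OF a(2)] by blast
    have "x - (of_nat a + \<kappa> * r) = \<kappa> ^ 1 * (y - r)" using a by (simp add: algebra_simps)
    also have "\<dots> \<in> pw (int 1 + int d)" by (intro pw_mult kappa_power_in_pw r)
    finally have "x - ?f (a, r) \<in> pw (int (Suc d))" by simp
    then show "\<exists>r\<in>?f ` ({..<p} \<times> R). x - r \<in> pw (int (Suc d))"
      using a r by (intro bexI[of _ "?f (a, r)"]) auto
  next
    fix x y assume "x \<in> ?f ` ({..<p} \<times> R)" "y \<in> ?f ` ({..<p} \<times> R)" "x - y \<in> pw (int (Suc d))"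
    then show "x = y" using eqI by auto
  qed
qed

text \<open>Multiplication by \<kappa>^i carries representatives of \<open>A\<close> modulo
  \<kappa>^(l - i) to representatives of the cosets.\<close>

lemma card_quotient:
  assumes "i \<le> l"
  shows "finite (pw (int i) // coset_rel (pw (int l)))"
    and "card (pw (int i) // coset_rel (pw (int l))) = p ^ (l - i)"
proof -
  define cl where "cl x = coset_rel (pw (int l)) `` {x}" for x
  have cl: "cl x = cl y \<longleftrightarrow> x - y \<in> pw (int l)" for x y
  proof
    assume "cl x = cl y"
    moreover have "y \<in> cl y" by (simp add: cl_def coset_rel_def pw_zero)
    ultimately have "y \<in> cl x" by simp
    then show "x - y \<in> pw (int l)" by (simp add: cl_def coset_rel_def)
  next
    assume xy: "x - y \<in> pw (int l)"
    have "x - z \<in> pw (int l) \<longleftrightarrow> y - z \<in> pw (int l)" for z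
      using pw_add[OF xy, of "y - z"] pw_diff[of "x - z" _ "x - y"] xy by auto
    then show "cl x = cl y" by (auto simp: cl_def coset_rel_def)
  qed
  have Q: "pw (int i) // coset_rel (pw (int l)) = cl ` pw (int i)"
    by (auto simp: quotient_def cl_def)
  obtain R where R: "R \<subseteq> A" "finite R" "card R = p ^ (l - i)"
    "\<And>x. x \<in> A \<Longrightarrow> \<exists>r\<in>R. x - r \<in> pw (int (l - i))"
    "\<And>r s. r \<in> R \<Longrightarrow> s \<in> R \<Longrightarrow> r - s \<in> pw (int (l - i)) \<Longrightarrow> r = s"
    using residue_system by meson
  have ki: "\<kappa> ^ i * x \<in> pw (int l) \<longleftrightarrow> x \<in> pw (int (l - i))" for x
  proof
    assume "\<kappa> ^ i * x \<in> pw (int l)"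
    then have "x \<in> pw (int l - int i)"
      by (rule pw_cancel) (use kappa_powi_in_pw[of "- int i"] kappa_nonzero in \<open>auto simp: power_int_minus\<close>)
    then show "x \<in> pw (int (l - i))" using assms by (simp add: of_nat_diff)
  next
    assume "x \<in> pw (int (l - i))"
    from pw_mult[OF kappa_power_in_pw[of i] this] show "\<kappa> ^ i * x \<in> pw (int l)" using assms by simp
  qed
  have "cl ` pw (int i) = (\<lambda>r. cl (\<kappa> ^ i * r)) ` R"
  proof
    show "cl ` pw (int i) \<subseteq> (\<lambda>r. cl (\<kappa> ^ i * r)) ` R"
    proof
      fix c assume "c \<in> cl ` pw (int i)"
      then obtain a where a: "a \<in> A" "c = cl (\<kappa> ^ i * a)" by (auto simp: pw_def)
      obtain r where r: "r \<in> R" "a - r \<in> pw (int (l - i))" using R(4)[OF a(1)] by blast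
      then have "cl (\<kappa> ^ i * a) = cl (\<kappa> ^ i * r)" by (simp add: cl ki flip: right_diff_distrib)
      then show "c \<in> (\<lambda>r. cl (\<kappa> ^ i * r)) ` R" using a r by auto
    qed
    show "(\<lambda>r. cl (\<kappa> ^ i * r)) ` R \<subseteq> cl ` pw (int i)"
      using R(1) pw_A_mult[OF _ kappa_power_in_pw[of i]] by (fastforce simp: mult.commute)
  qed
  moreover have "inj_on (\<lambda>r. cl (\<kappa> ^ i * r)) R"
    by (rule inj_onI) (simp add: cl ki R(5) flip: right_diff_distrib)
  ultimately show "finite (pw (int i) // coset_rel (pw (int l)))"
    and "card (pw (int i) // coset_rel (pw (int l))) = p ^ (l - i)"
    using R(2,3) by (auto simp: Q card_image)
qed

text \<open>The hypothesis puts \<open>A\<close> itself into the family of ideals whose intersection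
  is the hull, which keeps the hull inside \<open>A\<close>.\<close>

lemma is_ideal_hull:
  assumes "X \<subseteq> A"
  shows "is_ideal A (is_ideal A hull X)"
proof -
  have "is_ideal A A"
    by (auto simp: is_ideal_def intro: A.zero_closed A.add_closed A.mult_closed)
  then have "is_ideal A hull X \<subseteq> A" using assms by (intro hull_minimal)
  moreover have "0 \<in> is_ideal A hull X"
    unfolding hull_def by (auto simp: is_ideal_def)
  moreover have "x + y \<in> is_ideal A hull X" if "x \<in> is_ideal A hull X" "y \<in> is_ideal A hull X" for x y
    using that unfolding hull_def by (auto simp: is_ideal_def)
  moreover have "r * x \<in> is_ideal A hull X" if "r \<in> A" "x \<in> is_ideal A hull X" for r x
    using that unfolding hull_def by (auto simp: is_ideal_def)
  ultimately show ?thesis unfolding is_ideal_def by blast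
qed

lemma is_ideal_pw: "n \<ge> 0 \<Longrightarrow> is_ideal A (pw n)"
  using pw_mono[of 0 n] unfolding is_ideal_def
  by (auto simp: pw_0 pw_zero intro: pw_add pw_A_mult)

text \<open>Every nonzero element is a unit times a power of \<kappa>, so the ideal is generated by
  the smallest power of \<kappa> that it contains.\<close>

lemma nonzero_ideal:
  assumes "is_ideal A N" "x \<in> N" "x \<noteq> 0"
  shows "\<exists>n. N = pw (int n)"
proof -
  have key: "\<exists>n. x \<in> pw (int n) \<and> \<kappa> ^ n \<in> N" if x: "x \<in> N" "x \<noteq> 0" for x
  proof -
    obtain m :: int and u where u: "u \<in> A" "inverse u \<in> A" "u \<noteq> 0" "x = \<kappa> powi m * u"
      by (rule kappa_powi_unit[OF x(2)])
    have e: "\<kappa> powi m = inverse u * x" using u by simp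
    have kN: "\<kappa> powi m \<in> N"
      unfolding e using assms(1) x(1) u(2) unfolding is_ideal_def by blast
    then have "\<kappa> powi m \<in> pw 0" using assms(1) unfolding is_ideal_def pw_0 by auto
    then have m: "m = int (nat m)" by (simp add: kappa_powi_in_pw_iff)
    then have "\<kappa> powi m = \<kappa> ^ nat m" by (metis power_int_of_nat)
    moreover have "x \<in> pw m" unfolding pw_def using u by auto
    ultimately show ?thesis using kN m by metis
  qed
  define n where "n = (LEAST n. \<kappa> ^ n \<in> N)"
  have "\<exists>n. \<kappa> ^ n \<in> N" using key[OF assms(2,3)] by blast
  then have n: "\<kappa> ^ n \<in> N" unfolding n_def by (rule LeastI_ex)
  have "N \<subseteq> pw (int n)"
  proof
    fix y assume y: "y \<in> N"
    show "y \<in> pw (int n)"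
    proof (cases "y = 0")
      case True
      then show ?thesis by (simp add: pw_zero)
    next
      case False
      then obtain m where m: "y \<in> pw (int m)" "\<kappa> ^ m \<in> N" using key[OF y] by blast
      then have "n \<le> m" unfolding n_def by (intro Least_le)
      then show ?thesis using pw_mono[OF _ m(1)] by simp
    qed
  qed
  moreover have "pw (int n) \<subseteq> N"
  proof
    fix y assume "y \<in> pw (int n)"
    then obtain a where "a \<in> A" "y = a * \<kappa> ^ n" by (auto simp: pw_def mult.commute)
    then show "y \<in> N" using assms(1) n unfolding is_ideal_def by simp
  qed
  ultimately show ?thesis by blast
qed

text \<open>This gives the uniqueness that the definite description in
  \<open>jacobi_exponent\<close> requires.\<close>

lemma ppow_inj:
  assumes "ppow Z \<theta> l = ppow Z \<theta> l'"
  shows "l = l'"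
proof -
  have inf: "pw n \<noteq> {0}" for n
  proof
    assume "pw n = {0}"
    then have "\<kappa> powi n = 0" using kappa_powi_in_pw[of n] by blast
    then show False using kappa_nonzero by simp
  qed
  have fin: "m = n" if "pw (int m) = pw (int n)" for m n
  proof (rule linorder_cases[of m n])
    assume "m < n"
    then show ?thesis using that pw_neq[of "int m" "int n"] by simp
  next
    assume "n < m"
    then show ?thesis using that pw_neq[of "int n" "int m"] by simp
  qed
  show ?thesis
  proof (cases l)
    case l: (enat m)
    show ?thesis
    proof (cases l')
      case (enat n)
      then show ?thesis using assms l fin by (simp del: ppow.simps(1) add: ppow_eq_pw)
    next
      case infinity
      then show ?thesis using assms l inf by (simp del: ppow.simps(1) add: ppow_eq_pw)
    qed
  next
    case l: infinity
    show ?thesis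
    proof (cases l')
      case (enat n)
      then have "pw (int n) = {0}" using assms l by (simp del: ppow.simps(1) add: ppow_eq_pw)
      then show ?thesis using inf by blast
    qed (simp add: l)
  qed
qed

end

context theta_form begin

lemma J_ideal:
  assumes "\<exists>u\<in>M. \<exists>v\<in>M. b u v \<noteq> 0"
  defines "N \<equiv> is_ideal A hull {J u v w |u v w. u \<in> M \<and> v \<in> M \<and> w \<in> M}"
  obtains l where "N = pw (int l)" "3 * int i + 13 - 2 * int p \<le> int l" "2 * i + 1 \<le> l"
proof -
  define X where "X = {J u v w |u v w. u \<in> M \<and> v \<in> M \<and> w \<in> M}"
  have X: "X \<subseteq> pw (3 * int i + 13 - 2 * int p)" "X \<subseteq> pw (2 * int i + 1)"
    using J_in_pw J_in_pw_weak by (auto simp: X_def)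
  have "pw (2 * int i + 1) \<subseteq> A" using pw_mono[of 0 "2 * int i + 1"] by (auto simp: pw_0)
  then have "X \<subseteq> A" using X by blast
  then have N: "is_ideal A N" unfolding N_def X_def[symmetric] by (rule is_ideal_hull)
  obtain u v w where uvw: "u \<in> M" "v \<in> M" "w \<in> M" "J u v w \<noteq> 0"
    using J_nonzero[OF assms(1)] by blast
  have "J u v w \<in> N" unfolding N_def by (rule hull_inc) (use uvw in blast)
  then obtain l where l: "N = pw (int l)" using nonzero_ideal[OF N] uvw(4) by blast
  \<comment> \<open>For negative n, \<open>pw n\<close> is not an ideal of \<open>A\<close>; such a
    bound is trivial because l is a natural number.\<close>
  have le: "n \<le> int l" if n: "X \<subseteq> pw n" "n \<ge> 0" for n
  proof -
    have "N \<subseteq> pw n" unfolding N_def X_def[symmetric] using n by (intro hull_minimal is_ideal_pw)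
    then have "\<kappa> powi int l \<in> pw n" using kappa_powi_in_pw[of "int l"] unfolding l by blast
    then show ?thesis by (simp only: kappa_powi_in_pw_iff)
  qed
  have "2 * int i + 1 \<le> int l" using X(2) by (intro le) auto
  moreover have "3 * int i + 13 - 2 * int p \<le> int l"
    using X(1) le[of "3 * int i + 13 - 2 * int p"] by (cases "0 \<le> 3 * int i + 13 - 2 * int p") auto
  ultimately show thesis using that[OF l] by linarith
qed

end

section \<open>Linear maps on the exterior square as bilinear forms\<close>

lemma lookup_scale: "Poly_Mapping.lookup (scale a f) k = a * Poly_Mapping.lookup f k"
  by (simp add: scale_def Poly_Mapping.map.rep_eq when_def)

lemma scale_single: "scale a (Poly_Mapping.single k c) = Poly_Mapping.single k (a * c)"
  by (rule poly_mapping_eqI) (simp add: lookup_scale lookup_single when_def)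

lemma scale_uminus: "scale (- 1) f = - f"
  by (rule poly_mapping_eqI) (simp add: lookup_scale)

lemma is_submodule_hull: "is_submodule Z (is_submodule Z hull X)"
  unfolding is_submodule_def hull_def by blast

locale submodule_form = subring_set Z for Z :: "'k::field set" +
  fixes M :: "'k set" and \<gamma> :: "('k \<times> 'k \<Rightarrow>\<^sub>0 'k) set \<Rightarrow> 'k"
  assumes M_add: "x \<in> M \<Longrightarrow> y \<in> M \<Longrightarrow> x + y \<in> M"
    and M_scale: "a \<in> Z \<Longrightarrow> x \<in> M \<Longrightarrow> a * x \<in> M"
    and linear: "wedge_linear Z M \<gamma>"
begin

abbreviation "rels \<equiv> is_submodule Z hull wedge_relators Z M"

lemma free_module_add: "f \<in> free_module Z M \<Longrightarrow> g \<in> free_module Z M \<Longrightarrow> f + g \<in> free_module Z M"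
  unfolding free_module_def using Poly_Mapping.keys_add[of f g]
  by (auto simp: lookup_add intro!: add_closed)

text \<open>\<open>is_submodule\<close> asks for sums and multiples, so negation is obtained as
  scaling by -1.\<close>

lemma rels_minus:
  assumes "f \<in> rels"
  shows "- f \<in> rels"
proof -
  have "- 1 \<in> Z" by (rule uminus_closed[OF one_closed])
  then have "scale (- 1) f \<in> rels"
    using assms is_submodule_hull[of Z "wedge_relators Z M"] unfolding is_submodule_def by simp
  then show ?thesis by (simp only: scale_uminus)
qed

lemma rels_add: "f \<in> rels \<Longrightarrow> g \<in> rels \<Longrightarrow> f + g \<in> rels"
  using is_submodule_hull[of Z "wedge_relators Z M"] unfolding is_submodule_def by blast

lemma wedge_class_eqI:
  assumes "f \<in> free_module Z M" "g \<in> free_module Z M" "f - g \<in> rels"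
  shows "wedge_class Z M f = wedge_class Z M g"
proof -
  have "f - h \<in> rels \<longleftrightarrow> g - h \<in> rels" for h
  proof
    assume "f - h \<in> rels"
    from rels_add[OF this rels_minus[OF assms(3)]] show "g - h \<in> rels" by simp
  next
    assume "g - h \<in> rels"
    from rels_add[OF assms(3) this] show "f - h \<in> rels" by simp
  qed
  then show ?thesis
    using assms by (auto simp: wedge_class_def wedge_rel_def)
qed

lemma single_free: "x \<in> M \<Longrightarrow> y \<in> M \<Longrightarrow> a \<in> Z \<Longrightarrow> Poly_Mapping.single (x, y) a \<in> free_module Z M"
  by (auto simp: free_module_def lookup_single when_def zero_closed split: if_splits)

lemma gamma_add: "f \<in> free_module Z M \<Longrightarrow> g \<in> free_module Z M \<Longrightarrow>
    \<gamma> (wedge_class Z M (f + g)) = \<gamma> (wedge_class Z M f) + \<gamma> (wedge_class Z M g)"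
  using linear by (simp add: wedge_linear_def)

lemma gamma_scale: "a \<in> Z \<Longrightarrow> f \<in> free_module Z M \<Longrightarrow>
    \<gamma> (wedge_class Z M (scale a f)) = a * \<gamma> (wedge_class Z M f)"
  using linear by (simp add: wedge_linear_def)

lemma gamma_zero: "\<gamma> (wedge_class Z M 0) = 0"
proof -
  have "0 \<in> free_module Z M" by (auto simp: free_module_def zero_closed)
  from gamma_scale[OF zero_closed this] show ?thesis
    by (metis add_diff_cancel_left' diff_self gamma_add[OF \<open>0 \<in> _\<close> \<open>0 \<in> _\<close>] add_0)
qed

definition form :: "'k \<Rightarrow> 'k \<Rightarrow> 'k" where "form x y = \<gamma> (wedge Z M x y)"

lemma relators_rels: "f \<in> wedge_relators Z M \<Longrightarrow> f \<in> rels"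
  by (rule hull_inc)

lemma form_add_left:
  assumes "x \<in> M" "y \<in> M" "z \<in> M"
  shows "form (x + y) z = form x z + form y z"
proof -
  let ?s = "\<lambda>x y. Poly_Mapping.single (x, y) (1::'k)"
  have "?s (x + y) z - ?s x z - ?s y z \<in> wedge_relators Z M"
    unfolding wedge_relators_def Let_def using assms by blast
  then have "?s (x + y) z - (?s x z + ?s y z) \<in> rels"
    using relators_rels by (simp add: diff_diff_eq)
  then have "wedge_class Z M (?s (x + y) z) = wedge_class Z M (?s x z + ?s y z)"
    using assms by (intro wedge_class_eqI free_module_add single_free M_add one_closed)
  then show ?thesis
    using assms by (simp add: form_def wedge_def gamma_add single_free one_closed)
qed

lemma form_add_right:
  assumes "x \<in> M" "y \<in> M" "z \<in> M"
  shows "form z (x + y) = form z x + form z y"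
proof -
  let ?s = "\<lambda>x y. Poly_Mapping.single (x, y) (1::'k)"
  have "?s z (x + y) - ?s z x - ?s z y \<in> wedge_relators Z M"
    unfolding wedge_relators_def Let_def using assms by blast
  then have "?s z (x + y) - (?s z x + ?s z y) \<in> rels"
    using relators_rels by (simp add: diff_diff_eq)
  then have "wedge_class Z M (?s z (x + y)) = wedge_class Z M (?s z x + ?s z y)"
    using assms by (intro wedge_class_eqI free_module_add single_free M_add one_closed)
  then show ?thesis
    using assms by (simp add: form_def wedge_def gamma_add single_free one_closed)
qed

lemma form_scale_left:
  assumes "a \<in> Z" "x \<in> M" "y \<in> M"
  shows "form (a * x) y = a * form x y"
proof -
  let ?s = "\<lambda>x y. Poly_Mapping.single (x, y) (1::'k)"
  have "?s (a * x) y - scale a (?s x y) \<in> wedge_relators Z M"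
    unfolding wedge_relators_def Let_def using assms by blast
  then have "wedge_class Z M (?s (a * x) y) = wedge_class Z M (scale a (?s x y))"
    using assms by (intro wedge_class_eqI relators_rels)
      (auto simp: scale_single intro: single_free M_scale one_closed)
  then show ?thesis
    using assms by (simp add: form_def wedge_def gamma_scale single_free one_closed)
qed

lemma form_scale_right:
  assumes "a \<in> Z" "x \<in> M" "y \<in> M"
  shows "form x (a * y) = a * form x y"
proof -
  let ?s = "\<lambda>x y. Poly_Mapping.single (x, y) (1::'k)"
  have "?s x (a * y) - scale a (?s x y) \<in> wedge_relators Z M"
    unfolding wedge_relators_def Let_def using assms by blast
  then have "wedge_class Z M (?s x (a * y)) = wedge_class Z M (scale a (?s x y))"
    using assms by (intro wedge_class_eqI relators_rels)
      (auto simp: scale_single intro: single_free M_scale one_closed)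
  then show ?thesis
    using assms by (simp add: form_def wedge_def gamma_scale single_free one_closed)
qed

lemma form_alt:
  assumes "x \<in> M"
  shows "form x x = 0"
proof -
  have "Poly_Mapping.single (x, x) (1::'k) \<in> wedge_relators Z M"
    unfolding wedge_relators_def Let_def using assms by blast
  then have "wedge_class Z M (Poly_Mapping.single (x, x) 1) = wedge_class Z M 0"
    using assms
    by (intro wedge_class_eqI single_free one_closed) (auto intro: relators_rels simp: free_module_def zero_closed)
  then show ?thesis by (simp add: form_def wedge_def gamma_zero)
qed

lemma wedge_in_exterior_square: "x \<in> M \<Longrightarrow> y \<in> M \<Longrightarrow> wedge Z M x y \<in> exterior_square Z M"
  unfolding wedge_def wedge_class_def exterior_square_def
  by (intro quotientI single_free one_closed)

text \<open>Formal combinations are built up one pair at a time, and \<gamma> is linear. In the end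
  this turns the surjectivity of \<gamma> into a nonzero value of the form.\<close>

lemma gamma_zero_if_form_zero:
  assumes "\<And>x y. x \<in> M \<Longrightarrow> y \<in> M \<Longrightarrow> form x y = 0" "c \<in> exterior_square Z M"
  shows "\<gamma> c = 0"
proof -
  have "f \<in> free_module Z M \<Longrightarrow> \<gamma> (wedge_class Z M f) = 0" for f
  proof (induction f rule: update_induct)
    case const
    show ?case by (rule gamma_zero)
  next
    case (update f k a)
    let ?s = "Poly_Mapping.single k (1::'k)"
    have l0: "Poly_Mapping.lookup f k = 0" using update(1) by (simp add: in_keys_iff)
    have e: "Poly_Mapping.update k a f = f + scale a ?s"
    proof (rule poly_mapping_eqI)
      fix j
      show "Poly_Mapping.lookup (Poly_Mapping.update k a f) j = Poly_Mapping.lookup (f + scale a ?s) j"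
        by (cases "j = k") (simp_all add: lookup_update lookup_add lookup_scale lookup_single l0)
    qed
    have k: "k \<in> M \<times> M" using update(2,4) by (auto simp: free_module_def keys_update)
    have a: "a \<in> Z" using update(4) by (auto simp: free_module_def lookup_update dest: subsetD[OF _ rangeI, of _ _ k])
    have f: "f \<in> free_module Z M"
    proof -
      have "Poly_Mapping.lookup f j \<in> Z" for j
      proof (cases "j = k")
        case True
        then show ?thesis using l0 zero_closed by simp
      next
        case False
        then have "Poly_Mapping.lookup f j = Poly_Mapping.lookup (Poly_Mapping.update k a f) j"
          by (simp add: lookup_update)
        also have "\<dots> \<in> Z" using update(4) unfolding free_module_def by blast
        finally show ?thesis .
      qed
      moreover have "Poly_Mapping.keys f \<subseteq> M \<times> M"
        using update(2,4) by (auto simp: free_module_def keys_update)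
      ultimately show ?thesis by (auto simp: free_module_def)
    qed
    have s: "?s \<in> free_module Z M" using k by (cases k) (auto intro: single_free one_closed)
    have sa: "scale a ?s \<in> free_module Z M"
      using k a by (cases k) (auto simp: scale_single intro: single_free)
    have "\<gamma> (wedge_class Z M ?s) = 0"
      using k assms(1) by (cases k) (auto simp: form_def wedge_def)
    then show ?case
      unfolding e gamma_add[OF f sa] gamma_scale[OF a s] using update(3)[OF f] by simp
  qed
  then show ?thesis using assms(2) by (auto simp: exterior_square_def wedge_class_def elim!: quotientE)
qed

end

section \<open>Embedded $p$-adic integers\<close>

lemma padic_mod:
  assumes "x \<in> padic_ints p" "m \<le> n"
  shows "x n mod int p ^ m = x m"
  using assms(2)
proof (induction n)
  case 0
  have "x 0 \<in> {0..<int p ^ 0}" using assms(1) unfolding padic_ints_def by blast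
  then show ?case using 0 by simp
next
  case (Suc n)
  have x: "x (Suc n) mod int p ^ n = x n" "\<And>n. x n \<in> {0..<int p ^ n}" using assms(1) by (auto simp: padic_ints_def)
  show ?case
  proof (cases "m = Suc n")
    case True
    then show ?thesis using x(2)[of "Suc n"] by simp
  next
    case False
    then have m: "m \<le> n" using Suc.prems by simp
    then have "x (Suc n) mod int p ^ m = x (Suc n) mod int p ^ n mod int p ^ m"
      by (simp add: mod_mod_cancel le_imp_power_dvd)
    then show ?thesis using x Suc.IH[OF m] by simp
  qed
qed

lemma padic_intsI:
  assumes "p > 0" "\<And>n. 0 \<le> x n" "\<And>n. x n < int p ^ n" "\<And>n. x (Suc n) mod int p ^ n = x n"
  shows "x \<in> padic_ints p"
  using assms by (auto simp: padic_ints_def)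

lemma padic_ints_mod:
  assumes "p > 0" "\<And>n. [x (Suc n) = x n] (mod int p ^ n)"
  shows "(\<lambda>n. x n mod int p ^ n) \<in> padic_ints p"
proof (rule padic_intsI[OF assms(1)])
  fix n
  show "x (Suc n) mod int p ^ Suc n mod int p ^ n = x n mod int p ^ n"
    using assms(2)[of n] by (simp add: mod_mod_cancel cong_def)
qed (use assms(1) in auto)

locale padic_embedded =
  fixes p :: nat and \<iota> :: "(nat \<Rightarrow> int) \<Rightarrow> 'k::field"
  assumes prime_p: "prime p" and embedding: "padic_embedding p \<iota>"
begin

lemma p_pos: "p > 0"
  using prime_p by (simp add: prime_gt_0_nat)

lemma p_gt_1: "int p > 1"
  using prime_p prime_gt_1_nat by simp

lemma in_padic: "x \<in> padic_ints p \<Longrightarrow> [x (Suc n) = x n] (mod int p ^ n)"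
  using padic_mod[of x p n "Suc n"] padic_mod[of x p n n] by (simp add: cong_def)

lemma padic_bounds: "x \<in> padic_ints p \<Longrightarrow> 0 \<le> x n \<and> x n < int p ^ n"
  by (auto simp: padic_ints_def)

lemma add_padic: "x \<in> padic_ints p \<Longrightarrow> y \<in> padic_ints p \<Longrightarrow> padic_add p x y \<in> padic_ints p"
  unfolding padic_add_def by (intro padic_ints_mod p_pos cong_add in_padic)

lemma mult_padic: "x \<in> padic_ints p \<Longrightarrow> y \<in> padic_ints p \<Longrightarrow> padic_mult p x y \<in> padic_ints p"
  unfolding padic_mult_def by (intro padic_ints_mod p_pos cong_mult in_padic)

lemma one_padic: "padic_one p \<in> padic_ints p"
  unfolding padic_one_def by (intro padic_ints_mod p_pos cong_refl)

lemma iota_add: "x \<in> padic_ints p \<Longrightarrow> y \<in> padic_ints p \<Longrightarrow> \<iota> (padic_add p x y) = \<iota> x + \<iota> y"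
  and iota_mult: "x \<in> padic_ints p \<Longrightarrow> y \<in> padic_ints p \<Longrightarrow> \<iota> (padic_mult p x y) = \<iota> x * \<iota> y"
  and iota_one: "\<iota> (padic_one p) = 1"
  and iota_inj: "inj_on \<iota> (padic_ints p)"
  using embedding by (auto simp: padic_embedding_def)

definition const :: "int \<Rightarrow> nat \<Rightarrow> int" where "const a = (\<lambda>n. a mod int p ^ n)"

lemma const_padic: "const a \<in> padic_ints p"
  unfolding const_def by (intro padic_ints_mod p_pos cong_refl)

lemma iota_zero: "\<iota> (const 0) = 0"
proof -
  have "padic_add p (const 0) (const 0) = const 0" by (simp add: padic_add_def const_def)
  then have "\<iota> (const 0) = \<iota> (const 0) + \<iota> (const 0)"
    using iota_add[OF const_padic const_padic, of 0 0] by simp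
  then show ?thesis by (metis add_cancel_left_left)
qed

lemma iota_of_nat: "\<iota> (const (int k)) = of_nat k"
proof (induction k)
  case 0
  then show ?case by (simp add: iota_zero)
next
  case (Suc k)
  have "padic_add p (const (int k)) (padic_one p) = const (int (Suc k))"
    by (simp add: padic_add_def const_def padic_one_def mod_add_eq add.commute)
  then have "\<iota> (const (int (Suc k))) = \<iota> (const (int k)) + 1"
    using iota_add[OF const_padic one_padic] by (metis iota_one)
  then show ?case using Suc by simp
qed

lemma subring_image: "subring_set (\<iota> ` padic_ints p)"
proof
  show "1 \<in> \<iota> ` padic_ints p" using one_padic iota_one by (metis imageI)
  fix a assume "a \<in> \<iota> ` padic_ints p"
  then obtain x where x: "x \<in> padic_ints p" "a = \<iota> x" by blast
  define y where "y = (\<lambda>n. (- x n) mod int p ^ n)"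
  have y: "y \<in> padic_ints p"
    unfolding y_def using in_padic[OF x(1)] by (intro padic_ints_mod p_pos) (simp add: cong_minus_minus_iff)
  have "padic_add p x y = const 0"
    by (simp add: padic_add_def y_def const_def mod_add_right_eq)
  then have "a + \<iota> y = 0" using iota_add[OF x(1) y] x(2) iota_zero by simp
  then have "- a = \<iota> y" by (rule minus_unique)
  then show "- a \<in> \<iota> ` padic_ints p" using y by simp
next
  fix a b assume "a \<in> \<iota> ` padic_ints p" "b \<in> \<iota> ` padic_ints p"
  then obtain x y where xy: "x \<in> padic_ints p" "a = \<iota> x" "y \<in> padic_ints p" "b = \<iota> y" by blast
  show "a + b \<in> \<iota> ` padic_ints p" 
    by (rule image_eqI[OF _ add_padic[OF xy(1,3)]]) (simp add: iota_add xy)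
  show "a * b \<in> \<iota> ` padic_ints p" 
    by (rule image_eqI[OF _ mult_padic[OF xy(1,3)]]) (simp add: iota_mult xy)
qed

text \<open>The residues of (x - x 1) / p. Division by p costs one digit, hence the index
  \<open>Suc n\<close>.\<close>

definition shift :: "(nat \<Rightarrow> int) \<Rightarrow> nat \<Rightarrow> int" where "shift x = (\<lambda>n. x (Suc n) div int p)"

lemma shift_padic:
  assumes "x \<in> padic_ints p"
  shows "shift x \<in> padic_ints p"
proof (rule padic_intsI[OF p_pos])
  fix n
  have p0: "int p > 0" using p_pos by simp
  show "0 \<le> shift x n" using padic_bounds[OF assms, of "Suc n"] p0
    by (simp add: shift_def pos_imp_zdiv_nonneg_iff)
  have "int p * shift x n \<le> x (Suc n)"
    using div_mult_mod_eq[of "x (Suc n)" "int p"] pos_mod_sign[OF p0, of "x (Suc n)"]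
    unfolding shift_def mult.commute[of "int p"] by linarith
  also have "\<dots> < int p * int p ^ n" using padic_bounds[OF assms, of "Suc n"] by simp
  finally show "shift x n < int p ^ n" using p0 by simp
  have "shift x (Suc n) mod int p ^ n = (x (Suc (Suc n)) mod (int p * int p ^ n)) div int p"
    using p0 by (simp add: shift_def zmod_zmult2_eq)
  also have "x (Suc (Suc n)) mod (int p * int p ^ n) = x (Suc n)"
    using padic_mod[OF assms, of "Suc n" "Suc (Suc n)"] by simp
  finally show "shift x (Suc n) mod int p ^ n = shift x n" by (simp add: shift_def)
qed

lemma iota_shift:
  assumes "x \<in> padic_ints p"
  shows "\<iota> x = of_nat (nat (x 1)) + of_nat p * \<iota> (shift x)"
proof -
  have "padic_add p (const (x 1)) (padic_mult p (const (int p)) (shift x)) = x"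
  proof
    fix n
    have "x (Suc n) mod int p = x 1" using padic_mod[OF assms, of 1 "Suc n"] by simp
    then have "x 1 + int p * shift x n = x (Suc n)"
      using div_mult_mod_eq[of "x (Suc n)" "int p"] by (simp add: shift_def algebra_simps)
    moreover have "padic_add p (const (x 1)) (padic_mult p (const (int p)) (shift x)) n
      = (x 1 + int p * shift x n) mod int p ^ n"
      by (simp add: padic_add_def padic_mult_def const_def mod_simps)
    ultimately show "padic_add p (const (x 1)) (padic_mult p (const (int p)) (shift x)) n = x n"
      using padic_mod[OF assms, of n "Suc n"] by simp
  qed
  then have "\<iota> x = \<iota> (const (x 1)) + \<iota> (const (int p)) * \<iota> (shift x)"
    using iota_add[OF const_padic mult_padic[OF const_padic shift_padic[OF assms]]]
      iota_mult[OF const_padic shift_padic[OF assms]] by metis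
  moreover have "x 1 = int (nat (x 1))" using padic_bounds[OF assms, of 1] by simp
  ultimately show ?thesis by (metis iota_of_nat)
qed

text \<open>Inverses are chosen separately modulo every p^n; they are compatible because an inverse
  modulo p^n is unique.\<close>

lemma unit_padic:
  assumes "x \<in> padic_ints p" "x 1 \<noteq> 0"
  shows "inverse (\<iota> x) \<in> \<iota> ` padic_ints p"
proof -
  have cop: "coprime (x n) (int p ^ n)" for n
  proof (cases "n = 0")
    case False
    then have "x n mod int p = x 1" using padic_mod[OF assms(1), of 1 n] by simp
    then have "\<not> int p dvd x n" using assms(2) by (auto simp: dvd_eq_mod_eq_0)
    then have "coprime (int p) (x n)" using prime_p by (intro prime_imp_coprime) auto
    then show ?thesis by (simp add: coprime_commute)
  qed simp
  have "\<forall>n. \<exists>w. [x n * w = 1] (mod int p ^ n)"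
    using cop cong_solve_coprime_int by blast
  then obtain w where w: "\<And>n. [x n * w n = 1] (mod int p ^ n)" by metis
  define y where "y = (\<lambda>n. w n mod int p ^ n)"
  have y: "y \<in> padic_ints p"
    unfolding y_def
  proof (intro padic_ints_mod p_pos)
    fix n
    have "[x (Suc n) * w (Suc n) = 1] (mod int p ^ n)"
      using w[of "Suc n"] by (rule cong_dvd_modulus) simp
    moreover have "[x (Suc n) * w (Suc n) = x n * w (Suc n)] (mod int p ^ n)"
      by (intro cong_mult in_padic[OF assms(1)] cong_refl)
    ultimately have "[x n * w (Suc n) = x n * w n] (mod int p ^ n)"
      using w[of n] by (meson cong_sym cong_trans)
    then show "[w (Suc n) = w n] (mod int p ^ n)"
      using cop[of n] by (simp add: cong_mult_lcancel)
  qed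
  have "padic_mult p x y = padic_one p"
    using w by (simp add: padic_mult_def padic_one_def y_def fun_eq_iff mod_mult_right_eq cong_def)
  then have "\<iota> x * \<iota> y = 1" using iota_mult[OF assms(1) y] iota_one by simp
  then have "inverse (\<iota> x) = \<iota> y" by (rule inverse_unique)
  then show ?thesis using y by simp
qed

text \<open>If the residue modulo p is 0, a factor p is split off by \<open>shift\<close>, which
  lowers the index m of a nonzero residue by one.\<close>

lemma factor_padic:
  assumes "x \<in> padic_ints p" "x m \<noteq> 0"
  shows "\<exists>n. \<exists>y\<in>\<iota> ` padic_ints p. \<iota> x = of_nat p ^ n * y \<and> inverse y \<in> \<iota> ` padic_ints p"
  using assms
proof (induction m arbitrary: x)
  case 0
  then show ?case using padic_bounds[of x 0] by simp
next
  case (Suc m)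
  show ?case
  proof (cases "x 1 = 0")
    case False
    then show ?thesis using Suc.prems unit_padic by (intro exI[of _ 0] bexI[of _ "\<iota> x"]) auto
  next
    case True
    have "x (Suc m) mod int p = 0" using padic_mod[OF Suc.prems(1), of 1 "Suc m"] True by simp
    then have "shift x m \<noteq> 0"
      using Suc.prems(2) div_mult_mod_eq[of "x (Suc m)" "int p"] by (auto simp: shift_def)
    from Suc.IH[OF shift_padic[OF Suc.prems(1)] this] obtain n y where
      y: "y \<in> \<iota> ` padic_ints p" "\<iota> (shift x) = of_nat p ^ n * y" "inverse y \<in> \<iota> ` padic_ints p"
      by (elim exE bexE conjE)
    have "\<iota> x = of_nat p ^ Suc n * y" using iota_shift[OF Suc.prems(1)] True y(2) by simp
    then show ?thesis using y(1,3) by (intro exI bexI conjI)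
  qed
qed

lemma cyclotomic_dvr:
  assumes "p \<ge> 5" "padic_cyclotomic_field p \<iota> \<theta>"
  shows "cyclotomic_dvr (\<iota> ` padic_ints p) p \<theta>"
proof -
  interpret subring_set "\<iota> ` padic_ints p" by (rule subring_image)
  show ?thesis
  proof
    show "prime p" by (rule prime_p)
    show "p \<ge> 5" by (rule assms(1))
    show "primitive_root_of_unity p \<theta>"
      "is_subfield hull (insert \<theta> (fractions (\<iota> ` padic_ints p))) = UNIV"
      using assms(2) by (auto simp: padic_cyclotomic_field_def)
  next
    fix z assume "z \<in> \<iota> ` padic_ints p"
    then obtain x where x: "x \<in> padic_ints p" "z = \<iota> x" by blast
    have "nat (x 1) < p" using padic_bounds[OF x(1), of 1] p_pos by (simp add: nat_less_iff)
    then show "\<exists>a<p. \<exists>y\<in>\<iota> ` padic_ints p. z = of_nat a + of_nat p * y"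
      unfolding x(2)
      by (intro exI[of _ "nat (x 1)"] conjI bexI[of _ "\<iota> (shift x)"] iota_shift imageI shift_padic x(1))
  next
    fix z assume "z \<in> \<iota> ` padic_ints p" "z \<noteq> 0"
    then obtain x where x: "x \<in> padic_ints p" "z = \<iota> x" by blast
    have "\<exists>m. x m \<noteq> 0"
    proof (rule ccontr)
      assume "\<not> (\<exists>m. x m \<noteq> 0)"
      then have "x = const 0" by (auto simp: const_def)
      then show False using x \<open>z \<noteq> 0\<close> iota_zero by simp
    qed
    then show "\<exists>n. \<exists>y\<in>\<iota> ` padic_ints p. z = of_nat p ^ n * y \<and> inverse y \<in> \<iota> ` padic_ints p"
      unfolding x(2) by (elim exE) (rule factor_padic[OF x(1)])
  next
    \<comment> \<open>Level 2 separates p from 0; at level 1 both are 0.\<close>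
    have "const (int p) 2 \<noteq> const 0 2"
      using p_gt_1 by (simp add: const_def power2_eq_square)
    then have "\<iota> (const (int p)) \<noteq> \<iota> (const 0)"
      using inj_onD[OF iota_inj _ const_padic const_padic] by metis
    then show p0: "of_nat p \<noteq> (0::'k)" by (simp add: iota_of_nat iota_zero)
    show "inverse (of_nat p) \<notin> \<iota> ` padic_ints p"
    proof
      assume "inverse (of_nat p) \<in> \<iota> ` padic_ints p"
      then obtain x where x: "x \<in> padic_ints p" "inverse (of_nat p) = \<iota> x" by blast
      have "\<iota> (padic_mult p (const (int p)) x) = \<iota> (padic_one p)"
        using p0 by (simp add: iota_mult[OF const_padic x(1)] iota_of_nat iota_one flip: x(2))
      then have "padic_mult p (const (int p)) x = padic_one p"
        by (rule inj_onD[OF iota_inj _ mult_padic[OF const_padic x(1)] one_padic])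
      \<comment> \<open>Level 1 is arithmetic modulo p, where the left-hand side is 0 and the
        right-hand side is 1.\<close>
      then have "padic_mult p (const (int p)) x 1 = padic_one p 1" by simp
      then show False using p_gt_1 by (simp add: padic_mult_def const_def padic_one_def)
    qed
  qed
qed

end

theorem theorem2:
  fixes p i :: nat
    and \<iota> :: "(nat \<Rightarrow> int) \<Rightarrow> 'k::field"
    and \<theta> :: 'k
    and Z :: "'k set"
    and \<gamma> :: "('k \<times> 'k \<Rightarrow>\<^sub>0 'k) set \<Rightarrow> 'k"
    and lam :: enat
  assumes "prime p" and "p \<ge> 5"
    and "padic_cyclotomic_field p \<iota> \<theta>"
    and "Z = \<iota> ` padic_ints p"
    and "\<gamma> \<in> surj_Hom_theta Z \<theta> i"
    and "lam = jacobi_exponent Z \<theta> i \<gamma>"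
  shows "finite (carrier (quot_struct Z \<theta> i lam \<gamma>)) \<and>
    (\<exists>l y :: nat. lam = enat l \<and> int l = 3 * int i + 13 - 2 * int p + int y) \<and>
    (\<exists>y :: nat. real (card (carrier (quot_struct Z \<theta> i lam \<gamma>)))
        = real p powi (2 * int i + 13 - 2 * int p + int y))"
proof -
  have "padic_embedded p \<iota>"
    using assms(1,3) by unfold_locales (simp_all add: padic_cyclotomic_field_def)
  then interpret D: cyclotomic_dvr Z p \<theta>
    using padic_embedded.cyclotomic_dvr[of p \<iota> \<theta>] assms(2,3,4) by simp
  define M where "M = D.pw (int i)"
  have ppow_i: "ppow Z \<theta> (enat i) = M" by (simp only: D.ppow_eq_pw M_def)
  have e1: "int (2 * i + 1) = 2 * int i + 1" by simp
  have \<gamma>: "\<gamma> \<in> exterior_square Z M \<rightarrow> D.pw (2 * int i + 1)" "wedge_linear Z M \<gamma>"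
    "\<And>x y. x \<in> M \<Longrightarrow> y \<in> M \<Longrightarrow> \<gamma> (wedge Z M (\<theta> * x) (\<theta> * y)) = \<theta> * \<gamma> (wedge Z M x y)"
    "\<gamma> ` exterior_square Z M = D.pw (2 * int i + 1)"
    using assms(5) unfolding surj_Hom_theta_def Hom_theta_def D.ppow_eq_pw e1 M_def[symmetric]
    by simp_all
  interpret W: submodule_form Z M \<gamma>
    by unfold_locales (use \<gamma>(2) D.Z_subset_A in \<open>auto simp: M_def intro: D.pw_add D.pw_A_mult\<close>)
  interpret F: theta_form Z p \<theta> i W.form
  proof unfold_locales
    show "D.Z_linear_on (D.pw (int i)) (\<lambda>u. W.form u v)" if "v \<in> D.pw (int i)" for v
      using that unfolding D.Z_linear_on_def M_def[symmetric]
      by (simp add: W.form_add_left W.form_scale_left)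
    show "D.Z_linear_on (D.pw (int i)) (W.form u)" if "u \<in> D.pw (int i)" for u
      using that unfolding D.Z_linear_on_def M_def[symmetric]
      by (simp add: W.form_add_right W.form_scale_right)
    show "W.form u u = 0" if "u \<in> D.pw (int i)" for u
      using that unfolding M_def[symmetric] by (rule W.form_alt)
    show "W.form (\<theta> * u) (\<theta> * v) = \<theta> * W.form u v" if "u \<in> D.pw (int i)" "v \<in> D.pw (int i)" for u v
      using that unfolding M_def[symmetric] W.form_def by (rule \<gamma>(3))
    show "W.form u v \<in> D.pw (2 * int i + 1)" if "u \<in> D.pw (int i)" "v \<in> D.pw (int i)" for u v
      using that unfolding M_def[symmetric] W.form_def
      by (intro funcset_mem[OF \<gamma>(1)] W.wedge_in_exterior_square)
  qed
  \<comment> \<open>By surjectivity \<gamma> attains the nonzero value \<kappa>^(2i + 1), so the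
    form cannot vanish on all pairs.\<close>
  have nz: "\<exists>u\<in>D.pw (int i). \<exists>v\<in>D.pw (int i). W.form u v \<noteq> 0"
  proof (rule ccontr)
    assume neg: "\<not> ?thesis"
    have form0: "W.form u v = 0" if "u \<in> M" "v \<in> M" for u v
      using neg that unfolding M_def by blast
    have "D.\<kappa> powi (2 * int i + 1) \<in> \<gamma> ` exterior_square Z M"
      unfolding \<gamma>(4) by (rule D.kappa_powi_in_pw)
    then obtain c where c: "c \<in> exterior_square Z M" "D.\<kappa> powi (2 * int i + 1) = \<gamma> c"
      by (rule imageE)
    have "\<gamma> c = 0" by (rule W.gamma_zero_if_form_zero[OF form0 c(1)])
    then show False using D.kappa_nonzero c(2) by simp
  qed
  obtain l where l: "is_ideal D.A hull {F.J u v w |u v w. u \<in> D.pw (int i) \<and> v \<in> D.pw (int i) \<and> w \<in> D.pw (int i)}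
      = D.pw (int l)" "3 * int i + 13 - 2 * int p \<le> int l" "2 * i + 1 \<le> l"
    by (rule F.J_ideal[OF nz])
  have "jacobi Z \<theta> i \<gamma> u v w = F.J u v w" for u v w
    unfolding jacobi_def Let_def ppow_i F.J_def W.form_def ..
  then have ideal: "jacobi_ideal Z \<theta> i \<gamma> = ppow Z \<theta> (enat l)"
    using l(1) unfolding jacobi_ideal_def D.max_order_eq ppow_i D.ppow_eq_pw M_def by simp
  have lam: "lam = enat l"
    unfolding assms(6) jacobi_exponent_def
  proof (rule the_equality)
    show "jacobi_ideal Z \<theta> i \<gamma> = ppow Z \<theta> (enat l)" by (rule ideal)
    show "l' = enat l" if "jacobi_ideal Z \<theta> i \<gamma> = ppow Z \<theta> l'" for l'
      using that ideal D.ppow_inj by simp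
  qed
  have carrier: "carrier (quot_struct Z \<theta> i lam \<gamma>) = D.pw (int i) // coset_rel (D.pw (int l))"
    unfolding lam quot_struct_def Let_def add_bracket.simps D.ppow_eq_pw ..
  have "i \<le> l" using l(3) by simp
  note card = D.card_quotient[OF this, folded carrier]
  define y where "y = nat (int l - (3 * int i + 13 - 2 * int p))"
  have y: "int l = 3 * int i + 13 - 2 * int p + int y" using l(2) by (simp add: y_def)
  \<comment> \<open>The order of the quotient is p^(l - i), so its exponent is that of \<lambda>
    lowered by i.\<close>
  have "2 * int i + 13 - 2 * int p + int y = int (l - i)" using y \<open>i \<le> l\<close> by simp
  then have "real (card (carrier (quot_struct Z \<theta> i lam \<gamma>))) = real p powi (2 * int i + 13 - 2 * int p + int y)"
    by (simp only: card(2) power_int_of_nat of_nat_power)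
  then show ?thesis using card(1) lam y by blast
qed

end
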